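(* Let $z=s-s^{-1}$ and $A(t)=1+z\sum_{m=1}^\infty A_mt^m$. Then, as power series in $t$ with coefficients in $\mathcal{C}$, $$A(t)=\frac{H(st)}{H(s^{-1}t)}=H(st)\,E(-s^{-1}t).$$
   Context: Coefficients: $\Lambda$ is $\mathbf{Z}[v^{\pm1},s^{\pm1}]$ with all $s^k-s^{-k}$ ($k\ge1$) inverted. Homfly skein: for a planar surface $F$ with designated input and output boundary points, $\mathcal{S}(F)$ is the $\Lambda$-module of linear combinations of oriented tangle diagrams in $F$ (arcs from inputs to outputs, and closed curves), up to isotopy fixing the boundary and Reidemeister moves II and III, modulo the local relations $X_+-X_-=z\,X_0$ (positive crossing minus negative crossing equals $z$ times the oriented smoothing) and (strand with one positive kink) $=v^{-1}\cdot$(strand). A disjoint null-homotopic simple loop contributes the scalar $(v^{-1}-v)/z$. $H_n$ is the skein of a rectangle with $n$ inputs at the bottom and $n$ outputs at the top, an algebra under composition of tangles; it is the Hecke algebra with generators $\sigma_1,\dots,\sigma_{n-1}$, braid relations and $\sigma_i^2=z\sigma_i+1$, where $\sigma_i$ is the braid with one positive crossing between strings $i,i+1$. $\mathcal{C}$ is the Homfly skein of the annulus (no boundary points), a commutative algebra under placing one annulus outside another. The closure of an $n$-tangle, obtained by joining outputs to inputs around the annulus so that strings run counterclockwise, induces a linear map $H_n\to\mathcal{C}$. $A_m\in\mathcal{C}$ is the closure of the $m$-braid $\sigma_{m-1}\cdots\sigma_2\sigma_1$ ($A_1$ is the closure of the single string). For $\pi\in S_n$ let $\omega_\pi\in H_n$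 be the positive permutation braid (the product of $\sigma_i$'s along a reduced word) and $l(\pi)$ its length. Put $a_n=\sum_{\pi}s^{l(\pi)}\omega_\pi$ and $b_n=\sum_\pi(-s)^{-l(\pi)}\omega_\pi$. Let $h_n\in\mathcal{C}$ be the closure of the idempotent $a_n/\sum_\pi s^{2l(\pi)}$ and $e_n\in\mathcal{C}$ the closure of the idempotent $b_n/\sum_\pi s^{-2l(\pi)}$. Set $H(t)=1+\sum_{n\ge1}h_nt^n$ and $E(t)=1+\sum_{n\ge1}e_nt^n$. *)

theory Defs
  imports "HOL-Computational_Algebra.Computational_Algebra" "HOL-Combinatorics.Permutations"
    "HOL-Library.Poly_Mapping"
begin

section \<open>The coefficient ring\<close>

text \<open>
  \<open>\<Lambda>\<close> is realised inside the field of fractions of \<open>\<int>[s][v]\<close>: the inner polynomial variable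
  is \<open>s\<close>, the outer one is \<open>v\<close>.
\<close>

definition frac_s :: "int poly poly fract" where
  "frac_s = Fract [:[:0, 1:]:] 1"

definition frac_v :: "int poly poly fract" where
  "frac_v = Fract [:0, 1:] 1"

inductive_set lam_carrier :: "int poly poly fract set" where
  one: "1 \<in> lam_carrier"
| s: "frac_s \<in> lam_carrier"
| s_inv: "inverse frac_s \<in> lam_carrier"
| v: "frac_v \<in> lam_carrier"
| v_inv: "inverse frac_v \<in> lam_carrier"
| loc: "k \<ge> 1 \<Longrightarrow> inverse (frac_s ^ k - inverse frac_s ^ k) \<in> lam_carrier"
| diff: "a \<in> lam_carrier \<Longrightarrow> b \<in> lam_carrier \<Longrightarrow> a - b \<in> lam_carrier"
| mult: "a \<in> lam_carrier \<Longrightarrow> b \<in> lam_carrier \<Longrightarrow> a * b \<in> lam_carrier"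

lemma lam_carrier_zero: "0 \<in> lam_carrier"
  using lam_carrier.diff[OF lam_carrier.one lam_carrier.one] by simp

lemma lam_carrier_uminus: "a \<in> lam_carrier \<Longrightarrow> - a \<in> lam_carrier"
  using lam_carrier.diff[OF lam_carrier_zero] by fastforce

lemma lam_carrier_add: "a \<in> lam_carrier \<Longrightarrow> b \<in> lam_carrier \<Longrightarrow> a + b \<in> lam_carrier"
  using lam_carrier.diff[OF _ lam_carrier_uminus] by fastforce

typedef lam = lam_carrier
  morphisms frac_of_lam Abs_lam
  using lam_carrier.one by blast

setup_lifting type_definition_lam

instantiation lam :: idom
begin

lift_definition zero_lam :: lam is 0 by (rule lam_carrier_zero)
lift_definition one_lam :: lam is 1 by (rule lam_carrier.one)
lift_definition plus_lam :: "lam \<Rightarrow> lam \<Rightarrow> lam" is "(+)" by (rule lam_carrier_add)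
lift_definition minus_lam :: "lam \<Rightarrow> lam \<Rightarrow> lam" is "(-)" by (rule lam_carrier.diff)
lift_definition uminus_lam :: "lam \<Rightarrow> lam" is uminus by (rule lam_carrier_uminus)
lift_definition times_lam :: "lam \<Rightarrow> lam \<Rightarrow> lam" is "(*)" by (rule lam_carrier.mult)

instance
  by standard (transfer; simp add: algebra_simps)+

end

text \<open>The inverse of a unit of \<open>\<Lambda>\<close>; non-units are sent to \<open>0\<close>.\<close>

instantiation lam :: inverse
begin

lift_definition inverse_lam :: "lam \<Rightarrow> lam"
  is "\<lambda>x. if inverse x \<in> lam_carrier then inverse x else 0"
  by (auto intro: lam_carrier_zero)

definition divide_lam :: "lam \<Rightarrow> lam \<Rightarrow> lam" where
  "divide_lam x y = x * inverse y"

instance ..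

end

lift_definition var_s :: lam is frac_s by (rule lam_carrier.s)
lift_definition var_v :: lam is frac_v by (rule lam_carrier.v)

definition var_z :: lam where
  "var_z = var_s - inverse var_s"

lemma lam_inverse_unit:
  fixes x y :: lam
  assumes "x * y = 1"
  shows "inverse x = y"
  using assms
proof transfer
  fix x y :: "int poly poly fract"
  assume "y \<in> lam_carrier" "x * y = 1"
  moreover from this have "inverse x = y"
    by (metis inverse_unique)
  ultimately show "(if inverse x \<in> lam_carrier then inverse x else 0) = y" by simp
qed

lemma frac_s_power: "frac_s ^ k = Fract [:[:0, 1:] ^ k:] 1"
  by (induction k) (auto simp: frac_s_def One_fract_def one_pCons)

lemma frac_s_nz: "frac_s \<noteq> 0"
  by (simp add: frac_s_def Zero_fract_def eq_fract)

lemma frac_v_nz: "frac_v \<noteq> 0"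
  by (simp add: frac_v_def Zero_fract_def eq_fract)

lemma monom_01: "[:0, 1::int:] ^ k = monom 1 k"
  by (simp add: monom_altdef)

lemma frac_s_power_neq_1:
  assumes "k \<ge> 1" shows "frac_s ^ k \<noteq> 1"
proof
  assume "frac_s ^ k = 1"
  hence "[:0, 1::int:] ^ k = 1" by (simp add: frac_s_power One_fract_def eq_fract one_pCons)
  hence "coeff (monom (1::int) k) k = coeff (1::int poly) k" by (simp add: monom_01)
  with assms show False by (simp)
qed

lemma frac_loc_nz:
  assumes "k \<ge> 1" shows "frac_s ^ k - inverse frac_s ^ k \<noteq> 0"
proof
  assume "frac_s ^ k - inverse frac_s ^ k = 0"
  hence "frac_s ^ k * frac_s ^ k = 1"
    using frac_s_nz by (simp add: power_inverse field_simps)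
  hence "frac_s ^ (k + k) = 1" by (simp add: power_add)
  with frac_s_power_neq_1[of "k + k"] assms show False by simp
qed

lemma var_s_inverse [simp]: "var_s * inverse var_s = 1" "inverse var_s * var_s = 1"
  by (transfer, simp add: frac_s_nz lam_carrier.s_inv)+

lemma var_v_inverse [simp]: "var_v * inverse var_v = 1" "inverse var_v * var_v = 1"
  by (transfer, simp add: frac_v_nz lam_carrier.v_inv)+

lemma lam_loc_inverse:
  assumes "k \<ge> 1"
  shows "(var_s ^ k - inverse var_s ^ k) * inverse (var_s ^ k - inverse var_s ^ k) = 1"
proof -
  have 1: "frac_of_lam (var_s ^ k) = frac_s ^ k"
    by (induction k) (simp_all add: one_lam.rep_eq times_lam.rep_eq var_s.rep_eq)
  have 2: "frac_of_lam (inverse var_s ^ k) = inverse frac_s ^ k"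
    by (induction k) (simp_all add: one_lam.rep_eq times_lam.rep_eq inverse_lam.rep_eq
          var_s.rep_eq lam_carrier.s_inv)
  show ?thesis
    by (subst frac_of_lam_inject[symmetric])
      (simp add: 1 2 times_lam.rep_eq inverse_lam.rep_eq minus_lam.rep_eq one_lam.rep_eq
         lam_carrier.loc[OF assms] frac_loc_nz[OF assms, simplified])
qed

text \<open>
  The specialisation \<open>v = s\<^sup>-\<^sup>1\<close>, used below only to see that the skein of the annulus
  is not zero.
\<close>

definition emb :: "int poly \<Rightarrow> int poly fract" where
  "emb p = Fract p 1"

lemma emb_hom: "emb 0 = 0" "emb 1 = 1" "emb (a + b) = emb a + emb b" "emb (a * b) = emb a * emb b"
   "emb (- a) = - emb a"
  by (simp_all add: emb_def Zero_fract_def One_fract_def)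

definition spec_poly :: "int poly poly \<Rightarrow> int poly fract" where
  "spec_poly p = poly (map_poly emb p) (inverse (emb [:0, 1:]))"

lemma spec_poly_add: "spec_poly (p + q) = spec_poly p + spec_poly q"
proof -
  have "map_poly emb (p + q) = map_poly emb p + map_poly emb q"
    by (intro poly_eqI) (simp add: coeff_map_poly emb_hom)
  thus ?thesis by (simp add: spec_poly_def)
qed

lemma spec_poly_minus: "spec_poly (- p) = - spec_poly p"
proof -
  have "map_poly emb (- p) = - map_poly emb p"
    by (intro poly_eqI) (simp add: coeff_map_poly emb_hom)
  thus ?thesis by (simp add: spec_poly_def)
qed

lemma emb_sum: "emb (sum f A) = (\<Sum>x\<in>A. emb (f x))"
  by (induction A rule: infinite_finite_induct) (simp_all add: emb_hom)

lemma spec_poly_mult: "spec_poly (p * q) = spec_poly p * spec_poly q"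
proof -
  have "map_poly emb (p * q) = map_poly emb p * map_poly emb q"
    by (intro poly_eqI) (simp add: coeff_map_poly emb_hom coeff_mult emb_sum)
  thus ?thesis by (simp add: spec_poly_def)
qed

lemma spec_poly_1: "spec_poly 1 = 1"
  by (simp add: spec_poly_def map_poly_1 emb_hom)

lemma spec_poly_0: "spec_poly 0 = 0"
  by (simp add: spec_poly_def)

definition spec_rel :: "int poly poly fract \<Rightarrow> int poly fract \<Rightarrow> bool" where
  "spec_rel x y \<longleftrightarrow> (\<exists>p q. x = Fract p q \<and> spec_poly q \<noteq> 0 \<and> y = spec_poly p / spec_poly q)"

lemma spec_nz: "spec_poly q \<noteq> 0 \<Longrightarrow> q \<noteq> 0"
  using spec_poly_0 by blast

lemma spec_rel_fun:
  assumes "spec_rel x y" "spec_rel x y'" shows "y = y'"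
proof -
  obtain p q p' q' where *: "x = Fract p q" "spec_poly q \<noteq> 0" "y = spec_poly p / spec_poly q"
    "x = Fract p' q'" "spec_poly q' \<noteq> 0" "y' = spec_poly p' / spec_poly q'"
    using assms unfolding spec_rel_def by metis
  hence "p * q' = p' * q" using spec_nz by (metis eq_fract(1))
  hence "spec_poly p * spec_poly q' = spec_poly p' * spec_poly q" by (metis spec_poly_mult)
  with * show ?thesis by (simp add: frac_eq_eq)
qed

lemma spec_rel_mult: "spec_rel x y \<Longrightarrow> spec_rel x' y' \<Longrightarrow> spec_rel (x * x') (y * y')"
  unfolding spec_rel_def
  by (elim exE conjE, rule_tac x = "p * pa" in exI, rule_tac x = "q * qa" in exI)
    (simp add: spec_poly_mult)

lemma spec_rel_minus: "spec_rel x y \<Longrightarrow> spec_rel (- x) (- y)"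
  unfolding spec_rel_def
  by (elim exE conjE, rule_tac x = "- p" in exI, rule_tac x = "q" in exI)
    (simp add: spec_poly_minus)

lemma spec_rel_add: 
  assumes "spec_rel x y" "spec_rel x' y'" shows "spec_rel (x + x') (y + y')"
proof -
  obtain p q p' q' where *: "x = Fract p q" "spec_poly q \<noteq> 0" "y = spec_poly p / spec_poly q"
    "x' = Fract p' q'" "spec_poly q' \<noteq> 0" "y' = spec_poly p' / spec_poly q'"
    using assms unfolding spec_rel_def by metis
  hence "x + x' = Fract (p * q' + p' * q) (q * q')" using spec_nz by (metis add_fract)
  moreover have "y + y' = spec_poly (p * q' + p' * q) / spec_poly (q * q')"
    using * by (simp add: spec_poly_add spec_poly_mult add_frac_eq)
  ultimately show ?thesis using * unfolding spec_rel_def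
    by (metis mult_eq_0_iff spec_poly_mult)
qed

lemma spec_rel_diff: "spec_rel x y \<Longrightarrow> spec_rel x' y' \<Longrightarrow> spec_rel (x - x') (y - y')"
  using spec_rel_add[of x y "- x'" "- y'"] spec_rel_minus[of x' y'] by simp

lemma spec_rel_inverse: "spec_rel x y \<Longrightarrow> y \<noteq> 0 \<Longrightarrow> spec_rel (inverse x) (inverse y)"
  unfolding spec_rel_def
  by (elim exE conjE, rule_tac x = q in exI, rule_tac x = p in exI) simp

lemma spec_rel_poly: "spec_rel (Fract p 1) (spec_poly p)"
  unfolding spec_rel_def by (rule exI[of _ p], rule exI[of _ 1]) (simp add: spec_poly_1)

definition spec_s :: "int poly fract" where "spec_s = emb [:0, 1:]"

lemma spec_s_nz: "spec_s \<noteq> 0"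
  by (simp add: spec_s_def emb_def Zero_fract_def eq_fract)

lemma spec_rel_s: "spec_rel frac_s spec_s"
  using spec_rel_poly[of "[:[:0, 1:]:]"]
  by (simp add: frac_s_def spec_s_def spec_poly_def map_poly_pCons emb_hom)

lemma spec_rel_v: "spec_rel frac_v (inverse spec_s)"
  using spec_rel_poly[of "[:0, 1:]"]
  by (simp add: frac_v_def spec_s_def spec_poly_def map_poly_pCons emb_hom)

lemma spec_rel_1: "spec_rel 1 1"
  using spec_rel_poly[of 1] by (simp add: One_fract_def[symmetric] spec_poly_1)

lemma spec_rel_power: "spec_rel x y \<Longrightarrow> spec_rel (x ^ k) (y ^ k)"
  by (induction k) (auto intro: spec_rel_mult spec_rel_1)

lemma spec_loc_nz:
  assumes "k \<ge> 1" shows "spec_s ^ k - inverse spec_s ^ k \<noteq> 0"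
proof
  assume "spec_s ^ k - inverse spec_s ^ k = 0"
  hence "spec_s ^ k * spec_s ^ k = 1"
    using spec_s_nz by (simp add: power_inverse field_simps)
  hence "spec_s ^ (k + k) = 1" by (simp add: power_add)
  moreover have "spec_s ^ j = emb ([:0, 1:] ^ j)" for j
    by (induction j) (simp_all add: spec_s_def emb_def One_fract_def)
  ultimately have "[:0, 1::int:] ^ (k + k) = 1" by (simp add: emb_def One_fract_def eq_fract)
  hence "coeff (monom (1::int) (k + k)) (k + k) = coeff (1::int poly) (k + k)"
    by (simp add: monom_01)
  with assms show False by simp
qed

lemma spec_rel_s_inv: "spec_rel (inverse frac_s) (inverse spec_s)"
  using spec_rel_inverse[OF spec_rel_s spec_s_nz] .

lemma spec_rel_v_inv: "spec_rel (inverse frac_v) spec_s"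
  using spec_rel_inverse[OF spec_rel_v] spec_s_nz by simp

lemma spec_rel_total: "x \<in> lam_carrier \<Longrightarrow> \<exists>y. spec_rel x y"
proof (induction rule: lam_carrier.induct)
  case one
  show ?case by (rule exI, rule spec_rel_1)
next
  case s
  show ?case by (rule exI, rule spec_rel_s)
next
  case s_inv
  show ?case by (rule exI, rule spec_rel_s_inv)
next
  case v
  show ?case by (rule exI, rule spec_rel_v)
next
  case v_inv
  show ?case by (rule exI, rule spec_rel_v_inv)
next
  case (loc k)
  show ?case
    by (rule exI, rule spec_rel_inverse[OF spec_rel_diff[OF spec_rel_power[OF spec_rel_s]
      spec_rel_power[OF spec_rel_s_inv]] spec_loc_nz[OF loc]])
next
  case (diff a b)
  thus ?case using spec_rel_diff by metis
next
  case (mult a b)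
  thus ?case using spec_rel_mult by metis
qed

definition spec :: "lam \<Rightarrow> int poly fract" where
  "spec x = (THE y. spec_rel (frac_of_lam x) y)"

lemma spec_eqI: "spec_rel (frac_of_lam x) y \<Longrightarrow> spec x = y"
  unfolding spec_def using spec_rel_fun by blast

lemma spec_rel_spec: "spec_rel (frac_of_lam x) (spec x)"
  using spec_rel_total[OF frac_of_lam] spec_eqI by blast

lemma spec_hom:
  "spec 0 = 0" "spec 1 = 1" "spec (x + y) = spec x + spec y" "spec (x * y) = spec x * spec y"
  "spec (- x) = - spec x" "spec (x - y) = spec x - spec y"
proof -
  show one: "spec 1 = 1" by (intro spec_eqI) (simp add: one_lam.rep_eq spec_rel_1)
  show "spec (x + y) = spec x + spec y"
    by (intro spec_eqI) (simp add: plus_lam.rep_eq spec_rel_add spec_rel_spec)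
  show mult: "spec (x * y) = spec x * spec y" for x y
    by (intro spec_eqI) (simp add: times_lam.rep_eq spec_rel_mult spec_rel_spec)
  show "spec (- x) = - spec x"
    by (intro spec_eqI) (simp add: uminus_lam.rep_eq spec_rel_minus spec_rel_spec)
  show diff: "spec (x - y) = spec x - spec y" for x y
    by (intro spec_eqI) (simp add: minus_lam.rep_eq spec_rel_diff spec_rel_spec)
  show "spec 0 = 0" using diff[of 1 1] by simp
qed

lemma spec_inverse: "x * inverse x = 1 \<Longrightarrow> spec (inverse x) = inverse (spec x)"
  using inverse_unique[of "spec x" "spec (inverse x)"] by (simp add: spec_hom(2) spec_hom(4)[symmetric])

lemma spec_var:
  "spec var_s = spec_s" "spec (inverse var_s) = inverse spec_s"
  "spec var_v = inverse spec_s" "spec (inverse var_v) = spec_s"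
  "spec var_z = spec_s - inverse spec_s"
proof -
  show 1: "spec var_s = spec_s" by (intro spec_eqI) (simp add: var_s.rep_eq spec_rel_s)
  show 2: "spec var_v = inverse spec_s" by (intro spec_eqI) (simp add: var_v.rep_eq spec_rel_v)
  show 3: "spec (inverse var_s) = inverse spec_s" by (simp add: spec_inverse 1)
  show "spec (inverse var_v) = spec_s" by (simp add: spec_inverse 2)
  show "spec var_z = spec_s - inverse spec_s" by (simp add: var_z_def spec_hom 1 3)
qed

lemma var_z_inverse: "var_z * inverse var_z = 1"
  using lam_loc_inverse[of 1] by (simp add: var_z_def)

lemma spec_loop: "spec ((inverse var_v - var_v) / var_z) = 1"
  using spec_loc_nz[of 1]
  by (simp add: divide_lam_def spec_hom spec_inverse[OF var_z_inverse] spec_var)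

section \<open>Free modules\<close>

text \<open>The free \<open>\<Lambda>\<close>-module on \<open>'d\<close> is \<open>'d \<Rightarrow>\<^sub>0 lam\<close>; the basis element of \<open>D\<close> is \<open>single D 1\<close>.\<close>

definition free_scale :: "lam \<Rightarrow> ('d \<Rightarrow>\<^sub>0 lam) \<Rightarrow> ('d \<Rightarrow>\<^sub>0 lam)" where
  "free_scale c x = Poly_Mapping.map ((*) c) x"

lemma lookup_free_scale [simp]:
  "Poly_Mapping.lookup (free_scale c x) k = c * Poly_Mapping.lookup x k"
  by (simp add: free_scale_def Poly_Mapping.map.rep_eq when_def)

interpretation free: module free_scale
  by standard (auto intro!: poly_mapping_eqI simp: lookup_add algebra_simps)

lemma free_scale_single [simp]:
  "free_scale c (Poly_Mapping.single k a) = Poly_Mapping.single k (c * a)"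
  by (intro poly_mapping_eqI) (simp add: lookup_single when_def)

lemma ext_add:
  fixes \<phi> :: "'d \<Rightarrow> 'b::monoid_add \<Rightarrow> 'c::comm_monoid_add"
  assumes add: "\<And>k a b. \<phi> k (a + b) = \<phi> k a + \<phi> k b" and zero: "\<And>k. \<phi> k 0 = 0"
  shows "(\<Sum>k\<in>Poly_Mapping.keys (x + y). \<phi> k (Poly_Mapping.lookup (x + y) k)) =
    (\<Sum>k\<in>Poly_Mapping.keys x. \<phi> k (Poly_Mapping.lookup x k)) +
    (\<Sum>k\<in>Poly_Mapping.keys y. \<phi> k (Poly_Mapping.lookup y k))"
proof -
  let ?A = "Poly_Mapping.keys x \<union> Poly_Mapping.keys y"
  have *: "(\<Sum>k\<in>Poly_Mapping.keys u. \<phi> k (Poly_Mapping.lookup u k)) =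
      (\<Sum>k\<in>?A. \<phi> k (Poly_Mapping.lookup u k))" if "Poly_Mapping.keys u \<subseteq> ?A" for u
    using that by (intro sum.mono_neutral_left) (auto simp: in_keys_iff zero)
  show ?thesis
    by (subst (1 2 3) *) (auto simp: lookup_add add sum.distrib dest: Poly_Mapping.keys_add[THEN subsetD])
qed

lemma free_sum_single:
  fixes x :: "'d \<Rightarrow>\<^sub>0 'b::comm_monoid_add"
  shows "x = (\<Sum>k\<in>Poly_Mapping.keys x. Poly_Mapping.single k (Poly_Mapping.lookup x k))"
  by (intro poly_mapping_eqI) (auto simp: lookup_sum lookup_single when_def in_keys_iff)

lemma free_induct [case_names zero add]:
  fixes x :: "'d \<Rightarrow>\<^sub>0 lam"
  assumes "P 0" and "\<And>k c y. P y \<Longrightarrow> P (Poly_Mapping.single k c + y)"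
  shows "P x"
proof -
  have "P (\<Sum>k\<in>A. Poly_Mapping.single k (f k))" if "finite A" for A and f :: "'d \<Rightarrow> lam"
    using that by (induction A rule: finite_induct) (auto intro: assms)
  thus ?thesis by (subst free_sum_single) simp
qed

text \<open>The linear map between free modules extending a map between bases.\<close>

definition free_map :: "('d \<Rightarrow> 'e) \<Rightarrow> ('d \<Rightarrow>\<^sub>0 lam) \<Rightarrow> ('e \<Rightarrow>\<^sub>0 lam)" where
  "free_map g x = (\<Sum>k\<in>Poly_Mapping.keys x. Poly_Mapping.single (g k) (Poly_Mapping.lookup x k))"

lemma free_map_0 [simp]: "free_map g 0 = 0"
  by (simp add: free_map_def)

lemma free_map_add: "free_map g (x + y) = free_map g x + free_map g y"
  unfolding free_map_def by (rule ext_add) (simp_all add: single_add)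

lemma free_map_single [simp]: "free_map g (Poly_Mapping.single k a) = Poly_Mapping.single (g k) a"
  by (simp add: free_map_def)

lemma free_map_scale: "free_map g (free_scale c x) = free_scale c (free_map g x)"
  by (induction x rule: free_induct)
    (simp_all add: free_map_add free.scale_right_distrib)

lemma free_map_minus: "free_map g (- x) = - free_map g x"
  using free_map_add[of g x "- x"] by (simp add: minus_unique)

lemma free_map_diff: "free_map g (x - y) = free_map g x - free_map g y"
  using free_map_add[of g x "- y"] by (simp add: free_map_minus)

lemma free_map_span:
  assumes "x \<in> free.span A" "\<And>r. r \<in> A \<Longrightarrow> free_map g r \<in> free.span B"
  shows "free_map g x \<in> free.span B"
  using assms(1)
  by (induction rule: free.span_induct_alt)
    (auto simp: free_map_add free_map_scale intro: free.span_add free.span_scale free.span_zero assms(2))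

section \<open>Oriented tangle diagrams\<close>

text \<open>
  A diagram in a rectangle, in general position with respect to the height function, is cut
  by horizontal lines into slices each of which contains exactly one crossing, local minimum
  (cup) or local maximum (cap), all other strings being vertical. It is recorded by the
  directions of the strings along its bottom edge, read from left to right, and by the
  sequence of its slices, read from bottom to top. The natural number of an event counts the
  strings to the left of it. In \<open>Crossing i b\<close> the flag \<open>b\<close> says that the string running from
  bottom left to top right is the upper one. In \<open>Cup i a\<close> the left one of the two new strings
  has direction \<open>a\<close>.
\<close>

datatype dir = Up | Down

fun opp :: "dir \<Rightarrow> dir" where
  "opp Up = Down"
| "opp Down = Up"

datatype event = Crossing nat bool | Cup nat dir | Cap nat

fun admissible :: "dir list \<Rightarrow> event \<Rightarrow> bool" where
  "admissible P (Crossing i b) \<longleftrightarrow> i + 1 < length P"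
| "admissible P (Cup i a) \<longleftrightarrow> i \<le> length P"
| "admissible P (Cap i) \<longleftrightarrow> i + 1 < length P \<and> P ! (i + 1) = opp (P ! i)"

fun after :: "dir list \<Rightarrow> event \<Rightarrow> dir list" where
  "after P (Crossing i b) = take i P @ [P ! (i + 1), P ! i] @ drop (i + 2) P"
| "after P (Cup i a) = take i P @ [a, opp a] @ drop i P"
| "after P (Cap i) = take i P @ drop (i + 2) P"

text \<open>\<open>tangle P w Q\<close>: \<open>w\<close> is a diagram with bottom edge \<open>P\<close> and top edge \<open>Q\<close>.\<close>

fun tangle :: "dir list \<Rightarrow> event list \<Rightarrow> dir list \<Rightarrow> bool" where
  "tangle P [] Q \<longleftrightarrow> P = Q"
| "tangle P (e # w) Q \<longleftrightarrow> admissible P e \<and> tangle (after P e) w Q"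

fun pos :: "event \<Rightarrow> nat" where
  "pos (Crossing i b) = i"
| "pos (Cup i a) = i"
| "pos (Cap i) = i"

fun legs_below :: "event \<Rightarrow> nat" where
  "legs_below (Crossing i b) = 2"
| "legs_below (Cup i a) = 0"
| "legs_below (Cap i) = 2"

fun legs_above :: "event \<Rightarrow> nat" where
  "legs_above (Crossing i b) = 2"
| "legs_above (Cup i a) = 2"
| "legs_above (Cap i) = 0"

fun shift :: "nat \<Rightarrow> event \<Rightarrow> event" where
  "shift k (Crossing i b) = Crossing (k + i) b"
| "shift k (Cup i a) = Cup (k + i) a"
| "shift k (Cap i) = Cap (k + i)"

text \<open>
  The elementary moves. The first five generate isotopy of diagrams in the plane: interchanging
  the heights of two events that lie side by side (\<open>f\<close> to the right of \<open>e\<close>), cancelling a local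
  minimum against an adjacent local maximum, and turning a crossing past a local minimum or
  maximum. The remaining two are the Reidemeister moves II and III; in \<open>R3\<close> the flags \<open>a\<close>, \<open>b\<close>,
  \<open>c\<close> belong to the pairs of strings \<open>(1,2)\<close>, \<open>(1,3)\<close>, \<open>(2,3)\<close> and the side condition says that
  the three strings are not cyclically above each other. Orientations enter through the
  requirement, in the relations below, that both sides are diagrams with the same edges.
\<close>

inductive diagram_move :: "event list \<Rightarrow> event list \<Rightarrow> bool" where
  interchange: "diagram_move [e, shift (pos e + legs_above e) f] [shift (pos e + legs_below e) f, e]"
| zigzag_left: "diagram_move [Cup i a, Cap (i + 1)] []"
| zigzag_right: "diagram_move [Cup (i + 1) a, Cap i] []"
| turn_cup: "diagram_move [Cup i a, Crossing (i + 1) b] [Cup (i + 1) a, Crossing i (\<not> b)]"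
| turn_cap: "diagram_move [Crossing i b, Cap (i + 1)] [Crossing (i + 1) (\<not> b), Cap i]"
| R2: "diagram_move [Crossing i b, Crossing i (\<not> b)] []"
| R3: "\<not> (a = c \<and> b \<noteq> a) \<Longrightarrow>
    diagram_move [Crossing i a, Crossing (i + 1) b, Crossing i c]
      [Crossing (i + 1) c, Crossing i b, Crossing (i + 1) a]"

text \<open>
  The relations that replace one local diagram with edges \<open>P\<close>, \<open>Q\<close> by others; \<open>D w\<close> is the
  complete diagram into which \<open>w\<close> has been inserted. A crossing of two strings that are both
  directed upwards or both directed downwards is positive if the string running from bottom left
  to top right is the upper one; every other crossing can be turned into this position. In the
  two kinks the crossing is of this kind, by the directions forced on the strings.
\<close>

inductive_set local_relations :: "(event list \<Rightarrow> 'd) \<Rightarrow> dir list \<Rightarrow> dir list \<Rightarrow> ('d \<Rightarrow>\<^sub>0 lam) set"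
  for D :: "event list \<Rightarrow> 'd" and P Q :: "dir list" where
  move: "diagram_move l r \<Longrightarrow> tangle P l Q \<Longrightarrow> tangle P r Q \<Longrightarrow>
    Poly_Mapping.single (D l) 1 - Poly_Mapping.single (D r) 1 \<in> local_relations D P Q"
| skein: "tangle P [Crossing i True] Q \<Longrightarrow> Q = P \<Longrightarrow>
    Poly_Mapping.single (D [Crossing i True]) 1 - Poly_Mapping.single (D [Crossing i False]) 1
      - Poly_Mapping.single (D []) var_z \<in> local_relations D P Q"
| kink_right: "tangle P [Cup (i + 1) a, Crossing i True, Cap (i + 1)] Q \<Longrightarrow> Q = P \<Longrightarrow>
    Poly_Mapping.single (D [Cup (i + 1) a, Crossing i True, Cap (i + 1)]) 1
      - Poly_Mapping.single (D []) (inverse var_v) \<in> local_relations D P Q"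
| kink_left: "tangle P [Cup i a, Crossing (i + 1) True, Cap i] Q \<Longrightarrow> Q = P \<Longrightarrow>
    Poly_Mapping.single (D [Cup i a, Crossing (i + 1) True, Cap i]) 1
      - Poly_Mapping.single (D []) (inverse var_v) \<in> local_relations D P Q"
| loop: "tangle P [Cup i a, Cap i] Q \<Longrightarrow> Q = P \<Longrightarrow>
    Poly_Mapping.single (D [Cup i a, Cap i]) 1
      - Poly_Mapping.single (D []) ((inverse var_v - var_v) / var_z) \<in> local_relations D P Q"

lemma opp_opp [simp]: "opp (opp a) = a"
  by (cases a) auto

lemma tangle_append: "tangle P (u @ v) Q \<longleftrightarrow> (\<exists>R. tangle P u R \<and> tangle R v Q)"
  by (induction u arbitrary: P) auto

lemma tangle_appendI: "tangle P u R \<Longrightarrow> tangle R v Q \<Longrightarrow> tangle P (u @ v) Q"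
  by (auto simp: tangle_append)

lemma tangle_unique: "tangle P u Q \<Longrightarrow> tangle P u R \<Longrightarrow> Q = R"
  by (induction u arbitrary: P) auto

lemma admissible_right: "admissible P e \<Longrightarrow> admissible (P @ R) e"
  by (cases e) (auto simp: nth_append)

lemma after_right: "admissible P e \<Longrightarrow> after (P @ R) e = after P e @ R"
  by (cases e) (auto simp: nth_append)

lemma tangle_right: "tangle P w Q \<Longrightarrow> tangle (P @ R) w (Q @ R)"
  by (induction w arbitrary: P) (auto simp: admissible_right after_right)

lemma admissible_left: "admissible P e \<Longrightarrow> admissible (L @ P) (shift (length L) e)"
  by (cases e) (auto simp: nth_append)

lemma after_left: "admissible P e \<Longrightarrow> after (L @ P) (shift (length L) e) = L @ after P e"
  by (cases e) (auto simp: nth_append)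

lemma tangle_left: "tangle P w Q \<Longrightarrow> tangle (L @ P) (map (shift (length L)) w) (L @ Q)"
  by (induction w arbitrary: P) (auto simp: admissible_left after_left)

lemma shift_shift [simp]: "shift k (shift j e) = shift (k + j) e"
  by (cases e) auto

lemma shift_0 [simp]: "shift 0 e = e"
  by (cases e) auto

lemma shift_comp [simp]: "shift k \<circ> shift j = shift (k + j)"
  by (rule ext) simp

lemma shift_0_id [simp]: "shift 0 = id"
  by (rule ext) simp

lemma pos_shift [simp]: "pos (shift k e) = k + pos e"
  and legs_below_shift [simp]: "legs_below (shift k e) = legs_below e"
  and legs_above_shift [simp]: "legs_above (shift k e) = legs_above e"
  by (cases e; simp)+

lemma diagram_move_shift: "diagram_move l r \<Longrightarrow> diagram_move (map (shift k) l) (map (shift k) r)"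
proof (induction rule: diagram_move.induct)
  case (interchange e f)
  show ?case using diagram_move.interchange[of "shift k e" f] by (simp add: add.assoc)
next
  case (zigzag_left i a)
  show ?case using diagram_move.zigzag_left[of "k + i" a] by simp
next
  case (zigzag_right i a)
  show ?case using diagram_move.zigzag_right[of "k + i" a] by simp
next
  case (turn_cup i a b)
  show ?case using diagram_move.turn_cup[of "k + i" a b] by simp
next
  case (turn_cap i b)
  show ?case using diagram_move.turn_cap[of "k + i" b] by simp
next
  case (R2 i b)
  show ?case using diagram_move.R2[of "k + i" b] by simp
next
  case (R3 a c b i)
  show ?case using diagram_move.R3[OF R3, of "k + i"] by simp
qed

text \<open>Placing further strings beside a local relation gives a local relation again.\<close>

lemma local_relations_right:
  "r \<in> local_relations D P Q \<Longrightarrow> r \<in> local_relations D (P @ R) (Q @ R)"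
proof (induction rule: local_relations.induct)
  case (move l r)
  thus ?case by (intro local_relations.move tangle_right)
next
  case (skein i)
  thus ?case by (intro local_relations.skein tangle_right) auto
next
  case (kink_right i a)
  thus ?case by (intro local_relations.kink_right tangle_right) auto
next
  case (kink_left i a)
  thus ?case by (intro local_relations.kink_left tangle_right) auto
next
  case (loop i a)
  thus ?case by (intro local_relations.loop tangle_right) auto
qed

lemma local_relations_left:
  assumes "r \<in> local_relations D P Q"
    and g: "\<And>w. tangle P w Q \<Longrightarrow> g (D w) = D' (map (shift (length L)) w)"
  shows "free_map g r \<in> local_relations D' (L @ P) (L @ Q)"
  using assms(1)
proof (induction rule: local_relations.induct)
  case (move l r)
  show ?case
    using local_relations.move[OF diagram_move_shift[OF move(1)] tangle_left[OF move(2)]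
        tangle_left[OF move(3)], of D' ] g[OF move(2)] g[OF move(3)]
    by (simp add: free_map_diff)
next
  case (skein i)
  have "tangle P [Crossing i False] Q" using skein by simp
  hence "free_map g (Poly_Mapping.single (D [Crossing i True]) 1 -
      Poly_Mapping.single (D [Crossing i False]) 1 - Poly_Mapping.single (D []) var_z) =
    Poly_Mapping.single (D' [Crossing (length L + i) True]) 1 -
      Poly_Mapping.single (D' [Crossing (length L + i) False]) 1 - Poly_Mapping.single (D' []) var_z"
    using skein g[of "[Crossing i False]"] g[of "[Crossing i True]"] g[of "[]"]
    by (simp add: free_map_diff del: tangle.simps(2))
  thus ?case
    using local_relations.skein[of "L @ P" "length L + i" "L @ Q" D'] skein(2)
      tangle_left[OF skein(1), of L]
    by (simp del: tangle.simps)
next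
  case (kink_right i a)
  show ?case
    using local_relations.kink_right[of "L @ P" "length L + i" a "L @ Q" D'] kink_right(2)
      tangle_left[OF kink_right(1), of L] g[OF kink_right(1)] g[of "[]"]
    by (simp add: free_map_diff del: tangle.simps(2))
next
  case (kink_left i a)
  show ?case
    using local_relations.kink_left[of "L @ P" "length L + i" a "L @ Q" D'] kink_left(2)
      tangle_left[OF kink_left(1), of L] g[OF kink_left(1)] g[of "[]"]
    by (simp add: free_map_diff del: tangle.simps(2))
next
  case (loop i a)
  show ?case
    using local_relations.loop[of "L @ P" "length L + i" a "L @ Q" D'] loop(2)
      tangle_left[OF loop(1), of L] g[OF loop(1)] g[of "[]"]
    by (simp add: free_map_diff del: tangle.simps(2))
qed

lemma free_map_local_relations:
  assumes "r \<in> local_relations D P Q" and "\<And>w. tangle P w Q \<Longrightarrow> g (D w) = D' w"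
  shows "free_map g r \<in> local_relations D' P Q"
  using local_relations_left[of r D P Q g D' "[]"] assms by simp

section \<open>The skein of the annulus\<close>

text \<open>
  Cutting the annulus along a ray, in general position, turns a diagram in it into a diagram in a
  rectangle whose bottom and top edges agree. The vertical direction becomes the counterclockwise
  direction, and the left edge becomes the inner boundary circle. Here \<open>(S, w)\<close> has the
  intersection \<open>S\<close> with the ray.
\<close>

typedef annular = "{(S, w). tangle S w S}"
  by (rule exI[of _ "([], [])"]) simp

setup_lifting type_definition_annular

definition annular_of :: "dir list \<Rightarrow> event list \<Rightarrow> annular" where
  "annular_of S w = Abs_annular (S, w)"

lemma annular_cases:
  obtains S w where "D = annular_of S w" "tangle S w S"
proof -
  obtain S w where *: "Rep_annular D = (S, w)" by (cases "Rep_annular D")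
  with Rep_annular[of D] have "tangle S w S" by simp
  moreover from * have "D = annular_of S w"
    by (metis Rep_annular_inverse annular_of_def)
  ultimately show ?thesis using that by blast
qed

lemma Rep_annular_of: "tangle S w S \<Longrightarrow> Rep_annular (annular_of S w) = (S, w)"
  by (simp add: annular_of_def Abs_annular_inverse)

text \<open>\<open>D + D'\<close> is \<open>D\<close> together with \<open>D'\<close>, placed in an annulus outside that of \<open>D\<close>.\<close>

instantiation annular :: monoid_add
begin

lift_definition zero_annular :: annular is "([], [])" by simp

lift_definition plus_annular :: "annular \<Rightarrow> annular \<Rightarrow> annular"
  is "\<lambda>(S, u) (T, w). (S @ T, u @ map (shift (length S)) w)"
  by (auto intro!: tangle_appendI[OF tangle_right tangle_left])

instance
  by standard (transfer; auto)+

end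

lemma zero_annular_of: "(0 :: annular) = annular_of [] []"
  by (simp add: zero_annular_def annular_of_def)

lemma plus_annular_of:
  assumes "tangle S u S" "tangle T w T"
  shows "annular_of S u + annular_of T w = annular_of (S @ T) (u @ map (shift (length S)) w)"
  using assms by (simp add: plus_annular_def annular_of_def Abs_annular_inverse)

text \<open>
  Besides the local relations there is the freedom of choosing the ray: parts of the diagram may
  be moved across it.
\<close>

definition annular_relations :: "(annular \<Rightarrow>\<^sub>0 lam) set" where
  "annular_relations =
    (\<Union>{local_relations (\<lambda>w. annular_of S (u @ w @ v)) P Q | S P Q u v.
        tangle S u P \<and> tangle Q v S}) \<union>
    {Poly_Mapping.single (annular_of S (u @ v)) 1 - Poly_Mapping.single (annular_of P (v @ u)) 1
        | S P u v. tangle S u P \<and> tangle P v S}"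

abbreviation annular_span :: "(annular \<Rightarrow>\<^sub>0 lam) set" where
  "annular_span \<equiv> free.span annular_relations"

lemma annular_relations_local:
  assumes "r \<in> local_relations D P Q" "tangle S u P" "tangle Q v S"
    and "D = (\<lambda>w. annular_of S (u @ w @ v))"
  shows "r \<in> annular_relations"
  using assms unfolding annular_relations_def by blast

lemma annular_relations_rotate:
  assumes "tangle S u P" "tangle P v S"
  shows "Poly_Mapping.single (annular_of S (u @ v)) 1 -
    Poly_Mapping.single (annular_of P (v @ u)) 1 \<in> annular_relations"
  using assms unfolding annular_relations_def by blast

definition same_annular :: "annular \<Rightarrow> annular \<Rightarrow> bool" where
  "same_annular D D' \<longleftrightarrow> Poly_Mapping.single D 1 - Poly_Mapping.single D' 1 \<in> annular_span"

lemma same_annular_refl [simp]: "same_annular D D"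
  by (simp add: same_annular_def free.span_zero)

lemma same_annular_sym: "same_annular D D' \<Longrightarrow> same_annular D' D"
  unfolding same_annular_def using free.span_neg by fastforce

lemma same_annular_trans [trans]: "same_annular D D' \<Longrightarrow> same_annular D' D'' \<Longrightarrow> same_annular D D''"
  unfolding same_annular_def
  by (drule (1) free.span_add) simp

lemma same_annular_rotate:
  "tangle S u P \<Longrightarrow> tangle P v S \<Longrightarrow> same_annular (annular_of S (u @ v)) (annular_of P (v @ u))"
  unfolding same_annular_def by (intro free.span_base annular_relations_rotate)

definition same_tangle :: "dir list \<Rightarrow> event list \<Rightarrow> event list \<Rightarrow> dir list \<Rightarrow> bool" where
  "same_tangle P l r Q \<longleftrightarrow> tangle P l Q \<and> tangle P r Q \<and>
    (\<forall>L R S u v. tangle S u (L @ P @ R) \<longrightarrow> tangle (L @ Q @ R) v S \<longrightarrow>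
      same_annular (annular_of S (u @ map (shift (length L)) l @ v))
        (annular_of S (u @ map (shift (length L)) r @ v)))"

lemma same_tangle_refl: "tangle P l Q \<Longrightarrow> same_tangle P l l Q"
  by (simp add: same_tangle_def)

lemma same_tangle_sym: "same_tangle P l r Q \<Longrightarrow> same_tangle P r l Q"
  by (simp add: same_tangle_def same_annular_sym)

lemma same_tangle_trans [trans]:
  "same_tangle P l r Q \<Longrightarrow> same_tangle P r t Q \<Longrightarrow> same_tangle P l t Q"
  unfolding same_tangle_def using same_annular_trans by blast

lemma same_tangleD: "same_tangle P l r Q \<Longrightarrow> tangle P l Q" "same_tangle P l r Q \<Longrightarrow> tangle P r Q"
  by (simp_all add: same_tangle_def)

lemma same_tangle_context:
  assumes "same_tangle P l r Q" "tangle S u (L @ P @ R)" "tangle (L @ Q @ R) v S"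
  shows "same_annular (annular_of S (u @ map (shift (length L)) l @ v))
    (annular_of S (u @ map (shift (length L)) r @ v))"
  using assms unfolding same_tangle_def by blast

lemma tangle_both: "tangle P w Q \<Longrightarrow> tangle (L @ P @ R) (map (shift (length L)) w) (L @ Q @ R)"
  by (intro tangle_left tangle_right)

lemma same_tangle_pad:
  assumes "same_tangle P l r Q"
  shows "same_tangle (L @ P @ R) (map (shift (length L)) l) (map (shift (length L)) r) (L @ Q @ R)"
  unfolding same_tangle_def
proof (intro conjI allI impI)
  show "tangle (L @ P @ R) (map (shift (length L)) l) (L @ Q @ R)"
    "tangle (L @ P @ R) (map (shift (length L)) r) (L @ Q @ R)"
    using assms by (auto dest: same_tangleD intro: tangle_both)
next
  fix L' R' S u v
  assume *: "tangle S u (L' @ (L @ P @ R) @ R')" "tangle (L' @ (L @ Q @ R) @ R') v S"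
  show "same_annular (annular_of S (u @ map (shift (length L')) (map (shift (length L)) l) @ v))
      (annular_of S (u @ map (shift (length L')) (map (shift (length L)) r) @ v))"
    using same_tangle_context[OF assms, of S u "L' @ L" "R @ R'" v] * by simp
qed

lemma same_tangle_append:
  assumes "same_tangle P l r Q" "same_tangle Q l' r' R"
  shows "same_tangle P (l @ l') (r @ r') R"
  unfolding same_tangle_def
proof (intro conjI allI impI)
  show "tangle P (l @ l') R" "tangle P (r @ r') R"
    using assms by (auto simp: same_tangle_def intro: tangle_appendI)
next
  fix L B S u v assume *: "tangle S u (L @ P @ B)" "tangle (L @ R @ B) v S"
  let ?s = "map (shift (length L))"
  have 1: "same_annular (annular_of S (u @ ?s l @ (?s l' @ v))) (annular_of S (u @ ?s r @ (?s l' @ v)))"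
    by (rule same_tangle_context[OF assms(1) *(1)])
      (rule tangle_appendI[OF tangle_both[OF same_tangleD(1)[OF assms(2)]] *(2)])
  have 2: "same_annular (annular_of S ((u @ ?s r) @ ?s l' @ v)) (annular_of S ((u @ ?s r) @ ?s r' @ v))"
    by (rule same_tangle_context[OF assms(2) _ *(2)])
      (rule tangle_appendI[OF *(1) tangle_both[OF same_tangleD(2)[OF assms(1)]]])
  show "same_annular (annular_of S (u @ ?s (l @ l') @ v)) (annular_of S (u @ ?s (r @ r') @ v))"
    using same_annular_trans[OF 1] 2 by simp
qed

lemma same_tangle_move:
  assumes "diagram_move l r" "tangle P l Q" "tangle P r Q"
  shows "same_tangle P l r Q"
  unfolding same_tangle_def
proof (intro conjI allI impI assms(2,3))
  fix L R S u v assume "tangle S u (L @ P @ R)" "tangle (L @ Q @ R) v S"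
  thus "same_annular (annular_of S (u @ map (shift (length L)) l @ v))
      (annular_of S (u @ map (shift (length L)) r @ v))"
    unfolding same_annular_def
    by (intro free.span_base annular_relations_local[OF local_relations.move[OF
            diagram_move_shift[OF assms(1)] tangle_both[OF assms(2)] tangle_both[OF assms(3)]]]) auto
qed

lemma same_tangle_annular:
  assumes "same_tangle S l r S"
  shows "same_annular (annular_of S l) (annular_of S r)"
  using same_tangle_context[OF assms, of S "[]" "[]" "[]" "[]"] by simp

lemma admissible_length: "admissible P e \<Longrightarrow> pos e + legs_below e \<le> length P"
  by (cases e) auto

lemma after_length: "admissible P e \<Longrightarrow> length (after P e) + legs_below e = length P + legs_above e"
  by (cases e) auto

lemma interchange_event:
  assumes "admissible P e" "admissible R f"
  shows "same_tangle (P @ R) [e, shift (length (after P e)) f] [shift (length P) f, e]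
    (after P e @ after R f)"
proof -
  let ?g = "shift (length P - pos e - legs_below e) f"
  have 1: "shift (length P) f = shift (pos e + legs_below e) ?g"
    using admissible_length[OF assms(1)] by simp
  have 2: "shift (length (after P e)) f = shift (pos e + legs_above e) ?g"
  proof -
    have "length (after P e) =  pos e + legs_above e + (length P - pos e - legs_below e)"
      using admissible_length[OF assms(1)] after_length[OF assms(1)] by simp
    thus ?thesis by simp
  qed
  have t1: "tangle (P @ R) [e, shift (length (after P e)) f] (after P e @ after R f)"
    using assms by (simp add: admissible_right after_right admissible_left after_left)
  have t2: "tangle (P @ R) [shift (length P) f, e] (after P e @ after R f)"
    using assms by (simp add: admissible_right after_right admissible_left after_left)
  show ?thesis
    by (rule same_tangle_move[OF _ t1 t2]) (unfold 1 2, rule diagram_move.interchange)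
qed

lemma interchange_event_tangle:
  assumes "tangle P u Q" "admissible R f"
  shows "same_tangle (P @ R) (u @ [shift (length Q) f]) (shift (length P) f # u) (Q @ after R f)"
  using assms(1)
proof (induction u arbitrary: P)
  case Nil
  thus ?case using tangle_left[of R "[f]" "after R f" P] assms(2) by (auto intro: same_tangle_refl)
next
  case (Cons e u)
  hence e: "admissible P e" and u: "tangle (after P e) u Q" by auto
  have "tangle (P @ R) [e] (after P e @ R)"
    using tangle_right[of P "[e]" "after P e" R] e by simp
  from same_tangle_append[OF same_tangle_refl[OF this] Cons.IH[OF u]]
  have "same_tangle (P @ R) (e # u @ [shift (length Q) f]) (e # shift (length (after P e)) f # u)
      (Q @ after R f)" by simp
  also have "tangle (after P e @ after R f) u (Q @ after R f)"
    using u by (rule tangle_right)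
  from same_tangle_append[OF interchange_event[OF e assms(2)] same_tangle_refl[OF this]]
  have "same_tangle (P @ R) (e # shift (length (after P e)) f # u) (shift (length P) f # e # u)
      (Q @ after R f)" by simp
  finally show ?case by simp
qed

lemma interchange_tangle:
  assumes "tangle P u Q" "tangle R w T"
  shows "same_tangle (P @ R) (u @ map (shift (length Q)) w) (map (shift (length P)) w @ u) (Q @ T)"
  using assms(2)
proof (induction w arbitrary: R)
  case Nil
  thus ?case using tangle_right[OF assms(1)] by (auto intro: same_tangle_refl)
next
  case (Cons f w)
  hence f: "admissible R f" and w: "tangle (after R f) w T" by auto
  have "tangle (Q @ after R f) (map (shift (length Q)) w) (Q @ T)"
    using w by (rule tangle_left)
  from same_tangle_append[OF interchange_event_tangle[OF assms(1) f] same_tangle_refl[OF this]]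
  have "same_tangle (P @ R) (u @ map (shift (length Q)) (f # w))
    (shift (length P) f # u @ map (shift (length Q)) w) (Q @ T)" by simp
  also have "tangle (P @ R) [shift (length P) f] (P @ after R f)"
    using tangle_left[of R "[f]" "after R f" P] f by simp
  from same_tangle_append[OF same_tangle_refl[OF this] Cons.IH[OF w]]
  have "same_tangle (P @ R) (shift (length P) f # u @ map (shift (length Q)) w)
    (map (shift (length P)) (f # w) @ u) (Q @ T)" by simp
  finally show ?case .
qed

subsection \<open>The relations span an ideal\<close>

lemma single_times_eq_free_map:
  "Poly_Mapping.single (D :: annular) 1 * x = free_map (\<lambda>D'. D + D') x"
  "x * Poly_Mapping.single (D :: annular) 1 = free_map (\<lambda>D'. D' + D) x"
  by (induction x rule: free_induct)
    (simp_all add: algebra_simps mult_single free_map_add)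

lemma free_scale_times:
  fixes x y :: "annular \<Rightarrow>\<^sub>0 lam"
  shows "free_scale c x * y = free_scale c (x * y)" "x * free_scale c y = free_scale c (x * y)"
proof -
  have *: "Poly_Mapping.single k (c * a) * z = free_scale c (Poly_Mapping.single k a * z)"
    "Poly_Mapping.single k a * free_scale c z = free_scale c (Poly_Mapping.single k a * z)"
    for k :: annular and a and z :: "annular \<Rightarrow>\<^sub>0 lam"
    by (induction z rule: free_induct)
      (simp_all add: distrib_left mult_single free.scale_right_distrib mult.assoc mult.left_commute)
  show "free_scale c x * y = free_scale c (x * y)"
    by (induction x rule: free_induct)
      (simp_all add: distrib_right free.scale_right_distrib *)
  show "x * free_scale c y = free_scale c (x * y)"
    by (induction x rule: free_induct)
      (simp_all add: distrib_right free.scale_right_distrib *)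
qed

lemma annular_relations_left:
  assumes "r \<in> annular_relations"
  shows "Poly_Mapping.single D 1 * r \<in> annular_span"
proof -
  obtain T b where D: "D = annular_of T b" and b: "tangle T b T" by (rule annular_cases)
  from assms consider
    (local) S P Q u v where "r \<in> local_relations (\<lambda>w. annular_of S (u @ w @ v)) P Q"
      "tangle S u P" "tangle Q v S"
  | (rotate) S P u v where "tangle S u P" "tangle P v S"
      "r = Poly_Mapping.single (annular_of S (u @ v)) 1 - Poly_Mapping.single (annular_of P (v @ u)) 1"
    unfolding annular_relations_def by blast
  thus ?thesis
  proof cases
    case local
    let ?s = "shift (length T)"
    have "free_map ((+) D) r \<in>
        local_relations (\<lambda>w. annular_of (T @ S) ((b @ map ?s u) @ w @ map ?s v)) (T @ P) (T @ Q)"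
      using local(1)
      by (rule local_relations_left)
        (simp add: D plus_annular_of[OF b] tangle_appendI[OF local(2) tangle_appendI[OF _ local(3)]])
    hence "free_map ((+) D) r \<in> annular_relations"
      by (rule annular_relations_local[OF _ tangle_appendI[OF tangle_right[OF b]
            tangle_left[OF local(2)]] tangle_left[OF local(3)]]) simp
    thus ?thesis by (simp add: single_times_eq_free_map free.span_base)
  next
    case rotate
    let ?u = "map (shift (length T)) u" and ?v = "map (shift (length T)) v"
    have u: "tangle (T @ S) ?u (T @ P)" and v: "tangle (T @ P) ?v (T @ S)"
      using rotate(1,2) by (auto intro: tangle_left)
    have "same_tangle (T @ S) (b @ ?u) (?u @ b) (T @ P)"
      by (rule interchange_tangle[OF b rotate(1)])
    from same_tangle_annular[OF same_tangle_append[OF this same_tangle_refl[OF v]]]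
    have "same_annular (annular_of (T @ S) (b @ ?u @ ?v)) (annular_of (T @ S) (?u @ (b @ ?v)))"
      by simp
    also have "same_annular (annular_of (T @ S) (?u @ (b @ ?v))) (annular_of (T @ P) ((b @ ?v) @ ?u))"
      by (intro same_annular_rotate u tangle_appendI[OF tangle_right[OF b] v])
    finally have "same_annular (D + annular_of S (u @ v)) (D + annular_of P (v @ u))"
      using rotate(1,2) by (simp add: D plus_annular_of b tangle_appendI)
    thus ?thesis
      by (simp add: rotate(3) single_times_eq_free_map free_map_diff same_annular_def)
  qed
qed

lemma annular_relations_right:
  assumes "r \<in> annular_relations"
  shows "r * Poly_Mapping.single D 1 \<in> annular_span"
proof -
  obtain T b where D: "D = annular_of T b" and b: "tangle T b T" by (rule annular_cases)
  from assms consider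
    (local) S P Q u v where "r \<in> local_relations (\<lambda>w. annular_of S (u @ w @ v)) P Q"
      "tangle S u P" "tangle Q v S"
  | (rotate) S P u v where "tangle S u P" "tangle P v S"
      "r = Poly_Mapping.single (annular_of S (u @ v)) 1 - Poly_Mapping.single (annular_of P (v @ u)) 1"
    unfolding annular_relations_def by blast
  thus ?thesis
  proof cases
    case local
    let ?b = "map (shift (length S)) b"
    have "free_map (\<lambda>E. E + D) r \<in>
        local_relations (\<lambda>w. annular_of (S @ T) (u @ w @ (v @ ?b))) P Q"
      using local(1)
      by (rule free_map_local_relations)
        (simp add: D plus_annular_of[OF _ b] tangle_appendI[OF local(2) tangle_appendI[OF _ local(3)]])
    hence "free_map (\<lambda>E. E + D) r \<in>
        local_relations (\<lambda>w. annular_of (S @ T) (u @ w @ (v @ ?b))) (P @ T) (Q @ T)"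
      by (rule local_relations_right)
    hence "free_map (\<lambda>E. E + D) r \<in> annular_relations"
      by (rule annular_relations_local[OF _ tangle_right[OF local(2)]
            tangle_appendI[OF tangle_right[OF local(3)] tangle_left[OF b]]]) simp
    thus ?thesis by (simp add: single_times_eq_free_map free.span_base)
  next
    case rotate
    let ?b = "map (shift (length S)) b" and ?b' = "map (shift (length P)) b"
    have u: "tangle (S @ T) u (P @ T)" and v: "tangle (P @ T) v (S @ T)"
      using rotate(1,2) by (auto intro: tangle_right)
    have 1: "same_tangle (P @ T) (v @ ?b) (?b' @ v) (S @ T)"
      by (rule interchange_tangle[OF rotate(2) b])
    from same_tangle_annular[OF same_tangle_append[OF same_tangle_refl[OF u] this]]
    have "same_annular (annular_of (S @ T) (u @ v @ ?b)) (annular_of (S @ T) (u @ (?b' @ v)))"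
      by simp
    also have "same_annular (annular_of (S @ T) (u @ (?b' @ v)))
        (annular_of (P @ T) ((?b' @ v) @ u))"
      by (intro same_annular_rotate u same_tangleD[OF 1])
    also have "same_annular (annular_of (P @ T) ((?b' @ v) @ u))
        (annular_of (P @ T) ((v @ ?b) @ u))"
      by (intro same_tangle_annular same_tangle_append[OF same_tangle_sym[OF 1]] same_tangle_refl u)
    also have "same_tangle (S @ T) (?b @ u) (u @ ?b') (P @ T)"
      by (rule same_tangle_sym[OF interchange_tangle[OF rotate(1) b]])
    from same_tangle_annular[OF same_tangle_append[OF same_tangle_refl[OF v] this]]
    have "same_annular (annular_of (P @ T) ((v @ ?b) @ u)) (annular_of (P @ T) (v @ u @ ?b'))"
      by simp
    finally have "same_annular (annular_of S (u @ v) + D) (annular_of P (v @ u) + D)"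
      using rotate(1,2) by (simp add: D plus_annular_of b tangle_appendI)
    thus ?thesis
      by (simp add: rotate(3) single_times_eq_free_map free_map_diff same_annular_def)
  qed
qed

lemma annular_span_left: "y \<in> annular_span \<Longrightarrow> x * y \<in> annular_span"
proof (induction y rule: free.span_induct_alt)
  case (step c r y)
  have "x * r \<in> annular_span"
  proof (induction x rule: free_induct)
    case (add k a x)
    have "Poly_Mapping.single k a * r = free_scale a (Poly_Mapping.single k 1 * r)"
      by (simp add: free_scale_times(1)[symmetric])
    with add show ?case
      using annular_relations_left[OF step(1)] free.span_add free.span_scale
      by (metis distrib_right)
  qed (simp add: free.span_zero)
  with step show ?case
    by (simp add: distrib_left free_scale_times free.span_add free.span_scale)
qed (simp add: free.span_zero)

lemma annular_span_right: "x \<in> annular_span \<Longrightarrow> x * y \<in> annular_span"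
proof (induction x rule: free.span_induct_alt)
  case (step c r x)
  have "r * y \<in> annular_span"
  proof (induction y rule: free_induct)
    case (add k a y)
    have "r * Poly_Mapping.single k a = free_scale a (r * Poly_Mapping.single k 1)"
      by (simp add: free_scale_times(2)[symmetric])
    with add show ?case
      using annular_relations_right[OF step(1)] free.span_add free.span_scale
      by (metis distrib_left)
  qed (simp add: free.span_zero)
  with step show ?case
    by (simp add: distrib_right free_scale_times free.span_add free.span_scale)
qed (simp add: free.span_zero)

subsection \<open>The skein of the annulus is not zero\<close>

text \<open>For \<open>v = s\<^sup>-\<^sup>1\<close> the map \<open>D \<mapsto> s\<^bsup>writhe D\<^esup>\<close> is compatible with all relations.\<close>

fun crossing_sign :: "dir list \<Rightarrow> event \<Rightarrow> int" where
  "crossing_sign P (Crossing i b) = (if b = (P ! i = P ! (i + 1)) then 1 else - 1)"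
| "crossing_sign P (Cup i a) = 0"
| "crossing_sign P (Cap i) = 0"

fun writhe :: "dir list \<Rightarrow> event list \<Rightarrow> int" where
  "writhe P [] = 0"
| "writhe P (e # w) = crossing_sign P e + writhe (after P e) w"

lemma writhe_append: "tangle P u Q \<Longrightarrow> writhe P (u @ w) = writhe P u + writhe Q w"
  by (induction u arbitrary: P) auto

lemma after_nth_right:
  assumes "admissible P e"
  shows "after P e ! (pos e + legs_above e + k) = P ! (pos e + legs_below e + k)"
  using assms by (cases e) (auto simp: nth_append)

lemma after_nth_left:
  assumes "admissible P e" "j < pos e"
  shows "after P e ! j = P ! j"
  using assms by (cases e) (auto simp: nth_append)

lemma crossing_sign_right:
  assumes "admissible P e"
  shows "crossing_sign (after P e) (shift (pos e + legs_above e) f) = crossing_sign P (shift (pos e + legs_below e) f)"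
  using after_nth_right[OF assms, of "pos f"] after_nth_right[OF assms, of "Suc (pos f)"]
  by (cases f) (simp_all add: add.assoc)

lemma crossing_sign_left:
  assumes "admissible P f" "pos e + legs_below e \<le> pos f"
  shows "crossing_sign (after P f) e = crossing_sign P e"
  using assms by (cases e) (auto simp: after_nth_left)

lemma crossing_sign_split:
  "crossing_sign (L @ x # y # R) (Crossing (length L) b) = (if b = (x = y) then 1 else - 1)"
  "crossing_sign (L @ x # y # z # R) (Crossing (Suc (length L)) b) = (if b = (y = z) then 1 else - 1)"
  by (simp_all add: nth_append)

lemma after_split:
  "after (L @ x # y # R) (Crossing (length L) b) = L @ y # x # R"
  "after (L @ x # y # z # R) (Crossing (Suc (length L)) b) = L @ x # z # y # R"
  "after (L @ R) (Cup (length L) a) = L @ a # opp a # R"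
  "after (L @ x # R) (Cup (Suc (length L)) a) = L @ x # a # opp a # R"
  "after (L @ x # y # R) (Cap (length L)) = L @ R"
  "after (L @ x # y # z # R) (Cap (Suc (length L))) = L @ x # R"
  by (simp_all add: nth_append)

lemma admissible_split:
  "admissible (L @ x # y # R) (Cap (length L)) \<longleftrightarrow> y = opp x"
  "admissible (L @ x # y # z # R) (Cap (Suc (length L))) \<longleftrightarrow> z = opp y"
  by (simp_all add: nth_append)

lemmas event_split = crossing_sign_split after_split admissible_split

lemma list_split1:
  assumes "i < length P"
  obtains L x R where "P = L @ x # R" "i = length L"
  using id_take_nth_drop[OF assms] assms that by (metis length_take min.absorb4)

lemma list_split2:
  assumes "i + 1 < length P"
  obtains L x y R where "P = L @ x # y # R" "i = length L"
proof -
  obtain L x R where 1: "P = L @ x # R" "i = length L" using assms list_split1[of i P] by auto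
  with assms obtain y R' where "R = y # R'" by (cases R) auto
  with 1 that show ?thesis by blast
qed

lemma list_split3:
  assumes "i + 2 < length P"
  obtains L x y z R where "P = L @ x # y # z # R" "i = length L"
proof -
  obtain L x y R where 1: "P = L @ x # y # R" "i = length L" using assms list_split2[of i P]
    by (metis add_lessD1 one_add_one add.assoc)
  with assms obtain z R' where "R = z # R'" by (cases R) auto
  with 1 that show ?thesis by blast
qed

lemma writhe_move:
  assumes "diagram_move l r" "tangle P l Q" "tangle P r Q"
  shows "writhe P l = writhe P r"
  using assms
proof (cases rule: diagram_move.cases)
  case (interchange e f)
  let ?f = "shift (pos e + legs_below e) f"
  from assms(2,3) interchange have "admissible P e" "admissible P ?f" by auto
  with crossing_sign_right[of P e f] crossing_sign_left[of P ?f e] interchange show ?thesis by simp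
next
  case (turn_cup i a b)
  with assms(3) have "i < length P" by simp
  then obtain L x R where P: "P = L @ x # R" "i = length L" by (rule list_split1)
  show ?thesis unfolding turn_cup P
    by (cases x; cases a) (simp_all add: event_split del: crossing_sign.simps(1) after.simps admissible.simps)
next
  case (turn_cap i b)
  with assms(3) have "i + 2 < length P" by simp
  then obtain L x y z R where P: "P = L @ x # y # z # R" "i = length L" by (rule list_split3)
  show ?thesis using assms(2) unfolding turn_cap P
    by (cases x; cases y; cases z)
      (simp_all add: event_split del: crossing_sign.simps(1) after.simps admissible.simps)
next
  case (R2 i b)
  with assms(2) have "i + 1 < length P" by simp
  then obtain L x y R where P: "P = L @ x # y # R" "i = length L" by (rule list_split2)
  show ?thesis unfolding R2 P
    by (auto simp: event_split simp del: crossing_sign.simps(1) after.simps admissible.simps)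
next
  case (R3 a c b i)
  with assms(3) have "i + 2 < length P" by simp
  then obtain L x y z R where P: "P = L @ x # y # z # R" "i = length L" by (rule list_split3)
  show ?thesis unfolding R3 P
    by (simp add: event_split del: crossing_sign.simps(1) after.simps admissible.simps)
qed auto

definition writhe_of :: "annular \<Rightarrow> int" where
  "writhe_of D = (case Rep_annular D of (S, w) \<Rightarrow> writhe S w)"

lemma writhe_of: "tangle S w S \<Longrightarrow> writhe_of (annular_of S w) = writhe S w"
  by (simp add: writhe_of_def Rep_annular_of)

definition spec_value :: "(annular \<Rightarrow>\<^sub>0 lam) \<Rightarrow> int poly fract" where
  "spec_value x = (\<Sum>D\<in>Poly_Mapping.keys x.
    spec (Poly_Mapping.lookup x D) * spec_s powi writhe_of D)"

lemma spec_value_add: "spec_value (x + y) = spec_value x + spec_value y"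
  unfolding spec_value_def by (rule ext_add) (simp_all add: spec_hom algebra_simps)

lemma spec_value_0: "spec_value 0 = 0"
  by (simp add: spec_value_def)

lemma spec_value_single: "spec_value (Poly_Mapping.single D c) = spec c * spec_s powi writhe_of D"
  by (simp add: spec_value_def spec_hom)

lemma spec_value_diff: "spec_value (x - y) = spec_value x - spec_value y"
  using spec_value_add[of "x - y" y] by simp

lemma spec_value_scale: "spec_value (free_scale c x) = spec c * spec_value x"
  by (induction x rule: free_induct)
    (simp_all add: spec_value_0 spec_value_add spec_value_single free.scale_right_distrib
       spec_hom algebra_simps)

lemma spec_value_local:
  assumes "r \<in> local_relations D P Q"
    and D: "\<And>w. tangle P w Q \<Longrightarrow> writhe_of (D w) = n + writhe P w"
  shows "spec_value r = 0"
  using assms(1)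
proof (cases rule: local_relations.cases)
  case (move l r)
  thus ?thesis using D by (simp add: spec_value_diff spec_value_single writhe_move)
next
  case (skein i)
  have "tangle P [Crossing i False] Q" using skein by simp
  moreover have "P ! i = P ! (i + 1)"
  proof -
    have "(take i P @ [P ! (i + 1), P ! i] @ drop (i + 2) P) ! i = P ! i"
      using skein by simp
    thus ?thesis using skein by (simp add: nth_append)
  qed
  ultimately have w: "writhe_of (D [Crossing i True]) = n + 1"
    "writhe_of (D [Crossing i False]) = n - 1" "writhe_of (D []) = n"
    using skein(2,3) D[of "[Crossing i True]"] D[of "[Crossing i False]"] D[of "[]"]
    by (simp_all del: tangle.simps(2))
  have "spec_s powi (n + 1) = spec_s * spec_s powi n"
    "spec_s powi (n - 1) = inverse spec_s * spec_s powi n"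
    using spec_s_nz by (simp_all add: power_int_add power_int_diff field_simps)
  note p = this
  show ?thesis unfolding skein(1)
    by (simp only: spec_value_diff spec_value_single spec_hom spec_var w p)
      (simp add: left_diff_distrib)
next
  case (kink_right i a)
  have "i < length P" using kink_right(2) by simp
  then obtain L x R where P: "P = L @ x # R" "i = length L" by (rule list_split1)
  have "writhe P [Cup (i + 1) a, Crossing i True, Cap (i + 1)] = 1"
    using kink_right(2)[unfolded kink_right(3)] unfolding P
    by (cases x; cases a) (simp_all add: event_split del: crossing_sign.simps(1) after.simps admissible.simps)
  thus ?thesis
    using kink_right(1,3) D[OF kink_right(2)] D[of "[]"] spec_s_nz
    by (simp add: spec_value_diff spec_value_single spec_hom spec_var power_int_add
        del: writhe.simps(2) tangle.simps(2))
next
  case (kink_left i a)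
  have "i \<le> length P" "i + 2 < length (after P (Cup i a))"
    using kink_left(2) by (simp_all del: after.simps)
  hence "i < length P" by simp
  then obtain L x R where P: "P = L @ x # R" "i = length L" by (rule list_split1)
  have "writhe P [Cup i a, Crossing (i + 1) True, Cap i] = 1"
    using kink_left(2)[unfolded kink_left(3)] unfolding P
    by (cases x; cases a) (simp_all add: event_split del: crossing_sign.simps(1) after.simps admissible.simps)
  thus ?thesis
    using kink_left(1,3) D[OF kink_left(2)] D[of "[]"] spec_s_nz
    by (simp add: spec_value_diff spec_value_single spec_hom spec_var power_int_add
        del: writhe.simps(2) tangle.simps(2))
next
  case (loop i a)
  thus ?thesis
    using D[OF loop(2)] D[of "[]"]
    by (simp add: spec_value_diff spec_value_single spec_hom spec_loop)
qed

lemma spec_value_annular_relations: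
  assumes "r \<in> annular_relations"
  shows "spec_value r = 0"
proof -
  from assms consider
    (local) S P Q u v where "r \<in> local_relations (\<lambda>w. annular_of S (u @ w @ v)) P Q"
      "tangle S u P" "tangle Q v S"
  | (rotate) S P u v where "tangle S u P" "tangle P v S"
      "r = Poly_Mapping.single (annular_of S (u @ v)) 1 - Poly_Mapping.single (annular_of P (v @ u)) 1"
    unfolding annular_relations_def by blast
  thus ?thesis
  proof cases
    case local
    show ?thesis
    proof (rule spec_value_local[OF local(1)])
      fix w assume w: "tangle P w Q"
      thus "writhe_of (annular_of S (u @ w @ v)) = (writhe S u + writhe Q v) + writhe P w"
        using local(2,3)
        by (simp add: writhe_of tangle_appendI writhe_append)
    qed
  next
    case rotate
    thus ?thesis
      by (simp add: spec_value_diff spec_value_single writhe_of tangle_appendI writhe_append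
          add.commute)
  qed
qed

lemma annular_span_proper: "1 \<notin> annular_span"
proof
  have "spec_value x = 0" if "x \<in> annular_span" for x
    using that
    by (induction rule: free.span_induct_alt)
      (simp_all add: spec_value_0 spec_value_add spec_value_scale spec_value_annular_relations)
  moreover assume "1 \<in> annular_span"
  ultimately have "spec_value 1 = 0" by blast
  thus False using spec_value_single[of 0 1] by (simp add: spec_hom spec_s_nz)
qed

subsection \<open>Commutativity\<close>

text \<open>
  A string that crosses over all strings to its left or right can be pulled across any event;
  hence one of two diagrams lying one outside the other can be lifted over the other one.
\<close>

fun string_left :: "nat \<Rightarrow> event list" where
  "string_left 0 = []"
| "string_left (Suc n) = Crossing n True # string_left n"

definition string_right :: "nat \<Rightarrow> event list" where
  "string_right n = map (\<lambda>j. Crossing j True) [0..<n]"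

lemma string_left_add:
  "string_left (m + n) = map (shift n) (string_left m) @ string_left n"
  by (induction m) (auto simp: add.commute)

lemma string_right_add:
  "string_right (m + n) = string_right m @ map (shift m) (string_right n)"
  by (induction n) (auto simp: string_right_def)

lemma tangle_string_left: "tangle (S @ [y]) (string_left (length S)) (y # S)"
proof (induction S rule: rev_induct)
  case (snoc x S)
  have "tangle ((S @ [y]) @ [x]) (string_left (length S)) ((y # S) @ [x])"
    by (rule tangle_right[OF snoc])
  thus ?case using after_split(1)[of S x y "[]"] by (simp del: after.simps)
qed simp

lemma tangle_string_right: "tangle (x # S) (string_right (length S)) (S @ [x])"
proof (induction S rule: rev_induct)
  case (snoc y S)
  have 1: "tangle ((x # S) @ [y]) (string_right (length S)) ((S @ [x]) @ [y])"
    by (rule tangle_right[OF snoc])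
  have 2: "tangle (S @ [x, y]) [Crossing (length S) True] (S @ [y, x])"
    using after_split(1)[of S x y "[]"] by (simp del: after.simps)
  show ?case using tangle_appendI[OF 1] 2 by (simp add: string_right_def)
qed (simp add: string_right_def)

lemma R2_False: "diagram_move [Crossing i False, Crossing i True] []"
  using diagram_move.R2[of i False] by simp

lemma event_cases:
  assumes "admissible S e"
  obtains (crossing) L a c R b where "S = L @ a # c # R" "e = Crossing (length L) b"
  | (cup) L R a where "S = L @ R" "e = Cup (length L) a"
  | (cap) L R a where "S = L @ a # opp a # R" "e = Cap (length L)"
proof (cases e)
  case (Crossing i b)
  with assms have "i + 1 < length S" by simp
  thus ?thesis by (rule list_split2) (use crossing Crossing in blast)
next
  case (Cup i a)
  with assms have "i \<le> length S" by simp
  with Cup cup[of "take i S" "drop i S" a] show ?thesis by simp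
next
  case (Cap i)
  with assms have "i + 1 < length S" by simp
  then obtain L x y R where "S = L @ x # y # R" "i = length L" by (rule list_split2)
  with Cap assms cap[of L x R] admissible_split(1)[of L x y R] show ?thesis by simp
qed

lemmas [simp del] = after.simps admissible.simps(3)
lemmas [simp] = after_split admissible_split

lemma string_left_middle:
  assumes mid: "same_tangle (L @ M @ y # R) (e # map (shift (length L)) (string_left (length M')))
      (map (shift (length L)) (string_left (length M)) @ [shift 1 e]) (L @ y # M' @ R)"
    and e0: "e = shift (length L) e0" "tangle M [e0] M'"
  shows "same_tangle (L @ M @ R @ [y]) (e # string_left (length (L @ M' @ R)))
    (string_left (length (L @ M @ R)) @ [shift 1 e]) (y # L @ M' @ R)"
proof -
  have l: "length (L @ N @ R) = length R + (length N + length L)" for N by simp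
  have sl: "string_left (length (L @ N @ R)) = map (shift (length (L @ N))) (string_left (length R)) @
      map (shift (length L)) (string_left (length N)) @ string_left (length L)" for N
    unfolding l string_left_add by (simp add: add.commute)
  have e: "tangle (L @ M) [e] (L @ M')"
    using tangle_left[OF e0(2), of L] e0(1) by simp
  have L: "tangle (L @ [y]) (string_left (length L)) (y # L)" by (rule tangle_string_left)
  have R: "tangle (R @ [y]) (string_left (length R)) (y # R)" by (rule tangle_string_left)
  note 1 = interchange_tangle[OF e R]
  have 2: "tangle (L @ y # M' @ R) (string_left (length L)) (y # L @ M' @ R)"
    using tangle_right[OF L, of "M' @ R"] by simp
  have 3: "tangle (L @ M' @ y # R)
      (map (shift (length L)) (string_left (length M')) @ string_left (length L)) (y # L @ M' @ R)"
    using tangle_appendI[OF tangle_left[OF tangle_right[OF tangle_string_left[of M' y], of R], of L]] 2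
    by simp
  have 4: "tangle (L @ M @ R @ [y])
      (map (shift (length (L @ M))) (string_left (length R))) (L @ M @ y # R)"
    using tangle_left[OF R, of "L @ M"] by simp
  have 5: "tangle (L @ M @ y # R) (map (shift (length L)) (string_left (length M))) (L @ y # M @ R)"
    using tangle_left[OF tangle_right[OF tangle_string_left[of M y], of R], of L] by simp
  have "same_tangle (L @ M @ R @ [y]) (e # string_left (length (L @ M' @ R)))
     (map (shift (length (L @ M))) (string_left (length R)) @ [e] @
       map (shift (length L)) (string_left (length M')) @ string_left (length L)) (y # L @ M' @ R)"
    using same_tangle_append[OF 1 same_tangle_refl, of
        "map (shift (length L)) (string_left (length M')) @ string_left (length L)"] 3
    by (simp add: sl del: length_append)
  also have "same_tangle (L @ M @ R @ [y])
      (map (shift (length (L @ M))) (string_left (length R)) @ [e] @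
       map (shift (length L)) (string_left (length M')) @ string_left (length L))
      (map (shift (length (L @ M))) (string_left (length R)) @
       map (shift (length L)) (string_left (length M)) @ [shift 1 e] @ string_left (length L))
      (y # L @ M' @ R)"
    using same_tangle_append[OF same_tangle_refl[OF 4] same_tangle_append[OF mid same_tangle_refl[OF 2]]]
    by simp
  also have 6: "same_tangle (L @ y # M @ R) ([shift 1 e] @ string_left (length L))
      (string_left (length L) @ [shift 1 e]) (y # L @ M' @ R)"
    using same_tangle_sym[OF interchange_tangle[OF L tangle_right[OF e0(2), of R]]]
    by (simp add: e0)
  have "same_tangle (L @ M @ R @ [y])
      (map (shift (length (L @ M))) (string_left (length R)) @
       map (shift (length L)) (string_left (length M)) @ [shift 1 e] @ string_left (length L))
      (string_left (length (L @ M @ R)) @ [shift 1 e]) (y # L @ M' @ R)"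
    using same_tangle_append[OF same_tangle_refl[OF tangle_appendI[OF 4 5]] 6]
    by (simp add: sl del: length_append)
  finally show ?thesis .
qed

lemma string_left_event:
  assumes "admissible S e"
  shows "same_tangle (S @ [y]) (e # string_left (length (after S e)))
    (string_left (length S) @ [shift 1 e]) (y # after S e)"
  using assms
proof (cases rule: event_cases)
  case (crossing L a c R b)
  let ?i = "length L"
  have "same_tangle (L @ [a, c] @ y # R) [Crossing ?i b, Crossing (?i + 1) True, Crossing ?i True]
      [Crossing (?i + 1) True, Crossing ?i True, Crossing (?i + 1) b] (L @ y # [c, a] @ R)"
    by (rule same_tangle_move[OF diagram_move.R3]) (auto simp: after_split)
  from string_left_middle[of L "[a, c]" y R e "[c, a]" "Crossing 0 b"] this
  show ?thesis using after_split(1)[of "[]" a c "[]"]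
    by (simp add: crossing numeral_2_eq_2)
next
  case (cup L R a)
  let ?i = "length L"
  have "same_tangle (L @ y # R) ([Cup ?i a, Crossing (?i + 1) True] @ [Crossing ?i True])
      ([Cup (?i + 1) a, Crossing ?i (\<not> True)] @ [Crossing ?i True]) (L @ y # a # opp a # R)"
    by (intro same_tangle_append[OF same_tangle_move[OF diagram_move.turn_cup] same_tangle_refl])
      auto
  hence 1: "same_tangle (L @ y # R) [Cup ?i a, Crossing (?i + 1) True, Crossing ?i True]
      [Cup (?i + 1) a, Crossing ?i False, Crossing ?i True] (L @ y # a # opp a # R)" by simp
  have "same_tangle (L @ y # R) ([Cup (?i + 1) a] @ [Crossing ?i False, Crossing ?i True])
      ([Cup (?i + 1) a] @ []) (L @ y # a # opp a # R)"
    by (intro same_tangle_append[OF same_tangle_refl same_tangle_move[OF R2_False]]) auto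
  hence 2: "same_tangle (L @ y # R) [Cup (?i + 1) a, Crossing ?i False, Crossing ?i True]
      [Cup (?i + 1) a] (L @ y # a # opp a # R)" by simp
  have "same_tangle (L @ [] @ y # R) [Cup ?i a, Crossing (?i + 1) True, Crossing ?i True]
     [Cup (?i + 1) a] (L @ y # [a, opp a] @ R)" using same_tangle_trans[OF 1 2] by simp
  from string_left_middle[of L "[]" y R e "[a, opp a]" "Cup 0 a"] this
  show ?thesis using after_split(3)[of "[]" "[]" a]
    by (simp add: cup numeral_2_eq_2)
next
  case (cap L R a)
  let ?i = "length L"
  have "same_tangle (L @ a # opp a # y # R) ([Crossing (?i + 1) True] @ [Crossing ?i True, Cap (?i + 1)])
      ([Crossing (?i + 1) True] @ [Crossing (?i + 1) (\<not> True), Cap ?i]) (L @ y # R)"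
    by (intro same_tangle_append[OF same_tangle_refl same_tangle_move[OF diagram_move.turn_cap]])
      auto
  hence 1: "same_tangle (L @ a # opp a # y # R) [Crossing (?i + 1) True, Crossing ?i True, Cap (?i + 1)]
      [Crossing (?i + 1) True, Crossing (?i + 1) (\<not> True), Cap ?i] (L @ y # R)" by simp
  have "same_tangle (L @ a # opp a # y # R)
      ([Crossing (?i + 1) True, Crossing (?i + 1) (\<not> True)] @ [Cap ?i])
      ([] @ [Cap ?i]) (L @ y # R)"
    by (intro same_tangle_append[OF same_tangle_move[OF diagram_move.R2] same_tangle_refl]) auto
  hence 2: "same_tangle (L @ a # opp a # y # R)
      [Crossing (?i + 1) True, Crossing (?i + 1) (\<not> True), Cap ?i] [Cap ?i] (L @ y # R)" by simp
  have "same_tangle (L @ [a, opp a] @ y # R) [Cap ?i]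
      [Crossing (?i + 1) True, Crossing ?i True, Cap (?i + 1)] (L @ y # [] @ R)"
    using same_tangle_sym[OF same_tangle_trans[OF 1 2]] by simp
  from string_left_middle[of L "[a, opp a]" y R e "[]" "Cap 0"] this
  show ?thesis using after_split(5)[of "[]" a "opp a" "[]"] admissible_split(1)[of "[]" a "opp a" "[]"]
    by (simp add: cap numeral_2_eq_2)
qed


lemma string_right_middle:
  assumes mid: "same_tangle (L @ x # M @ R)
      (shift 1 e # map (shift (length L)) (string_right (length M')))
      (map (shift (length L)) (string_right (length M)) @ [e]) (L @ M' @ x # R)"
    and e0: "e = shift (length L) e0" "tangle M [e0] M'"
  shows "same_tangle (x # L @ M @ R) (shift 1 e # string_right (length (L @ M' @ R)))
    (string_right (length (L @ M @ R)) @ [e]) (L @ M' @ R @ [x])"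
proof -
  have l: "length (L @ N @ R) = length L + (length N + length R)" for N by simp
  have sr: "string_right (length (L @ N @ R)) = string_right (length L) @
      map (shift (length L)) (string_right (length N)) @
      map (shift (length (L @ N))) (string_right (length R))" for N
    unfolding l string_right_add by (simp add: add.commute)
  have e: "tangle (L @ M) [e] (L @ M')"
    using tangle_left[OF e0(2), of L] e0(1) by simp
  have L: "tangle (x # L) (string_right (length L)) (L @ [x])" by (rule tangle_string_right)
  have R: "tangle (x # R) (string_right (length R)) (R @ [x])" by (rule tangle_string_right)
  have 2: "tangle (x # L @ N @ R) (string_right (length L)) (L @ x # N @ R)" for N
    using tangle_right[OF L, of "N @ R"] by simp
  have 3: "tangle (L @ x # N @ R) (map (shift (length L)) (string_right (length N)))
      (L @ N @ x # R)" for N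
    using tangle_left[OF tangle_right[OF tangle_string_right[of x N], of R], of L] by simp
  have 4: "tangle (L @ N @ x # R) (map (shift (length (L @ N))) (string_right (length R)))
      (L @ N @ R @ [x])" for N
    using tangle_left[OF R, of "L @ N"] by simp
  have 5: "same_tangle (x # L @ M @ R) ([shift 1 e] @ string_right (length L))
      (string_right (length L) @ [shift 1 e]) (L @ x # M' @ R)"
    using same_tangle_sym[OF interchange_tangle[OF L tangle_right[OF e0(2), of R]]]
    by (simp add: e0)
  have "same_tangle (x # L @ M @ R) (shift 1 e # string_right (length (L @ M' @ R)))
      (string_right (length L) @ (shift 1 e # map (shift (length L)) (string_right (length M'))) @
        map (shift (length (L @ M'))) (string_right (length R))) (L @ M' @ R @ [x])"
    using same_tangle_append[OF 5 same_tangle_refl[OF tangle_appendI[OF 3 4]]]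
    by (simp add: sr del: length_append)
  also have "same_tangle (x # L @ M @ R)
      (string_right (length L) @ (shift 1 e # map (shift (length L)) (string_right (length M'))) @
        map (shift (length (L @ M'))) (string_right (length R)))
      (string_right (length L) @ (map (shift (length L)) (string_right (length M)) @ [e]) @
        map (shift (length (L @ M'))) (string_right (length R))) (L @ M' @ R @ [x])"
    by (rule same_tangle_append[OF same_tangle_refl[OF 2]
          same_tangle_append[OF mid same_tangle_refl[OF 4]]])
  also have 6: "same_tangle (L @ M @ x # R)
      ([e] @ map (shift (length (L @ M'))) (string_right (length R)))
      (map (shift (length (L @ M))) (string_right (length R)) @ [e]) (L @ M' @ R @ [x])"
    using interchange_tangle[OF e R] by simp
  have "same_tangle (x # L @ M @ R)
      (string_right (length L) @ (map (shift (length L)) (string_right (length M)) @ [e]) @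
        map (shift (length (L @ M'))) (string_right (length R)))
      (string_right (length (L @ M @ R)) @ [e]) (L @ M' @ R @ [x])"
    using same_tangle_append[OF same_tangle_refl[OF tangle_appendI[OF 2 3]] 6]
    by (simp add: sr del: length_append)
  finally show ?thesis .
qed

lemma string_right_event:
  assumes "admissible S e"
  shows "same_tangle (x # S) (shift 1 e # string_right (length (after S e)))
    (string_right (length S) @ [e]) (after S e @ [x])"
  using assms
proof (cases rule: event_cases)
  case (crossing L a c R b)
  let ?i = "length L"
  have "same_tangle (L @ x # [a, c] @ R)
      [Crossing (?i + 1) b, Crossing ?i True, Crossing (?i + 1) True]
      [Crossing ?i True, Crossing (?i + 1) True, Crossing ?i b] (L @ [c, a] @ x # R)"
    by (rule same_tangle_sym, rule same_tangle_move[OF diagram_move.R3]) auto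
  from string_right_middle[of L x "[a, c]" R e "[c, a]" "Crossing 0 b"] this
  show ?thesis using after_split(1)[of "[]" a c "[]"]
    by (simp add: crossing numeral_2_eq_2 string_right_def)
next
  case (cup L R a)
  let ?i = "length L"
  have "same_tangle (L @ x # R) ([Cup (?i + 1) a, Crossing ?i (\<not> False)] @ [Crossing (?i + 1) True])
      ([Cup ?i a, Crossing (?i + 1) False] @ [Crossing (?i + 1) True]) (L @ a # opp a # x # R)"
    by (intro same_tangle_append[OF same_tangle_sym[OF same_tangle_move[OF diagram_move.turn_cup]]
          same_tangle_refl]) auto
  hence 1: "same_tangle (L @ x # R) [Cup (?i + 1) a, Crossing ?i True, Crossing (?i + 1) True]
      [Cup ?i a, Crossing (?i + 1) False, Crossing (?i + 1) True] (L @ a # opp a # x # R)" by simp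
  have "same_tangle (L @ x # R) ([Cup ?i a] @ [Crossing (?i + 1) False, Crossing (?i + 1) True])
      ([Cup ?i a] @ []) (L @ a # opp a # x # R)"
    by (intro same_tangle_append[OF same_tangle_refl same_tangle_move[OF R2_False]]) auto
  hence 2: "same_tangle (L @ x # R) [Cup ?i a, Crossing (?i + 1) False, Crossing (?i + 1) True]
      [Cup ?i a] (L @ a # opp a # x # R)" by simp
  have "same_tangle (L @ x # [] @ R) [Cup (?i + 1) a, Crossing ?i True, Crossing (?i + 1) True]
     [Cup ?i a] (L @ [a, opp a] @ x # R)" using same_tangle_trans[OF 1 2] by simp
  from string_right_middle[of L x "[]" R e "[a, opp a]" "Cup 0 a"] this
  show ?thesis using after_split(3)[of "[]" "[]" a]
    by (simp add: cup numeral_2_eq_2 string_right_def)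
next
  case (cap L R a)
  let ?i = "length L"
  have "same_tangle (L @ x # a # opp a # R) ([Crossing ?i True] @ [Crossing (?i + 1) (\<not> False), Cap ?i])
      ([Crossing ?i True] @ [Crossing ?i False, Cap (?i + 1)]) (L @ x # R)"
    by (intro same_tangle_append[OF same_tangle_refl
          same_tangle_sym[OF same_tangle_move[OF diagram_move.turn_cap]]]) auto
  hence 1: "same_tangle (L @ x # a # opp a # R) [Crossing ?i True, Crossing (?i + 1) True, Cap ?i]
      [Crossing ?i True, Crossing ?i (\<not> True), Cap (?i + 1)] (L @ x # R)" by simp
  have "same_tangle (L @ x # a # opp a # R) ([Crossing ?i True, Crossing ?i (\<not> True)] @ [Cap (?i + 1)])
      ([] @ [Cap (?i + 1)]) (L @ x # R)"
    by (intro same_tangle_append[OF same_tangle_move[OF diagram_move.R2] same_tangle_refl]) auto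
  hence 2: "same_tangle (L @ x # a # opp a # R)
      [Crossing ?i True, Crossing ?i (\<not> True), Cap (?i + 1)] [Cap (?i + 1)] (L @ x # R)" by simp
  have "same_tangle (L @ x # [a, opp a] @ R) [Cap (?i + 1)]
      [Crossing ?i True, Crossing (?i + 1) True, Cap ?i] (L @ [] @ x # R)"
    using same_tangle_sym[OF same_tangle_trans[OF 1 2]] by simp
  from string_right_middle[of L x "[a, opp a]" R e "[]" "Cap 0"] this
  show ?thesis using after_split(5)[of "[]" a "opp a" "[]"] admissible_split(1)[of "[]" a "opp a" "[]"]
    by (simp add: cap numeral_2_eq_2 string_right_def)
qed

lemma string_left_tangle:
  assumes "tangle S w S'"
  shows "same_tangle (S @ [y]) (w @ string_left (length S'))
    (string_left (length S) @ map (shift 1) w) (y # S')"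
  using assms
proof (induction w arbitrary: S)
  case Nil
  thus ?case using tangle_string_left by (auto intro: same_tangle_refl)
next
  case (Cons e w)
  hence e: "admissible S e" and w: "tangle (after S e) w S'" by auto
  have 1: "tangle (S @ [y]) [e] (after S e @ [y])"
    using tangle_right[of S "[e]" "after S e" "[y]"] e by simp
  have 2: "tangle (y # after S e) (map (shift 1) w) (y # S')"
    using tangle_left[OF w, of "[y]"] by simp
  have "same_tangle (S @ [y]) ((e # w) @ string_left (length S'))
      (e # string_left (length (after S e)) @ map (shift 1) w) (y # S')"
    using same_tangle_append[OF same_tangle_refl[OF 1] Cons.IH[OF w]] by simp
  also have "same_tangle (S @ [y]) (e # string_left (length (after S e)) @ map (shift 1) w)
      (string_left (length S) @ map (shift 1) (e # w)) (y # S')"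
    using same_tangle_append[OF string_left_event[OF e, of y] same_tangle_refl[OF 2]] by simp
  finally show ?case .
qed

lemma string_right_tangle:
  assumes "tangle S w S'"
  shows "same_tangle (x # S) (map (shift 1) w @ string_right (length S'))
    (string_right (length S) @ w) (S' @ [x])"
  using assms
proof (induction w arbitrary: S)
  case Nil
  thus ?case using tangle_string_right by (auto intro: same_tangle_refl)
next
  case (Cons e w)
  hence e: "admissible S e" and w: "tangle (after S e) w S'" by auto
  have 1: "tangle (x # S) [shift 1 e] (x # after S e)"
    using tangle_left[of S "[e]" "after S e" "[x]"] e by simp
  have 2: "tangle (after S e @ [x]) w (S' @ [x])"
    using tangle_right[OF w] .
  have "same_tangle (x # S) (map (shift 1) (e # w) @ string_right (length S'))
      (shift 1 e # string_right (length (after S e)) @ w) (S' @ [x])"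
    using same_tangle_append[OF same_tangle_refl[OF 1] Cons.IH[OF w]] by simp
  also have "same_tangle (x # S) (shift 1 e # string_right (length (after S e)) @ w)
      (string_right (length S) @ (e # w)) (S' @ [x])"
    using same_tangle_append[OF string_right_event[OF e, of x] same_tangle_refl[OF 2]] by simp
  finally show ?case .
qed

text \<open>
  In both words the first \<open>n\<close> strings cross over the next \<open>m\<close> strings; they differ in the order
  of the crossings.
\<close>

fun block_left :: "nat \<Rightarrow> nat \<Rightarrow> event list" where
  "block_left n 0 = []"
| "block_left n (Suc m) = block_left n m @ map (shift m) (string_left n)"

fun block_right :: "nat \<Rightarrow> nat \<Rightarrow> event list" where
  "block_right 0 m = []"
| "block_right (Suc n) m = map (shift 1) (block_right n m) @ string_right m"

lemma tangle_block_left: "tangle (S @ T) (block_left (length S) (length T)) (T @ S)"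
proof (induction T rule: rev_induct)
  case (snoc y T)
  have 1: "tangle ((S @ T) @ [y]) (block_left (length S) (length T)) ((T @ S) @ [y])"
    by (rule tangle_right[OF snoc])
  have 2: "tangle (T @ S @ [y]) (map (shift (length T)) (string_left (length S))) (T @ y # S)"
    by (rule tangle_left[OF tangle_string_left])
  show ?case using tangle_appendI[OF 1, of "map (shift (length T)) (string_left (length S))"] 2
    by simp
qed simp

lemma block_left_tangle:
  assumes "tangle S w S'"
  shows "same_tangle (S @ T) (w @ block_left (length S') (length T))
    (block_left (length S) (length T) @ map (shift (length T)) w) (T @ S')"
proof (induction T rule: rev_induct)
  case Nil
  thus ?case using assms by (auto intro: same_tangle_refl)
next
  case (snoc y T)
  let ?s = "map (shift (length T))"
  have 1: "same_tangle (S @ T @ [y]) (w @ block_left (length S') (length T))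
      (block_left (length S) (length T) @ ?s w) (T @ S' @ [y])"
    using same_tangle_pad[OF snoc, of "[]" "[y]"] by simp
  have 2: "tangle (T @ S' @ [y]) (?s (string_left (length S'))) (T @ y # S')"
    by (rule tangle_left[OF tangle_string_left])
  have 3: "same_tangle (T @ S @ [y]) (?s (w @ string_left (length S')))
      (?s (string_left (length S) @ map (shift 1) w)) (T @ y # S')"
    using same_tangle_pad[OF string_left_tangle[OF assms, of y], of T "[]"] by simp
  have 4: "tangle (S @ T @ [y]) (block_left (length S) (length T)) (T @ S @ [y])"
    using tangle_right[OF tangle_block_left[of S T], of "[y]"] by simp
  have "same_tangle (S @ T @ [y]) (w @ block_left (length S') (length (T @ [y])))
      (block_left (length S) (length T) @ ?s w @ ?s (string_left (length S'))) (T @ y # S')"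
    using same_tangle_append[OF 1 same_tangle_refl[OF 2]] by simp
  also have "same_tangle (S @ T @ [y])
      (block_left (length S) (length T) @ ?s w @ ?s (string_left (length S')))
      (block_left (length S) (length (T @ [y])) @ map (shift (length (T @ [y]))) w) (T @ y # S')"
    using same_tangle_append[OF same_tangle_refl[OF 4] 3] by simp
  finally show ?case by simp
qed

lemma block_right_tangle:
  assumes "tangle T w T'"
  shows "same_tangle (S @ T) (map (shift (length S)) w @ block_right (length S) (length T'))
    (block_right (length S) (length T) @ w) (T' @ S)"
    and "tangle (S @ T) (block_right (length S) (length T)) (T @ S)"
proof -
  have *: "tangle (S @ T) (block_right (length S) (length T)) (T @ S)" for S T
  proof (induction S)
    case (Cons x S)
    have 1: "tangle (x # S @ T) (map (shift 1) (block_right (length S) (length T))) (x # T @ S)"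
      using tangle_left[OF Cons, of "[x]"] by simp
    have 2: "tangle (x # T @ S) (string_right (length T)) (T @ x # S)"
      using tangle_right[OF tangle_string_right[of x T], of S] by simp
    show ?case using tangle_appendI[OF 1 2] by simp
  qed simp
  thus "tangle (S @ T) (block_right (length S) (length T)) (T @ S)" .
  show "same_tangle (S @ T) (map (shift (length S)) w @ block_right (length S) (length T'))
    (block_right (length S) (length T) @ w) (T' @ S)"
  proof (induction S)
    case Nil
    thus ?case using assms by (auto intro: same_tangle_refl)
  next
    case (Cons x S)
    let ?s = "map (shift 1)"
    have 1: "same_tangle (x # S @ T) (?s (map (shift (length S)) w @ block_right (length S) (length T')))
       (?s (block_right (length S) (length T) @ w)) (x # T' @ S)"
      using same_tangle_pad[OF Cons, of "[x]" "[]"] by simp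
    have 2: "tangle (x # T' @ S) (string_right (length T')) (T' @ x # S)"
      using tangle_right[OF tangle_string_right[of x T'], of S] by simp
    have 3: "same_tangle (x # T @ S) (?s w @ string_right (length T')) (string_right (length T) @ w)
        (T' @ x # S)"
      using same_tangle_pad[OF string_right_tangle[OF assms, of x], of "[]" S] by simp
    have 4: "tangle (x # S @ T) (?s (block_right (length S) (length T))) (x # T @ S)"
      using tangle_left[OF *, of "[x]"] by simp
    have "same_tangle (x # S @ T)
        (map (shift (length (x # S))) w @ block_right (length (x # S)) (length T'))
        (?s (block_right (length S) (length T)) @ ?s w @ string_right (length T')) (T' @ x # S)"
      using same_tangle_append[OF 1 same_tangle_refl[OF 2]] by simp
    also have "same_tangle (x # S @ T)
        (?s (block_right (length S) (length T)) @ ?s w @ string_right (length T'))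
        (block_right (length (x # S)) (length T) @ w) (T' @ x # S)"
      using same_tangle_append[OF same_tangle_refl[OF 4] 3] by simp
    finally show ?case by simp
  qed
qed

lemma block_left_right:
  "same_tangle (S @ T) (block_left (length S) (length T)) (block_right (length S) (length T)) (T @ S)"
proof (induction S)
  case Nil
  have "block_left 0 m = []" for m by (induction m) auto
  thus ?case by (simp add: same_tangle_refl)
next
  case (Cons x S)
  have step: "same_tangle (x # S @ T) (block_left (Suc (length S)) (length T))
      (map (shift 1) (block_left (length S) (length T)) @ string_right (length T)) (T @ x # S)"
  proof (induction T rule: rev_induct)
    case Nil
    thus ?case by (simp add: string_right_def same_tangle_refl)
  next
    case (snoc y T)
    let ?n = "length S" and ?m = "length T"
    let ?Y = "string_left (length S)"
    have sl: "string_left (Suc ?n) = map (shift 1) ?Y @ [Crossing 0 True]"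
      using string_left_add[of ?n 1] by simp
    have 1: "same_tangle (x # S @ T @ [y]) (block_left (Suc ?n) ?m)
        (map (shift 1) (block_left ?n ?m) @ string_right ?m) (T @ x # S @ [y])"
      using same_tangle_pad[OF snoc, of "[]" "[y]"] by simp
    have 2: "tangle (T @ x # S @ [y]) (map (shift ?m) (string_left (Suc ?n))) (T @ y # x # S)"
      using tangle_left[OF tangle_string_left[of "x # S" y], of T] by simp
    have 3: "tangle (x # S @ T @ [y]) (map (shift 1) (block_left ?n ?m)) (x # T @ S @ [y])"
      using tangle_both[OF tangle_block_left[of S T], of "[x]" "[y]"] by simp
    have 4: "same_tangle (x # T @ S @ [y])
        (string_right ?m @ map (shift (length (T @ [x]))) ?Y)
        (map (shift (length (x # T))) ?Y @ string_right ?m) (T @ x # y # S)"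
      using interchange_tangle[OF tangle_string_right[of x T] tangle_string_left[of S y]] by simp
    have 5: "tangle (T @ x # y # S) [Crossing ?m True] (T @ y # x # S)"
      by simp
    have "same_tangle (x # S @ T @ [y]) (block_left (Suc ?n) (Suc ?m))
        (map (shift 1) (block_left ?n ?m) @ string_right ?m @ map (shift ?m) (string_left (Suc ?n)))
        (T @ y # x # S)"
      using same_tangle_append[OF 1 same_tangle_refl[OF 2]] by simp
    also have "same_tangle (x # S @ T @ [y])
        (map (shift 1) (block_left ?n ?m) @ string_right ?m @ map (shift ?m) (string_left (Suc ?n)))
        (map (shift 1) (block_left ?n ?m) @ map (shift (Suc ?m)) ?Y @ string_right ?m @ [Crossing ?m True])
        (T @ y # x # S)"
      using same_tangle_append[OF same_tangle_refl[OF 3]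
          same_tangle_append[OF 4 same_tangle_refl[OF 5]]]
      by (simp add: sl del: string_left.simps)
    finally show ?case by (simp add: string_right_def)
  qed
  have "same_tangle (x # S @ T) (map (shift 1) (block_left (length S) (length T)))
      (map (shift 1) (block_right (length S) (length T))) (x # T @ S)"
    using same_tangle_pad[OF Cons, of "[x]" "[]"] by simp
  moreover have "tangle (x # T @ S) (string_right (length T)) (T @ x # S)"
    using tangle_right[OF tangle_string_right[of x T], of S] by simp
  ultimately have "same_tangle (x # S @ T)
      (map (shift 1) (block_left (length S) (length T)) @ string_right (length T))
      (map (shift 1) (block_right (length S) (length T)) @ string_right (length T)) (T @ x # S)"
    by (intro same_tangle_append same_tangle_refl)
  from same_tangle_trans[OF step this] show ?case by simp
qed

fun mirror :: "event \<Rightarrow> event" where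
  "mirror (Crossing i b) = Crossing i (\<not> b)"
| "mirror e = e"

lemma string_left_crossings: "e \<in> set (string_left n) \<Longrightarrow> \<exists>i b. e = Crossing i b"
  by (induction n) auto

lemma block_left_crossings: "e \<in> set (block_left n m) \<Longrightarrow> \<exists>i b. e = Crossing i b"
  by (induction m) (use string_left_crossings in fastforce)+

lemma crossings_inverse:
  assumes "tangle P w Q" "\<And>e. e \<in> set w \<Longrightarrow> \<exists>i b. e = Crossing i b"
  shows "same_tangle P (w @ rev (map mirror w)) [] P" "same_tangle Q (rev (map mirror w) @ w) [] Q"
proof -
  have "same_tangle P (w @ rev (map mirror w)) [] P \<and> same_tangle Q (rev (map mirror w) @ w) [] Q"
    using assms
  proof (induction w arbitrary: P)
    case Nil
    thus ?case by (simp add: same_tangle_refl)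
  next
    case (Cons e w)
    then obtain i b where e: "e = Crossing i b" by fastforce
    let ?P = "after P e"
    have w: "tangle ?P w Q" using Cons.prems(1) by simp
    have IH: "same_tangle ?P (w @ rev (map mirror w)) [] ?P" "same_tangle Q (rev (map mirror w) @ w) [] Q"
      using Cons.IH[OF w] Cons.prems(2) by auto
    from Cons.prems(1) e have "i + 1 < length P" by simp
    then obtain L x y R where P: "P = L @ x # y # R" "i = length L" by (rule list_split2)
    have P': "?P = L @ y # x # R" by (simp add: P e)
    have 1: "tangle P [e] ?P" "tangle ?P [mirror e] P" by (simp_all add: e P)
    have 2: "same_tangle P ([e] @ [mirror e]) [] P"
      using same_tangle_move[OF diagram_move.R2[of i b], of P P] by (simp add: e P)
    have "diagram_move [Crossing i (\<not> b), Crossing i b] []"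
      using diagram_move.R2[of i "\<not> b"] by simp
    from same_tangle_move[OF this, of ?P ?P]
    have 3: "same_tangle ?P ([mirror e] @ [e]) [] ?P" by (simp add: e P)
    have rw: "tangle Q (rev (map mirror w)) ?P"
      using same_tangleD(1)[OF IH(1)] w tangle_unique by (auto simp: tangle_append)
    have "same_tangle P ([e] @ (w @ rev (map mirror w)) @ [mirror e]) ([e] @ [] @ [mirror e]) P"
      by (rule same_tangle_append[OF same_tangle_refl[OF 1(1)]
            same_tangle_append[OF IH(1) same_tangle_refl[OF 1(2)]]])
    from same_tangle_trans[OF this] 2 have A: "same_tangle P ((e # w) @ rev (map mirror (e # w))) [] P"
      by simp
    have "same_tangle Q (rev (map mirror w) @ ([mirror e] @ [e]) @ w) (rev (map mirror w) @ [] @ w) Q"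
      by (rule same_tangle_append[OF same_tangle_refl[OF rw]
            same_tangle_append[OF 3 same_tangle_refl[OF w]]])
    from same_tangle_trans[OF this] IH(2) have "same_tangle Q (rev (map mirror (e # w)) @ (e # w)) [] Q"
      by simp
    with A show ?case ..
  qed
  thus "same_tangle P (w @ rev (map mirror w)) [] P" "same_tangle Q (rev (map mirror w) @ w) [] Q"
    by blast+
qed

lemma same_annular_commute: "same_annular (D + D') (D' + D)"
proof -
  obtain S a where D: "D = annular_of S a" and a: "tangle S a S" by (rule annular_cases)
  obtain T b where D': "D' = annular_of T b" and b: "tangle T b T" by (rule annular_cases)
  let ?a = "map (shift (length T)) a" and ?b = "map (shift (length S)) b"
  define r where "r = block_left (length S) (length T)"
  define r' where "r' = rev (map mirror r)"
  have r: "tangle (S @ T) r (T @ S)" unfolding r_def by (rule tangle_block_left)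
  have inv: "same_tangle (S @ T) (r @ r') [] (S @ T)" "same_tangle (T @ S) (r' @ r) [] (T @ S)"
    unfolding r'_def by (rule crossings_inverse[OF r]; simp add: r_def block_left_crossings)+
  have r': "tangle (T @ S) r' (S @ T)"
    using same_tangleD(1)[OF inv(1)] r tangle_unique by (auto simp: tangle_append)
  have a1: "tangle (S @ T) a (S @ T)" and a2: "tangle (T @ S) ?a (T @ S)"
    and b1: "tangle (S @ T) ?b (S @ T)" and b2: "tangle (T @ S) b (T @ S)"
    using a b by (auto intro: tangle_right tangle_left)
  have nat_a: "same_tangle (S @ T) (a @ r) (r @ ?a) (T @ S)"
    unfolding r_def by (rule block_left_tangle[OF a])
  have nat_b: "same_tangle (S @ T) (?b @ r) (r @ b) (T @ S)"
  proof -
    have *: "same_tangle (S @ T) r (block_right (length S) (length T)) (T @ S)"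
      unfolding r_def by (rule block_left_right)
    have "same_tangle (S @ T) (?b @ r) (?b @ block_right (length S) (length T)) (T @ S)"
      by (rule same_tangle_append[OF same_tangle_refl[OF b1] *])
    also have "same_tangle (S @ T) (?b @ block_right (length S) (length T))
        (block_right (length S) (length T) @ b) (T @ S)"
      by (rule block_right_tangle(1)[OF b])
    also have "same_tangle (S @ T) (block_right (length S) (length T) @ b) (r @ b) (T @ S)"
      by (rule same_tangle_append[OF same_tangle_sym[OF *] same_tangle_refl[OF b2]])
    finally show ?thesis .
  qed
  have "same_tangle (S @ T) ((a @ ?b) @ (r @ r')) ((a @ ?b) @ []) (S @ T)"
    by (rule same_tangle_append[OF same_tangle_refl[OF tangle_appendI[OF a1 b1]] inv(1)])
  hence 1: "same_tangle (S @ T) (a @ ?b) (a @ ?b @ r @ r') (S @ T)"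
    by (simp add: same_tangle_sym)
  have "same_tangle (S @ T) (a @ (?b @ r) @ r') (a @ (r @ b) @ r') (S @ T)"
    by (rule same_tangle_append[OF same_tangle_refl[OF a1]
          same_tangle_append[OF nat_b same_tangle_refl[OF r']]])
  hence 2: "same_tangle (S @ T) (a @ ?b @ r @ r') (a @ r @ b @ r') (S @ T)" by simp
  have "same_tangle (S @ T) ((a @ r) @ (b @ r')) ((r @ ?a) @ (b @ r')) (S @ T)"
    by (rule same_tangle_append[OF nat_a same_tangle_refl[OF tangle_appendI[OF b2 r']]])
  hence 3: "same_tangle (S @ T) (a @ r @ b @ r') (r @ ?a @ b @ r') (S @ T)" by simp
  have 4: "same_annular (annular_of (S @ T) (r @ ?a @ b @ r')) (annular_of (T @ S) ((?a @ b @ r') @ r))"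
    by (intro same_annular_rotate r tangle_appendI[OF a2] tangle_appendI[OF b2 r'])
  have "same_tangle (T @ S) ((?a @ b) @ (r' @ r)) ((?a @ b) @ []) (T @ S)"
    by (rule same_tangle_append[OF same_tangle_refl[OF tangle_appendI[OF a2 b2]] inv(2)])
  hence 5: "same_tangle (T @ S) ((?a @ b @ r') @ r) (?a @ b) (T @ S)" by simp
  have 6: "same_tangle (T @ S) (?a @ b) (b @ ?a) (T @ S)"
    by (rule same_tangle_sym[OF interchange_tangle[OF b a]])
  have "same_annular (annular_of (S @ T) (a @ ?b)) (annular_of (T @ S) (b @ ?a))"
    using same_tangle_annular[OF same_tangle_trans[OF same_tangle_trans[OF 1 2] 3]] 4
      same_tangle_annular[OF same_tangle_trans[OF 5 6]] same_annular_trans by blast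
  thus ?thesis by (simp add: D D' plus_annular_of a b)
qed

subsection \<open>The algebra\<close>

lemma span_equivp: "equivp (\<lambda>x y. x - y \<in> free.span A)"
proof (rule equivpI)
  show "reflp (\<lambda>x y. x - y \<in> free.span A)" by (auto intro!: reflpI simp: free.span_zero)
  show "symp (\<lambda>x y. x - y \<in> free.span A)"
    by (rule sympI) (drule free.span_neg, simp)
  show "transp (\<lambda>x y. x - y \<in> free.span A)"
    by (rule transpI) (drule (1) free.span_add, simp)
qed

lemma span_congruences:
  "x - x' \<in> free.span A \<Longrightarrow> y - y' \<in> free.span A \<Longrightarrow> (x + y) - (x' + y') \<in> free.span A"
  "x - x' \<in> free.span A \<Longrightarrow> y - y' \<in> free.span A \<Longrightarrow> (x - y) - (x' - y') \<in> free.span A"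
  "x - x' \<in> free.span A \<Longrightarrow> (- x) - (- x') \<in> free.span A"
  "x - x' \<in> free.span A \<Longrightarrow> free_scale c x - free_scale c x' \<in> free.span A"
proof -
  show "(x + y) - (x' + y') \<in> free.span A" if "x - x' \<in> free.span A" "y - y' \<in> free.span A"
    using free.span_add[OF that] by (simp add: algebra_simps)
  show "(x - y) - (x' - y') \<in> free.span A" if "x - x' \<in> free.span A" "y - y' \<in> free.span A"
    using free.span_diff[OF that] by (simp add: algebra_simps)
  show "(- x) - (- x') \<in> free.span A" if "x - x' \<in> free.span A"
    using free.span_neg[OF that] by simp
  show "free_scale c x - free_scale c x' \<in> free.span A" if "x - x' \<in> free.span A"
    using free.span_scale[OF that, of c] by (simp add: free.scale_right_diff_distrib)
qed

lemma annular_commute_span: "x * y - y * x \<in> annular_span"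
proof (induction x rule: free_induct)
  case (add k a x)
  have "Poly_Mapping.single k a * y - y * Poly_Mapping.single k a \<in> annular_span"
  proof (induction y rule: free_induct)
    case (add l b y)
    have "free_scale (a * b) (Poly_Mapping.single (k + l) 1 - Poly_Mapping.single (l + k) 1)
        \<in> annular_span"
      using same_annular_commute[of k l] unfolding same_annular_def by (rule free.span_scale)
    hence "Poly_Mapping.single k a * Poly_Mapping.single l b
        - Poly_Mapping.single l b * Poly_Mapping.single k a \<in> annular_span"
      by (simp add: mult_single free.scale_right_diff_distrib mult.commute)
    from free.span_add[OF this add] show ?case by (simp add: algebra_simps)
  qed (simp add: free.span_zero)
  from free.span_add[OF this add] show ?case by (simp add: algebra_simps)
qed (simp add: free.span_zero)

quotient_type annulus_skein = "annular \<Rightarrow>\<^sub>0 lam" / "\<lambda>x y. x - y \<in> annular_span"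
  by (rule span_equivp)

instantiation annulus_skein :: comm_ring_1
begin

lift_definition zero_annulus_skein :: annulus_skein is 0 .
lift_definition one_annulus_skein :: annulus_skein is 1 .
lift_definition plus_annulus_skein :: "annulus_skein \<Rightarrow> annulus_skein \<Rightarrow> annulus_skein"
  is "(+)" by (rule span_congruences)
lift_definition minus_annulus_skein :: "annulus_skein \<Rightarrow> annulus_skein \<Rightarrow> annulus_skein"
  is "(-)" by (rule span_congruences)
lift_definition uminus_annulus_skein :: "annulus_skein \<Rightarrow> annulus_skein"
  is uminus by (rule span_congruences)
lift_definition times_annulus_skein :: "annulus_skein \<Rightarrow> annulus_skein \<Rightarrow> annulus_skein"
  is "(*)"
proof -
  fix x x' y y' :: "annular \<Rightarrow>\<^sub>0 lam"
  assume "x - x' \<in> annular_span" "y - y' \<in> annular_span"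
  hence "(x - x') * y + x' * (y - y') \<in> annular_span"
    by (intro free.span_add annular_span_left annular_span_right)
  thus "x * y - x' * y' \<in> annular_span" by (simp add: algebra_simps)
qed

instance
proof
  fix a b c :: annulus_skein
  show "a * b * c = a * (b * c)" by transfer (simp add: mult.assoc free.span_zero)
  show "a * b = b * a" by transfer (rule annular_commute_span)
  show "1 * a = a" by transfer (simp add: free.span_zero)
  show "a + b + c = a + (b + c)" by transfer (simp add: add.assoc free.span_zero)
  show "a + b = b + a" by transfer (simp add: add.commute free.span_zero)
  show "0 + a = a" by transfer (simp add: free.span_zero)
  show "- a + a = 0" by transfer (simp add: free.span_zero)
  show "a - b = a + - b" by transfer (simp add: free.span_zero)
  show "(a + b) * c = a * c + b * c" by transfer (simp add: distrib_right free.span_zero)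
  show "(0 :: annulus_skein) \<noteq> 1"
    by transfer (use annular_span_proper free.span_neg in fastforce)
qed

end

lift_definition scale_annulus :: "lam \<Rightarrow> annulus_skein \<Rightarrow> annulus_skein" (infixr \<open>*\<^sub>C\<close> 75)
  is free_scale by (rule span_congruences)

section \<open>The skeins \<open>H\<^sub>n\<close> and the closure map\<close>

text \<open>
  \<open>box_of n w\<close> is the \<open>n\<close>-tangle \<open>w\<close>, all of whose \<open>n\<close> inputs at the bottom and \<open>n\<close> outputs
  at the top are directed upwards. The tangles for all \<open>n\<close> are collected in a single type, so that
  \<open>box_skein\<close> is the direct sum of the algebras \<open>H\<^sub>n\<close>; no relation mixes different values of \<open>n\<close>.
\<close>

typedef box = "{(n, w). tangle (replicate n Up) w (replicate n Up)}"
  by (rule exI[of _ "(0, [])"]) simp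

definition box_of :: "nat \<Rightarrow> event list \<Rightarrow> box" where
  "box_of n w = Abs_box (n, w)"

lemma box_cases:
  obtains n w where "D = box_of n w" "tangle (replicate n Up) w (replicate n Up)"
proof -
  obtain n w where *: "Rep_box D = (n, w)" by (cases "Rep_box D")
  with Rep_box[of D] have "tangle (replicate n Up) w (replicate n Up)" by simp
  moreover from * have "D = box_of n w"
    by (metis Rep_box_inverse box_of_def)
  ultimately show ?thesis using that by blast
qed

lemma Rep_box_of:
  "tangle (replicate n Up) w (replicate n Up) \<Longrightarrow> Rep_box (box_of n w) = (n, w)"
  by (simp add: box_of_def Abs_box_inverse)

definition box_relations :: "(box \<Rightarrow>\<^sub>0 lam) set" where
  "box_relations =
    \<Union>{local_relations (\<lambda>w. box_of n (u @ w @ v)) P Q | n P Q u v.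
        tangle (replicate n Up) u P \<and> tangle Q v (replicate n Up)}"

lemma box_relations_local:
  assumes "r \<in> local_relations D P Q" "tangle (replicate n Up) u P" "tangle Q v (replicate n Up)"
    and "D = (\<lambda>w. box_of n (u @ w @ v))"
  shows "r \<in> box_relations"
  using assms unfolding box_relations_def by blast

text \<open>
  The composition \<open>D E\<close> of two tangles has \<open>E\<close> on top of \<open>D\<close>. It is extended bilinearly; the
  product of elements of \<open>H\<^sub>n\<close> and \<open>H\<^sub>m\<close> with \<open>n \<noteq> m\<close> is set to \<open>0\<close>.
\<close>

definition strings :: "box \<Rightarrow> nat" where
  "strings D = fst (Rep_box D)"

definition stack :: "box \<Rightarrow> box \<Rightarrow> box" where
  "stack D E = box_of (strings D) (snd (Rep_box D) @ snd (Rep_box E))"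

definition stack_mult :: "(box \<Rightarrow>\<^sub>0 lam) \<Rightarrow> (box \<Rightarrow>\<^sub>0 lam) \<Rightarrow> (box \<Rightarrow>\<^sub>0 lam)" where
  "stack_mult x y = (\<Sum>D\<in>Poly_Mapping.keys x. \<Sum>E\<in>Poly_Mapping.keys y.
    if strings D = strings E
    then Poly_Mapping.single (stack D E) (Poly_Mapping.lookup x D * Poly_Mapping.lookup y E) else 0)"

lemma strings_box_of:
  "tangle (replicate n Up) w (replicate n Up) \<Longrightarrow> strings (box_of n w) = n"
  by (simp add: strings_def Rep_box_of)

lemma stack_box_of:
  "tangle (replicate n Up) u (replicate n Up) \<Longrightarrow> tangle (replicate n Up) w (replicate n Up) \<Longrightarrow>
    stack (box_of n u) (box_of n w) = box_of n (u @ w)"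
  by (simp add: stack_def strings_def Rep_box_of)

lemma strings_stack [simp]: "strings D = strings E \<Longrightarrow> strings (stack D E) = strings D"
  by (cases D rule: box_cases; cases E rule: box_cases)
    (simp add: strings_box_of stack_box_of tangle_appendI)

lemma stack_assoc:
  "strings D = strings E \<Longrightarrow> strings E = strings F \<Longrightarrow> stack (stack D E) F = stack D (stack E F)"
  by (cases D rule: box_cases; cases E rule: box_cases; cases F rule: box_cases)
    (simp add: strings_box_of stack_box_of tangle_appendI)

lemma stack_mult_add:
  "stack_mult (x + y) z = stack_mult x z + stack_mult y z"
  "stack_mult z (x + y) = stack_mult z x + stack_mult z y"
proof -
  show "stack_mult (x + y) z = stack_mult x z + stack_mult y z"
    unfolding stack_mult_def
  proof (rule ext_add)
    fix D and a b :: lam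
    show "(\<Sum>E\<in>Poly_Mapping.keys z. if strings D = strings E
        then Poly_Mapping.single (stack D E) ((a + b) * Poly_Mapping.lookup z E) else 0) =
      (\<Sum>E\<in>Poly_Mapping.keys z. if strings D = strings E
        then Poly_Mapping.single (stack D E) (a * Poly_Mapping.lookup z E) else 0) +
      (\<Sum>E\<in>Poly_Mapping.keys z. if strings D = strings E
        then Poly_Mapping.single (stack D E) (b * Poly_Mapping.lookup z E) else 0)"
      unfolding sum.distrib[symmetric]
      by (intro sum.cong refl) (simp add: distrib_right single_add)
  qed (simp cong: if_cong)
  have "(\<Sum>E\<in>Poly_Mapping.keys (x + y). if strings D = strings E
      then Poly_Mapping.single (stack D E) (a * Poly_Mapping.lookup (x + y) E) else 0) =
    (\<Sum>E\<in>Poly_Mapping.keys x. if strings D = strings E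
      then Poly_Mapping.single (stack D E) (a * Poly_Mapping.lookup x E) else 0) +
    (\<Sum>E\<in>Poly_Mapping.keys y. if strings D = strings E
      then Poly_Mapping.single (stack D E) (a * Poly_Mapping.lookup y E) else 0)" for D a
    by (rule ext_add) (auto simp: distrib_left single_add)
  thus "stack_mult z (x + y) = stack_mult z x + stack_mult z y"
    unfolding stack_mult_def by (simp add: sum.distrib)
qed

lemma stack_mult_0 [simp]: "stack_mult 0 x = 0" "stack_mult x 0 = 0"
  by (simp_all add: stack_mult_def)

lemma stack_mult_single:
  "stack_mult (Poly_Mapping.single D a) (Poly_Mapping.single E b) =
    (if strings D = strings E then Poly_Mapping.single (stack D E) (a * b) else 0)"
  by (simp add: stack_mult_def)

lemma stack_mult_scale:
  "stack_mult (free_scale c x) y = free_scale c (stack_mult x y)"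
  "stack_mult x (free_scale c y) = free_scale c (stack_mult x y)"
proof -
  have *: "stack_mult (Poly_Mapping.single k (c * a)) z = free_scale c (stack_mult (Poly_Mapping.single k a) z)"
    "stack_mult (Poly_Mapping.single k a) (free_scale c z) = free_scale c (stack_mult (Poly_Mapping.single k a) z)"
    for k a z
    by (induction z rule: free_induct)
      (simp_all add: stack_mult_add stack_mult_single free.scale_right_distrib mult.assoc mult.left_commute)
  show "stack_mult (free_scale c x) y = free_scale c (stack_mult x y)"
    by (induction x rule: free_induct)
      (simp_all add: stack_mult_add free.scale_right_distrib *)
  show "stack_mult x (free_scale c y) = free_scale c (stack_mult x y)"
    by (induction x rule: free_induct)
      (simp_all add: stack_mult_add free.scale_right_distrib *)
qed

lemma stack_mult_minus:
  "stack_mult (x - y) z = stack_mult x z - stack_mult y z"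
  "stack_mult z (x - y) = stack_mult z x - stack_mult z y"
  using stack_mult_add(1)[of "x - y" y z] stack_mult_add(2)[of z "x - y" y] by simp_all

lemma stack_mult_assoc: "stack_mult (stack_mult x y) z = stack_mult x (stack_mult y z)"
proof (induction x rule: free_induct)
  case (add k a x)
  have "stack_mult (stack_mult (Poly_Mapping.single k a) y) z =
    stack_mult (Poly_Mapping.single k a) (stack_mult y z)"
  proof (induction y rule: free_induct)
    case (add l b y)
    have "stack_mult (stack_mult (Poly_Mapping.single k a) (Poly_Mapping.single l b)) z =
      stack_mult (Poly_Mapping.single k a) (stack_mult (Poly_Mapping.single l b) z)"
      by (induction z rule: free_induct)
        (simp_all add: stack_mult_add stack_mult_single stack_assoc mult.assoc)
    with add show ?case by (simp add: stack_mult_add)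
  qed simp
  with add show ?case by (simp add: stack_mult_add)
qed simp

lemma stack_mult_eq_free_map:
  assumes "\<And>E. E \<in> Poly_Mapping.keys x \<Longrightarrow> strings E = strings D"
  shows "stack_mult (Poly_Mapping.single D 1) x = free_map (stack D) x"
    and "stack_mult x (Poly_Mapping.single D 1) = free_map (\<lambda>E. stack E D) x"
  using assms by (auto simp: stack_mult_def free_map_def intro!: sum.cong)

lemma stack_mult_eq_0:
  assumes "\<And>E. E \<in> Poly_Mapping.keys x \<Longrightarrow> strings E \<noteq> strings D"
  shows "stack_mult (Poly_Mapping.single D 1) x = 0" "stack_mult x (Poly_Mapping.single D 1) = 0"
  using assms by (auto simp: stack_mult_def intro!: sum.neutral) metis+

lemma keys_local_relations:
  assumes "r \<in> local_relations D P Q" "E \<in> Poly_Mapping.keys r"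
  shows "\<exists>w. tangle P w Q \<and> E = D w"
  using assms
proof (cases rule: local_relations.cases)
  case (skein i)
  have "tangle P [Crossing i False] Q" "tangle P [] Q" using skein by (simp_all add: after.simps(1))
  with skein assms(2) show ?thesis
    by (auto dest!: subsetD[OF Poly_Mapping.keys_diff] split: if_splits simp del: tangle.simps)
qed (use assms(2) in \<open>auto dest!: subsetD[OF Poly_Mapping.keys_diff] split: if_splits
      intro: exI[of _ "[]"] simp del: tangle.simps(2)\<close>)

lemma box_relations_mult:
  assumes "r \<in> box_relations"
  shows "stack_mult (Poly_Mapping.single D 1) r \<in> free.span box_relations"
    and "stack_mult r (Poly_Mapping.single D 1) \<in> free.span box_relations"
proof -
  obtain m b where D: "D = box_of m b" and b: "tangle (replicate m Up) b (replicate m Up)"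
    by (rule box_cases)
  obtain n P Q u v where r: "r \<in> local_relations (\<lambda>w. box_of n (u @ w @ v)) P Q"
    and u: "tangle (replicate n Up) u P" and v: "tangle Q v (replicate n Up)"
    using assms unfolding box_relations_def by blast
  have uwv: "tangle (replicate n Up) (u @ w @ v) (replicate n Up)" if "tangle P w Q" for w
    by (intro tangle_appendI[OF u] tangle_appendI[OF that v])
  have keys: "strings E = n" if "E \<in> Poly_Mapping.keys r" for E
    using keys_local_relations[OF r that] uwv strings_box_of by metis
  have "stack_mult (Poly_Mapping.single D 1) r \<in> free.span box_relations \<and>
    stack_mult r (Poly_Mapping.single D 1) \<in> free.span box_relations"
  proof (cases "m = n")
    case False
    thus ?thesis using keys by (simp add: stack_mult_eq_0 D strings_box_of b free.span_zero)
  next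
    case True
    have "free_map (stack D) r \<in> local_relations (\<lambda>w. box_of n ((b @ u) @ w @ v)) P Q"
      using b True by (intro free_map_local_relations[OF r]) (simp add: D stack_box_of uwv)
    hence 1: "free_map (stack D) r \<in> box_relations"
      by (rule box_relations_local[OF _ tangle_appendI[OF b[unfolded True] u] v]) simp
    have "free_map (\<lambda>E. stack E D) r \<in> local_relations (\<lambda>w. box_of n (u @ w @ (v @ b))) P Q"
      using b True by (intro free_map_local_relations[OF r]) (simp add: D stack_box_of uwv)
    hence 2: "free_map (\<lambda>E. stack E D) r \<in> box_relations"
      by (rule box_relations_local[OF _ u tangle_appendI[OF v b[unfolded True]]]) simp
    show ?thesis
      using 1 2 keys True b by (simp add: stack_mult_eq_free_map D strings_box_of free.span_base)
  qed
  thus "stack_mult (Poly_Mapping.single D 1) r \<in> free.span box_relations"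
    "stack_mult r (Poly_Mapping.single D 1) \<in> free.span box_relations" by blast+
qed

lemma box_span_left:
  "y \<in> free.span box_relations \<Longrightarrow> stack_mult x y \<in> free.span box_relations"
proof (induction y rule: free.span_induct_alt)
  case (step c r y)
  have "stack_mult x r \<in> free.span box_relations"
  proof (induction x rule: free_induct)
    case (add k a x)
    have "stack_mult (Poly_Mapping.single k a) r = free_scale a (stack_mult (Poly_Mapping.single k 1) r)"
      by (simp add: stack_mult_scale(1)[symmetric])
    with add show ?case
      using box_relations_mult(1)[OF step(1)] free.span_add free.span_scale
      by (metis stack_mult_add(1))
  qed (simp add: free.span_zero)
  with step show ?case
    by (simp add: stack_mult_add stack_mult_scale free.span_add free.span_scale)
qed (simp add: free.span_zero)

lemma box_span_right:
  "x \<in> free.span box_relations \<Longrightarrow> stack_mult x y \<in> free.span box_relations"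
proof (induction x rule: free.span_induct_alt)
  case (step c r x)
  have "stack_mult r y \<in> free.span box_relations"
  proof (induction y rule: free_induct)
    case (add k a y)
    have "stack_mult r (Poly_Mapping.single k a) = free_scale a (stack_mult r (Poly_Mapping.single k 1))"
      by (simp add: stack_mult_scale(2)[symmetric])
    with add show ?case
      using box_relations_mult(2)[OF step(1)] free.span_add free.span_scale
      by (metis stack_mult_add(2))
  qed (simp add: free.span_zero)
  with step show ?case
    by (simp add: stack_mult_add stack_mult_scale free.span_add free.span_scale)
qed (simp add: free.span_zero)

quotient_type box_skein = "box \<Rightarrow>\<^sub>0 lam" / "\<lambda>x y. x - y \<in> free.span box_relations"
  by (rule span_equivp)

instantiation box_skein :: ring
begin

lift_definition zero_box_skein :: box_skein is 0 .
lift_definition plus_box_skein :: "box_skein \<Rightarrow> box_skein \<Rightarrow> box_skein"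
  is "(+)" by (rule span_congruences)
lift_definition minus_box_skein :: "box_skein \<Rightarrow> box_skein \<Rightarrow> box_skein"
  is "(-)" by (rule span_congruences)
lift_definition uminus_box_skein :: "box_skein \<Rightarrow> box_skein"
  is uminus by (rule span_congruences)
lift_definition times_box_skein :: "box_skein \<Rightarrow> box_skein \<Rightarrow> box_skein"
  is stack_mult
proof -
  fix x x' y y' :: "box \<Rightarrow>\<^sub>0 lam"
  assume "x - x' \<in> free.span box_relations" "y - y' \<in> free.span box_relations"
  hence "stack_mult (x - x') y + stack_mult x' (y - y') \<in> free.span box_relations"
    by (intro free.span_add box_span_left box_span_right)
  thus "stack_mult x y - stack_mult x' y' \<in> free.span box_relations"
    by (simp add: stack_mult_minus)
qed

instance
proof
  fix a b c :: box_skein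
  show "a + b + c = a + (b + c)" by transfer (simp add: add.assoc free.span_zero)
  show "a + b = b + a" by transfer (simp add: add.commute free.span_zero)
  show "0 + a = a" by transfer (simp add: free.span_zero)
  show "- a + a = 0" by transfer (simp add: free.span_zero)
  show "a - b = a + - b" by transfer (simp add: free.span_zero)
  show "a * b * c = a * (b * c)" by transfer (simp add: stack_mult_assoc free.span_zero)
  show "(a + b) * c = a * c + b * c" by transfer (simp add: stack_mult_add free.span_zero)
  show "a * (b + c) = a * b + a * c" by transfer (simp add: stack_mult_add free.span_zero)
qed

end

lift_definition scale_box :: "lam \<Rightarrow> box_skein \<Rightarrow> box_skein" (infixr \<open>*\<^sub>H\<close> 75)
  is free_scale by (rule span_congruences)

definition box_class :: "box \<Rightarrow> box_skein" where
  "box_class D = abs_box_skein (Poly_Mapping.single D 1)"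

definition close_box :: "box \<Rightarrow> annular" where
  "close_box D = (case Rep_box D of (n, w) \<Rightarrow> annular_of (replicate n Up) w)"

lemma close_box_of:
  "tangle (replicate n Up) w (replicate n Up) \<Longrightarrow> close_box (box_of n w) = annular_of (replicate n Up) w"
  by (simp add: close_box_def box_of_def Abs_box_inverse)

lemma close_box_relations:
  assumes "r \<in> box_relations" shows "free_map close_box r \<in> annular_relations"
proof -
  obtain n P Q u v where r: "r \<in> local_relations (\<lambda>w. box_of n (u @ w @ v)) P Q"
    and u: "tangle (replicate n Up) u P" and v: "tangle Q v (replicate n Up)"
    using assms unfolding box_relations_def by blast
  have "free_map close_box r \<in> local_relations (\<lambda>w. annular_of (replicate n Up) (u @ w @ v)) P Q"
    by (rule free_map_local_relations[OF r])
      (intro close_box_of tangle_appendI[OF u] tangle_appendI[OF _ v])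
  thus ?thesis by (rule annular_relations_local[OF _ u v]) simp
qed

lift_definition closure_map :: "box_skein \<Rightarrow> annulus_skein" is "free_map close_box"
proof -
  fix x y :: "box \<Rightarrow>\<^sub>0 lam"
  assume "x - y \<in> free.span box_relations"
  hence "free_map close_box (x - y) \<in> annular_span"
    by (rule free_map_span) (intro free.span_base close_box_relations)
  thus "free_map close_box x - free_map close_box y \<in> annular_span" by (simp add: free_map_diff)
qed

section \<open>Braids and the symmetrisers\<close>

text \<open>The strings are numbered from \<open>1\<close> to \<open>n\<close>; \<open>box_one n\<close> is the unit of \<open>H\<^sub>n\<close>.\<close>

definition box_one :: "nat \<Rightarrow> box_skein" where
  "box_one n = box_class (box_of n [])"

definition sigma :: "nat \<Rightarrow> nat \<Rightarrow> box_skein" where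
  "sigma n i = box_class (box_of n [Crossing (i - 1) True])"

definition braid :: "nat \<Rightarrow> nat list \<Rightarrow> box_skein" where
  "braid n is = foldr (\<lambda>i x. sigma n i * x) is (box_one n)"

text \<open>The string of \<open>braid n is\<close> that starts in position \<open>j\<close> ends in position \<open>word_perm is j\<close>.\<close>

definition word_perm :: "nat list \<Rightarrow> nat \<Rightarrow> nat" where
  "word_perm is = fold (\<lambda>i p. transpose i (i + 1) \<circ> p) is id"

definition perm_length :: "nat \<Rightarrow> (nat \<Rightarrow> nat) \<Rightarrow> nat" where
  "perm_length n \<pi> = (LEAST k. \<exists>is. set is \<subseteq> {1..<n} \<and> word_perm is = \<pi> \<and> length is = k)"

definition reduced_word :: "nat \<Rightarrow> (nat \<Rightarrow> nat) \<Rightarrow> nat list \<Rightarrow> bool" where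
  "reduced_word n \<pi> is \<longleftrightarrow>
    set is \<subseteq> {1..<n} \<and> word_perm is = \<pi> \<and> length is = perm_length n \<pi>"

text \<open>By the braid relations \<open>perm_braid\<close> does not depend on the choice of the reduced word.\<close>

definition perm_braid :: "nat \<Rightarrow> (nat \<Rightarrow> nat) \<Rightarrow> box_skein" where
  "perm_braid n \<pi> = braid n (SOME is. reduced_word n \<pi> is)"

definition symm_a :: "nat \<Rightarrow> box_skein" where
  "symm_a n = (\<Sum>\<pi> | \<pi> permutes {1..n}. var_s ^ perm_length n \<pi> *\<^sub>H perm_braid n \<pi>)"

definition symm_b :: "nat \<Rightarrow> box_skein" where
  "symm_b n = (\<Sum>\<pi> | \<pi> permutes {1..n}. inverse (- var_s) ^ perm_length n \<pi> *\<^sub>H perm_braid n \<pi>)"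

definition h_elem :: "nat \<Rightarrow> annulus_skein" where
  "h_elem n = closure_map
    (inverse (\<Sum>\<pi> | \<pi> permutes {1..n}. var_s ^ (2 * perm_length n \<pi>)) *\<^sub>H symm_a n)"

definition e_elem :: "nat \<Rightarrow> annulus_skein" where
  "e_elem n = closure_map
    (inverse (\<Sum>\<pi> | \<pi> permutes {1..n}. inverse var_s ^ (2 * perm_length n \<pi>)) *\<^sub>H symm_b n)"

definition A_elem :: "nat \<Rightarrow> annulus_skein" where
  "A_elem m = closure_map (braid m (rev [1..<m]))"

section \<open>Power series over the skein of the annulus\<close>

definition H_series :: "annulus_skein fps" where
  "H_series = Abs_fps (\<lambda>n. if n = 0 then 1 else h_elem n)"

definition E_series :: "annulus_skein fps" where
  "E_series = Abs_fps (\<lambda>n. if n = 0 then 1 else e_elem n)"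

definition A_series :: "annulus_skein fps" where
  "A_series = Abs_fps (\<lambda>m. if m = 0 then 1 else var_z *\<^sub>C A_elem m)"

text \<open>\<open>fps_at F c\<close> is \<open>F(c t)\<close>.\<close>

definition fps_at :: "annulus_skein fps \<Rightarrow> lam \<Rightarrow> annulus_skein fps" where
  "fps_at F c = Abs_fps (\<lambda>n. c ^ n *\<^sub>C (F $ n))"

text \<open>The quotient by a power series with constant term \<open>1\<close>.\<close>

definition fps_quot :: "'a::comm_ring_1 fps \<Rightarrow> 'a fps \<Rightarrow> 'a fps" where
  "fps_quot F G = F * fps_right_inverse G 1"

lemma fps_quot_mult:
  assumes "G $ 0 = 1" shows "fps_quot F G * G = F"
proof -
  have "G * fps_right_inverse G 1 = 1" by (rule fps_right_inverse) (simp add: assms)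
  thus ?thesis unfolding fps_quot_def by (metis mult.assoc mult.commute mult_1_right)
qed

end

theory Submission
  imports Defs
begin

text \<open>
  The identity comes from a recursion for closures of symmetrisers that only uses the Hecke algebra
  relations, and it is applied twice, once for each root of \<open>x\<^sup>2 = 1 + x z\<close>. These roots are
  \<open>x = s\<close> and \<open>x = -s\<^sup>-\<^sup>1\<close>; the symmetriser \<open>\<Sum> x\<^bsup>l(\<pi>)\<^esup> \<omega>\<^sub>\<pi>\<close> is \<open>a\<^sub>n\<close> for the first and \<open>b\<^sub>n\<close>
  for the second. Let \<open>P\<^sub>n = \<Sum> x\<^bsup>2l(\<pi>)\<^esup>\<close> and let \<open>g\<^sub>n\<close> be the closure of the symmetriser divided
  by \<open>P\<^sub>n\<close>.

  Every permutation of \<open>n + 1\<close> strings first moves some string \<open>j\<close> to the last place and then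
  permutes the others, so that the symmetriser on \<open>n + 1\<close> strings is
  \<open>(\<Sum>\<^sub>j x\<^bsup>n+1-j\<^esup> \<sigma>\<^sub>j \<cdots> \<sigma>\<^sub>n)\<close> times the symmetriser on \<open>n\<close> strings. Let \<open>Y\<^sub>p\<^sub>,\<^sub>m\<close> be the closure
  of the \<open>(p + m)\<close>-string element \<open>\<sigma>\<^bsub>p+m-1\<^esub> \<cdots> \<sigma>\<^sub>p\<close> times the symmetriser on the first \<open>p\<close> strings.
  Expanding the symmetriser in \<open>Y\<^bsub>p+1,m\<^esub>\<close>, the term \<open>j = p + 1\<close> is a product of two braids lying
  side by side and closes to \<open>Y\<^bsub>p,0\<^esub> A\<^bsub>m+1\<^esub>\<close>. In every other term \<open>\<sigma>\<^sub>j \<cdots> \<sigma>\<^bsub>p-1\<^esub>\<close> commutes with the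
  long braid, is carried round the annulus and absorbed by the symmetriser, on which each \<open>\<sigma>\<^sub>i\<close>
  acts as \<open>x\<close>; what remains is \<open>Y\<^bsub>p,m+1\<^esub>\<close>. Dividing by \<open>P\<^sub>p\<close> and iterating,
  \<open>(1 + x\<^sup>2 + \<cdots> + x\<^bsup>2n-2\<^esup>) g\<^sub>n = \<Sum>\<^bsub>1\<le>m\<le>n\<^esub> x\<^bsup>m-1\<^esup> g\<^bsub>n-m\<^esub> A\<^sub>m\<close>,
  and multiplication by \<open>x z = x\<^sup>2 - 1\<close> turns this into \<open>A(t) G(x\<^sup>-\<^sup>1 t) = G(x t)\<close>
  (\<open>A_series_quotient\<close>).

  For the two roots this says \<open>A(t) H(s\<^sup>-\<^sup>1 t) = H(s t)\<close> and \<open>A(t) E(-s t) = E(-s\<^sup>-\<^sup>1 t)\<close>. Hence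
  \<open>K(t) = H(t) E(-t)\<close> satisfies \<open>K(s t) = K(s\<^sup>-\<^sup>1 t)\<close>, and as \<open>s\<^sup>n - s\<^sup>-\<^sup>n\<close> is a unit for
  \<open>n \<ge> 1\<close>, it follows that \<open>K = 1\<close> (\<open>H_E_inverse\<close>). So \<open>1/H(s\<^sup>-\<^sup>1 t) = E(-s\<^sup>-\<^sup>1 t)\<close>, which
  gives both equalities.

  The definition of \<open>\<omega>\<^sub>\<pi>\<close> uses an arbitrary reduced word; that all reduced words of \<open>\<pi>\<close> give the
  same braid is proved by rewriting words into normal form (\<open>normal_form\<close>). The absorption of
  generators on one side of the symmetriser follows from the inductive description of normal words,
  and on the other side by mirror symmetry (\<open>symm_sum_rev\<close>).
\<close>

section \<open>Normal forms of braid words\<close>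

text \<open>
  Equality in the braid monoid: a word stands for the product of the generators \<open>\<sigma>\<^sub>i\<close> named by its
  entries, read from the bottom of the braid to the top.
\<close>
inductive braid_equiv :: "nat list \<Rightarrow> nat list \<Rightarrow> bool" (infix \<open>\<approx>\<close> 50) where
  braid_refl [simp, intro]: "u \<approx> u"
| braid_sym: "u \<approx> v \<Longrightarrow> v \<approx> u"
| braid_trans [trans]: "u \<approx> v \<Longrightarrow> v \<approx> w \<Longrightarrow> u \<approx> w"
| far_commute: "i + 1 < j \<Longrightarrow> u @ [i, j] @ v \<approx> u @ [j, i] @ v"
| braid_relation: "u @ [i, i + 1, i] @ v \<approx> u @ [i + 1, i, i + 1] @ v"

lemma braid_equiv_context: "u \<approx> v \<Longrightarrow> a @ u @ b \<approx> a @ v @ b"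
proof (induction rule: braid_equiv.induct)
  case (far_commute i j u v)
  thus ?case using braid_equiv.far_commute[of i j "a @ u" "v @ b"] by simp
next
  case (braid_relation u i v)
  thus ?case using braid_equiv.braid_relation[of "a @ u" i "v @ b"] by simp
qed (auto intro: braid_sym braid_trans)

lemma braid_equiv_left: "u \<approx> v \<Longrightarrow> a @ u \<approx> a @ v"
  using braid_equiv_context[of u v a "[]"] by simp

lemma braid_equiv_right: "u \<approx> v \<Longrightarrow> u @ b \<approx> v @ b"
  using braid_equiv_context[of u v "[]" b] by simp

lemma braid_equiv_Cons: "u \<approx> v \<Longrightarrow> i # u \<approx> i # v"
  using braid_equiv_left[of u v "[i]"] by simp

lemma braid_equiv_rev: "u \<approx> v \<Longrightarrow> rev u \<approx> rev v"
proof (induction rule: braid_equiv.induct)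
  case (far_commute i j u v)
  thus ?case using braid_sym[OF braid_equiv.far_commute[of i j "rev v" "rev u"]] by simp
next
  case (braid_relation u i v)
  thus ?case using braid_equiv.braid_relation[of "rev v" i "rev u"] by simp
qed (auto intro: braid_sym braid_trans)

lemma braid_equiv_length: "u \<approx> v \<Longrightarrow> length u = length v"
  by (induction rule: braid_equiv.induct) auto

lemma word_perm_Nil [simp]: "word_perm [] = id"
  by (simp add: word_perm_def)

lemma word_perm_append: "word_perm (u @ v) = word_perm v \<circ> word_perm u"
proof (induction v rule: rev_induct)
  case (snoc i v)
  have "word_perm (w @ [i]) = transpose i (i + 1) \<circ> word_perm w" for w
    by (simp add: word_perm_def)
  thus ?case using snoc by (metis append_assoc comp_assoc)
qed simp

lemma word_perm_single: "word_perm [i] = transpose i (i + 1)"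
  by (simp add: word_perm_def)

lemma word_perm_Cons: "word_perm (i # u) = word_perm u \<circ> transpose i (i + 1)"
  using word_perm_append[of "[i]" u] by (simp add: word_perm_single)

lemma braid_equiv_word_perm: "u \<approx> v \<Longrightarrow> word_perm u = word_perm v"
proof (induction rule: braid_equiv.induct)
  case (far_commute i j u v)
  have "word_perm [i, j] = word_perm [j, i]"
    using far_commute by (auto simp: word_perm_Cons fun_eq_iff transpose_def)
  thus ?case by (simp only: word_perm_append)
next
  case (braid_relation u i v)
  have "word_perm [i, i + 1, i] = word_perm [i + 1, i, i + 1]"
    by (auto simp: word_perm_Cons fun_eq_iff transpose_def)
  thus ?case by (simp only: word_perm_append)
qed auto

lemma word_perm_permutes: "set u \<subseteq> {1..<n} \<Longrightarrow> word_perm u permutes {1..n}"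
  by (induction u)
    (auto simp: word_perm_Cons permutes_id intro!: permutes_compose permutes_swap_id)

lemma far_Cons:
  assumes "\<And>j. j \<in> set u \<Longrightarrow> i + 1 < j \<or> j + 1 < i"
  shows "i # u \<approx> u @ [i]"
  using assms
proof (induction u)
  case (Cons j u)
  have "[i, j] \<approx> [j, i]"
    using Cons.prems[of j] far_commute[of i j "[]" "[]"] far_commute[of j i "[]" "[]"]
    by (auto intro: braid_sym)
  from braid_equiv_right[OF this, of u] have "i # j # u \<approx> j # i # u" by simp
  also have "\<dots> \<approx> j # u @ [i]" using Cons by (intro braid_equiv_Cons) auto
  finally show ?case by simp
qed auto

lemma far_append:
  assumes "\<And>i j. i \<in> set u \<Longrightarrow> j \<in> set v \<Longrightarrow> i + 1 < j \<or> j + 1 < i"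
  shows "u @ v \<approx> v @ u"
  using assms
proof (induction u)
  case (Cons i u)
  have "i # u @ v \<approx> i # v @ u" using Cons by (intro braid_equiv_Cons) auto
  also have "\<dots> \<approx> v @ i # u"
    using braid_equiv_right[OF far_Cons[of v i], of u] Cons.prems by simp
  finally show ?case by simp
qed auto

lemma slide_below: "i + 1 < j \<Longrightarrow> i # [j..<N] \<approx> [j..<N] @ [i]"
  by (rule far_Cons) auto

text \<open>
  A crossing is pushed up past the string that runs from place \<open>j\<close> to place \<open>N\<close>. That string
  passes from its left to its right, so the crossing comes out one place lower.
\<close>
lemma slide_above:
  assumes "j < i" "i < N"
  shows "i # [j..<N] \<approx> [j..<N] @ [i - 1]"
proof -
  obtain k where k: "i = k + 1" "j \<le> k" using assms(1) by (cases i) auto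
  have split: "[j..<N] = [j..<k] @ [k, k + 1] @ [k + 2..<N]"
  proof -
    have "[j..<N] = [j..<k] @ [k..<N]" using upt_add_eq_append[of j k "N - k"] k assms(2) by simp
    thus ?thesis using k assms(2) by (simp add: upt_conv_Cons)
  qed
  have "(k + 1) # [j..<k] @ [k, k + 1] @ [k + 2..<N] \<approx>
      [j..<k] @ [k + 1, k, k + 1] @ [k + 2..<N]"
    using braid_equiv_right[OF far_Cons[of "[j..<k]" "k + 1"], of "[k, k + 1] @ [k + 2..<N]"]
    by simp
  also have "\<dots> \<approx> [j..<k] @ [k, k + 1, k] @ [k + 2..<N]"
    by (rule braid_sym[OF braid_relation])
  also have "\<dots> \<approx> [j..<k] @ [k, k + 1] @ [k + 2..<N] @ [k]"
    using braid_equiv_left[OF slide_below[of k "k + 2" N], of "[j..<k] @ [k, k + 1]"] by simp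
  finally show ?thesis unfolding split k(1) by simp
qed

text \<open>
  One word for each permutation. The word \<open>[j..<Suc n]\<close> takes the string from place \<open>j\<close> to the last
  place; these are the shortest representatives of the cosets of the symmetric group on \<open>n\<close> places
  in the one on \<open>n + 1\<close> places.
\<close>
fun normal_words :: "nat \<Rightarrow> nat list set" where
  "normal_words 0 = {[]}"
| "normal_words (Suc n) =
    (\<lambda>(j, w). [j..<Suc n] @ w) ` ({1..Suc n} \<times> normal_words n)"

lemma normal_words_set: "w \<in> normal_words n \<Longrightarrow> set w \<subseteq> {1..<n}"
  by (induction n arbitrary: w) (fastforce simp del: upt_Suc)+

lemma normal_words_SucI:
  "1 \<le> j \<Longrightarrow> j \<le> Suc n \<Longrightarrow> w \<in> normal_words n \<Longrightarrow> [j..<Suc n] @ w \<in> normal_words (Suc n)"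
  by (auto simp del: upt_Suc)

lemma Nil_normal_words: "[] \<in> normal_words n"
proof (induction n)
  case (Suc n)
  thus ?case using normal_words_SucI[of "Suc n" n "[]"] by simp
qed simp

text \<open>
  The exchange property: the generator \<open>i\<close> either slides through the first cycle \<open>[j..<Suc n]\<close> and
  reaches the shorter normal word, or lengthens that cycle (\<open>i = j - 1\<close>), or is its first letter
  (\<open>i = j\<close>). The second alternative of the conclusion is the case in which multiplication by \<open>i\<close>
  shortens the permutation.
\<close>
lemma normal_words_step:
  assumes "w \<in> normal_words n" "1 \<le> i" "i < n"
  shows "\<exists>w'\<in>normal_words n. i # w \<approx> w' \<or> w \<approx> i # w'"
  using assms
proof (induction n arbitrary: w i)
  case (Suc n)
  then obtain j v where w: "w = [j..<Suc n] @ v" and j: "1 \<le> j" "j \<le> Suc n"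
    and v: "v \<in> normal_words n" by (auto simp del: upt_Suc)
  have pass: ?case if "1 \<le> k" "k < n" and slide: "i # [j..<Suc n] \<approx> [j..<Suc n] @ [k]" for k
  proof -
    from Suc.IH[OF v that(1,2)] obtain v' where v': "v' \<in> normal_words n"
      and alt: "k # v \<approx> v' \<or> v \<approx> k # v'" by blast
    have slide': "i # [j..<Suc n] @ x \<approx> [j..<Suc n] @ k # x" for x
      using braid_equiv_right[OF slide, of x] by simp
    from alt have "i # w \<approx> [j..<Suc n] @ v' \<or> w \<approx> i # [j..<Suc n] @ v'"
      unfolding w using slide' braid_equiv_left braid_trans braid_sym by metis
    thus ?thesis using normal_words_SucI[OF j v'] by blast
  qed
  consider "i + 1 < j" | "i + 1 = j" | "i = j" | "j < i" by linarith
  thus ?case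
  proof cases
    case 1
    thus ?thesis using pass[OF _ _ slide_below] Suc.prems j by auto
  next
    case 2
    hence "i # w = [i..<Suc n] @ v" using Suc.prems by (simp add: w upt_conv_Cons del: upt_Suc)
    thus ?thesis using normal_words_SucI[of i n v] Suc.prems v by (metis less_imp_le braid_refl)
  next
    case 3
    hence "w = i # [i + 1..<Suc n] @ v" using Suc.prems by (simp add: w upt_conv_Cons del: upt_Suc)
    thus ?thesis using normal_words_SucI[of "i + 1" n v] Suc.prems v by (metis Suc_eq_plus1 Suc_leI le_add2 braid_refl)
  next
    case 4
    thus ?thesis using pass[OF _ _ slide_above] Suc.prems j by auto
  qed
qed simp

lemma word_perm_upt: "j \<le> N \<Longrightarrow> word_perm [j..<N] j = N"
proof (induction N)
  case (Suc N)
  thus ?case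
    by (cases "j = Suc N") (auto simp: word_perm_append word_perm_single)
qed simp

lemma word_perm_cycle_start:
  assumes "w \<in> normal_words n" "1 \<le> j" "j \<le> Suc n"
  shows "word_perm ([j..<Suc n] @ w) j = Suc n"
proof -
  have "word_perm w permutes {1..n}" using word_perm_permutes normal_words_set assms(1) by blast
  hence "word_perm w (Suc n) = Suc n" by (rule permutes_not_in) simp
  thus ?thesis using assms by (simp add: word_perm_append word_perm_upt del: upt_Suc)
qed

lemma word_perm_bij: "bij (word_perm u)"
proof (induction u)
  case (Cons i u)
  show ?case unfolding word_perm_Cons by (rule bij_comp[OF bij_transpose Cons])
qed (simp add: bij_id[unfolded id_def] id_def)

lemma word_perm_cancel:
  assumes "word_perm (a @ u) = word_perm (a @ v)"
  shows "word_perm u = word_perm v"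
proof
  fix y
  obtain x where "y = word_perm a x" using bij_is_surj[OF word_perm_bij] by (rule surjE)
  thus "word_perm u y = word_perm v y"
    using fun_cong[OF assms, of x] by (simp add: word_perm_append)
qed

lemma word_perm_cycle_unique:
  assumes "w \<in> normal_words n" "j \<in> {1..Suc n}" "w' \<in> normal_words n" "j' \<in> {1..Suc n}"
    and eq: "word_perm ([j..<Suc n] @ w) = word_perm ([j'..<Suc n] @ w')"
  shows "j = j'" "word_perm w = word_perm w'"
proof -
  have "word_perm ([j..<Suc n] @ w) j = Suc n" "word_perm ([j'..<Suc n] @ w') j' = Suc n"
    using assms(1-4) by (intro word_perm_cycle_start; simp)+
  hence "word_perm ([j..<Suc n] @ w) j = word_perm ([j..<Suc n] @ w) j'" using eq by metis
  thus "j = j'" using bij_is_inj[OF word_perm_bij] by (rule injD[rotated])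
  thus "word_perm w = word_perm w'" using eq word_perm_cancel by blast
qed

lemma word_perm_inj: "inj_on word_perm (normal_words n)"
proof (induction n)
  case (Suc n)
  show ?case
  proof (rule inj_onI)
    fix u u' assume *: "u \<in> normal_words (Suc n)" "u' \<in> normal_words (Suc n)"
      "word_perm u = word_perm u'"
    obtain j w where u: "u = [j..<Suc n] @ w" "j \<in> {1..Suc n}" "w \<in> normal_words n"
      using *(1) by (auto simp del: upt_Suc)
    obtain j' w' where u': "u' = [j'..<Suc n] @ w'" "j' \<in> {1..Suc n}" "w' \<in> normal_words n"
      using *(2) by (auto simp del: upt_Suc)
    from word_perm_cycle_unique[OF u(3,2) u'(3,2)] * u(1) u'(1)
    show "u = u'" using Suc.IH u(3) u'(3) by (auto dest: inj_onD)
  qed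
qed simp

lemma word_perm_surj: "\<pi> permutes {1..n} \<Longrightarrow> \<pi> \<in> word_perm ` normal_words n"
proof (induction n arbitrary: \<pi>)
  case (Suc n)
  let ?N = "Suc n"
  define j where "j = inv \<pi> ?N"
  have "inv \<pi> permutes {1..?N}" using Suc.prems by (rule permutes_inv)
  hence j: "1 \<le> j" "j \<le> ?N" using permutes_in_image[of "inv \<pi>" "{1..?N}" ?N] by (auto simp: j_def)
  have \<pi>j: "\<pi> j = ?N" unfolding j_def using Suc.prems by (rule permutes_inverses)
  define c where "c = word_perm [j..<?N]"
  have c: "c permutes {1..?N}" unfolding c_def using j by (intro word_perm_permutes) auto
  have cj: "c j = ?N" unfolding c_def using j(2) by (rule word_perm_upt)
  hence inv_c: "inv c ?N = j" using permutes_inverses(2)[OF c] by metis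
  have "\<pi> \<circ> inv c permutes {1..?N}" using Suc.prems c by (intro permutes_compose permutes_inv)
  hence "\<pi> \<circ> inv c permutes {1..n}"
    by (rule permutes_superset) (auto simp: inv_c \<pi>j le_Suc_eq)
  from Suc.IH[OF this] obtain w where w: "w \<in> normal_words n" "\<pi> \<circ> inv c = word_perm w" by blast
  have "word_perm ([j..<?N] @ w) = \<pi> \<circ> (inv c \<circ> c)"
    by (simp add: word_perm_append w(2)[symmetric] c_def comp_assoc del: upt_Suc)
  also have "\<dots> = \<pi>" using permutes_inv_o(2)[OF c] by simp
  finally show ?case using normal_words_SucI[OF j w(1)] by blast
qed (simp add: id_def)

lemma word_perm_bij_normal: "bij_betw word_perm (normal_words n) {\<pi>. \<pi> permutes {1..n}}"
  unfolding bij_betw_def using word_perm_inj word_perm_surj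
    word_perm_permutes[OF normal_words_set] by auto

text \<open>
  By the exchange property, the normal word of the permutation of \<open>u\<close> is built up letter by letter
  with braid relations alone, unless at some letter the normal word becomes shorter; then \<open>u\<close> was
  not reduced. This contains the part of Matsumoto's theorem that is used: reduced words are
  equivalent to the normal word.
\<close>
lemma normal_form:
  assumes "set u \<subseteq> {1..<n}"
  shows "\<exists>w\<in>normal_words n. word_perm w = word_perm u \<and> (u \<approx> w \<or> length w < length u)"
  using assms
proof (induction u)
  case Nil
  show ?case using Nil_normal_words[of n] by fastforce
next
  case (Cons i u)
  then obtain w where w: "w \<in> normal_words n" "word_perm w = word_perm u"
    "u \<approx> w \<or> length w < length u" by auto
  from Cons.prems normal_words_step[OF w(1), of i] obtain w' where w': "w' \<in> normal_words n"
    "i # w \<approx> w' \<or> w \<approx> i # w'" by auto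
  from w'(2) show ?case
  proof
    assume *: "i # w \<approx> w'"
    have "word_perm w' = word_perm (i # u)"
      using braid_equiv_word_perm[OF *] w(2) by (simp add: word_perm_Cons)
    moreover have "i # u \<approx> w' \<or> length w' < length (i # u)"
      using w(3) braid_equiv_length[OF *] braid_trans[OF braid_equiv_Cons *] by auto
    ultimately show ?thesis using w'(1) by blast
  next
    assume *: "w \<approx> i # w'"
    have "word_perm (i # u) = word_perm (i # i # w')"
      using braid_equiv_word_perm[OF *] w(2) by (simp add: word_perm_Cons)
    hence "word_perm w' = word_perm (i # u)" by (simp add: word_perm_Cons comp_assoc)
    moreover have "length w' < length (i # u)"
      using w(3) braid_equiv_length[OF *] braid_equiv_length[of u w] by auto
    ultimately show ?thesis using w'(1) by blast
  qed
qed

lemma normal_words_shortest: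
  assumes "w \<in> normal_words n" "set u \<subseteq> {1..<n}" "word_perm u = word_perm w"
  shows "u \<approx> w \<or> length w < length u"
  using normal_form[OF assms(2)] assms(1,3) word_perm_inj[of n] by (metis inj_onD)

lemma perm_length_normal:
  assumes "w \<in> normal_words n"
  shows "perm_length n (word_perm w) = length w"
  unfolding perm_length_def
proof (rule Least_equality)
  show "\<exists>u. set u \<subseteq> {1..<n} \<and> word_perm u = word_perm w \<and> length u = length w"
    using normal_words_set[OF assms] by blast
next
  fix k assume "\<exists>u. set u \<subseteq> {1..<n} \<and> word_perm u = word_perm w \<and> length u = k"
  thus "length w \<le> k" using normal_words_shortest[OF assms] braid_equiv_length by fastforce
qed

lemma reduced_word_normal:
  assumes "w \<in> normal_words n" "reduced_word n (word_perm w) u"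
  shows "u \<approx> w" "set u \<subseteq> {1..<n}"
  using assms(2) normal_words_shortest[OF assms(1), of u] perm_length_normal[OF assms(1)]
  by (auto simp: reduced_word_def)

lemma reduced_word_exists:
  assumes "w \<in> normal_words n"
  shows "reduced_word n (word_perm w) w"
  using normal_words_set[OF assms] perm_length_normal[OF assms] by (simp add: reduced_word_def)

section \<open>Symmetrisers of a Hecke algebra\<close>

lemma finite_normal_words [simp]: "finite (normal_words n)"
  by (induction n) auto

text \<open>
  The value of a linear functional on the symmetriser with parameter \<open>x\<close> on the first \<open>n\<close> strings,
  the functional being given by its values on words.
\<close>
definition symm_sum :: "'a::comm_ring_1 \<Rightarrow> nat \<Rightarrow> (nat list \<Rightarrow> 'a) \<Rightarrow> 'a" where
  "symm_sum x n f = (\<Sum>w\<in>normal_words n. x ^ length w * f w)"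

lemma symm_sum_0 [simp]: "symm_sum x 0 f = f []"
  by (simp add: symm_sum_def)

lemma symm_sum_cong: "(\<And>w. w \<in> normal_words n \<Longrightarrow> f w = g w) \<Longrightarrow> symm_sum x n f = symm_sum x n g"
  by (simp add: symm_sum_def)

lemma symm_sum_add: "symm_sum x n (\<lambda>w. f w + g w) = symm_sum x n f + symm_sum x n g"
  by (simp add: symm_sum_def sum.distrib distrib_left)

lemma symm_sum_scale: "symm_sum x n (\<lambda>w. c * f w) = c * symm_sum x n f"
  by (simp add: symm_sum_def sum_distrib_left mult.left_commute)

lemma symm_sum_scale_right: "symm_sum x n (\<lambda>w. f w * c) = symm_sum x n f * c"
  using symm_sum_scale[of x n c f] by (simp add: mult.commute)

lemma symm_sum_swap:
  "symm_sum x n (\<lambda>v. symm_sum x m (f v)) = symm_sum x m (\<lambda>w. symm_sum x n (\<lambda>v. f v w))"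
proof -
  have "symm_sum x n (\<lambda>v. symm_sum x m (f v)) =
      (\<Sum>v\<in>normal_words n. \<Sum>w\<in>normal_words m. x ^ length v * (x ^ length w * f v w))"
    by (simp add: symm_sum_def sum_distrib_left)
  also have "\<dots> = (\<Sum>w\<in>normal_words m. \<Sum>v\<in>normal_words n. x ^ length w * (x ^ length v * f v w))"
    by (subst sum.swap) (simp add: mult.left_commute)
  finally show ?thesis by (simp add: symm_sum_def sum_distrib_left)
qed

lemma symm_sum_Suc:
  "symm_sum x (Suc n) f =
    (\<Sum>j = 1..Suc n. x ^ (Suc n - j) * symm_sum x n (\<lambda>w. f ([j..<Suc n] @ w)))"
proof -
  have "inj_on (\<lambda>(j, w). [j..<Suc n] @ w) ({1..Suc n} \<times> normal_words n)"
    by (rule inj_onI, clarify) (metis word_perm_cycle_unique(1) same_append_eq)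
  hence "symm_sum x (Suc n) f = (\<Sum>(j, w)\<in>{1..Suc n} \<times> normal_words n.
      x ^ length ([j..<Suc n] @ w) * f ([j..<Suc n] @ w))"
    unfolding symm_sum_def normal_words.simps by (subst sum.reindex) (simp_all add: case_prod_unfold del: upt_Suc)
  thus ?thesis
    by (simp add: sum.cartesian_product symm_sum_def sum_distrib_left power_add mult.assoc
        del: upt_Suc)
qed

text \<open>
  The sum of \<open>x\<^bsup>2l(\<pi>)\<^esup>\<close> over all permutations \<open>\<pi>\<close>, that is, the Poincare polynomial of the
  symmetric group at \<open>x\<^sup>2\<close>; each generator acts on the symmetriser as \<open>x\<close>, so that the square of
  the symmetriser is this multiple of it.
\<close>
definition poincare :: "'a::comm_ring_1 \<Rightarrow> nat \<Rightarrow> 'a" where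
  "poincare x n = symm_sum x n (\<lambda>w. x ^ length w)"

lemma poincare_0 [simp]: "poincare x 0 = 1"
  by (simp add: poincare_def)

definition qint :: "'a::comm_ring_1 \<Rightarrow> nat \<Rightarrow> 'a" where
  "qint x n = (\<Sum>k<n. (x * x) ^ k)"

lemma qint_0 [simp]: "qint x 0 = 0" and qint_Suc: "qint x (Suc n) = qint x n + x ^ (2 * n)"
  by (simp_all add: qint_def power_mult power2_eq_square)

lemma qint_geometric: "(x * x - 1) * qint x n = x ^ (2 * n) - 1"
  by (induction n) (simp_all add: qint_Suc algebra_simps)

lemma poincare_Suc: "poincare x (Suc n) = qint x (Suc n) * poincare x n"
proof -
  have "poincare x (Suc n) = (\<Sum>j = 1..Suc n. (x * x) ^ (Suc n - j) * poincare x n)"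
    unfolding poincare_def symm_sum_Suc length_append power_add symm_sum_scale length_upt
    by (simp only: power_mult_distrib mult.assoc)
  also have "\<dots> = qint x (Suc n) * poincare x n"
    unfolding qint_def sum_distrib_right[symmetric]
    by (subst sum.reindex_bij_witness[of _ "\<lambda>k. Suc n - k" "\<lambda>j. Suc n - j" "{..<Suc n}"]) auto
  finally show ?thesis .
qed

text \<open>
  A linear functional on the Hecke algebra on \<open>n\<close> strings, seen as a function on words. Working with
  functionals makes reversal of words, an anti-automorphism of the algebra, a mere
  substitution. As \<open>x\<close> is a root of \<open>x\<^sup>2 = 1 + x z\<close>, a generator can act as the scalar \<open>x\<close>.
\<close>
locale hecke_functional =
  fixes F :: "nat list \<Rightarrow> 'a::comm_ring_1" and n :: nat and x z :: 'a
  assumes equiv: "u \<approx> v \<Longrightarrow> F u = F v"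
    and skein: "1 \<le> i \<Longrightarrow> i < n \<Longrightarrow> F (u @ [i, i] @ v) = z * F (u @ [i] @ v) + F (u @ v)"
    and eigenvalue: "x * x = 1 + x * z"
begin

lemma equiv_context: "a \<approx> b \<Longrightarrow> F (u @ a @ v) = F (u @ b @ v)"
  by (intro equiv braid_equiv_context)

text \<open>
  Write \<open>T j\<close> for the part of the symmetriser that starts with the cycle \<open>[j..<Suc p]\<close>. For \<open>j\<close>
  other than \<open>i\<close> and \<open>i + 1\<close> the generator slides through the cycle and is absorbed by the smaller
  symmetriser. The other two parts are interchanged up to the quadratic relation: \<open>\<sigma>\<^sub>i\<close> sends
  \<open>T (i + 1)\<close> to \<open>T i\<close> and \<open>T i\<close> to \<open>z T i + T (i + 1)\<close>, so that \<open>x T i + T (i + 1)\<close> is an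
  eigenvector for the eigenvalue \<open>x\<close>.
\<close>
lemma symm_sum_generator:
  "p \<le> n \<Longrightarrow> 1 \<le> i \<Longrightarrow> i < p \<Longrightarrow>
    symm_sum x p (\<lambda>w. F (u @ i # w @ v)) = x * symm_sum x p (\<lambda>w. F (u @ w @ v))"
proof (induction p arbitrary: i u)
  case (Suc p)
  define T where "T j = symm_sum x p (\<lambda>w. F (u @ [j..<Suc p] @ w @ v))" for j
  define G where "G j = symm_sum x p (\<lambda>w. F (u @ i # [j..<Suc p] @ w @ v))" for j
  have slide: "G j = x * T j" if k: "1 \<le> k" "k < p" "i # [j..<Suc p] \<approx> [j..<Suc p] @ [k]" for j k
  proof -
    have "G j = symm_sum x p (\<lambda>w. F ((u @ [j..<Suc p]) @ k # w @ v))"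
      unfolding G_def using equiv_context[OF k(3), of u "w @ v" for w]
      by (intro symm_sum_cong) (simp del: upt_Suc)
    also have "\<dots> = x * symm_sum x p (\<lambda>w. F ((u @ [j..<Suc p]) @ w @ v))"
      using Suc.prems k by (intro Suc.IH) auto
    finally show ?thesis by (simp add: T_def del: upt_Suc)
  qed
  have others: "G j = x * T j" if "j \<in> {1..Suc p} - {i, Suc i}" for j
  proof (cases "i + 1 < j")
    case True
    thus ?thesis using that Suc.prems by (intro slide[of i] slide_below) auto
  next
    case False
    thus ?thesis using that Suc.prems by (intro slide[of "i - 1"] slide_above) auto
  qed
  have up: "[i..<Suc p] = i # [Suc i..<Suc p]" using Suc.prems by (simp add: upt_conv_Cons)
  have above: "G (Suc i) = T i"
    unfolding G_def T_def up by (simp del: upt_Suc)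
  have at: "G i = z * T i + T (Suc i)"
  proof -
    have "F (u @ i # [i..<Suc p] @ w @ v) =
        z * F (u @ [i..<Suc p] @ w @ v) + F (u @ [Suc i..<Suc p] @ w @ v)" for w
      using skein[of i u "[Suc i..<Suc p] @ w @ v"] Suc.prems unfolding up by (simp del: upt_Suc)
    thus ?thesis unfolding G_def T_def by (simp add: symm_sum_add symm_sum_scale)
  qed
  have pair: "x ^ (Suc p - i) * G i + x ^ (Suc p - Suc i) * G (Suc i) =
      x * (x ^ (Suc p - i) * T i + x ^ (Suc p - Suc i) * T (Suc i))"
  proof -
    have "Suc p - i = Suc (Suc p - Suc i)" using Suc.prems by simp
    hence "x ^ (Suc p - i) * G i + x ^ (Suc p - Suc i) * G (Suc i) =
        x ^ (Suc p - Suc i) * ((1 + x * z) * T i + x * T (Suc i))"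
      by (simp add: at above algebra_simps)
    also have "\<dots> = x * (x ^ (Suc p - i) * T i + x ^ (Suc p - Suc i) * T (Suc i))"
      unfolding eigenvalue[symmetric] using \<open>Suc p - i = _\<close> by (simp add: algebra_simps)
    finally show ?thesis .
  qed
  have split: "(\<Sum>j = 1..Suc p. f j) = (f i + f (Suc i)) + (\<Sum>j\<in>{1..Suc p} - {i, Suc i}. f j)"
    for f :: "nat \<Rightarrow> 'a"
    using sum.subset_diff[of "{i, Suc i}" "{1..Suc p}" f] Suc.prems by (simp add: add.commute)
  have "symm_sum x (Suc p) (\<lambda>w. F (u @ i # w @ v)) = (\<Sum>j = 1..Suc p. x ^ (Suc p - j) * G j)"
    unfolding symm_sum_Suc G_def by (simp del: upt_Suc)
  also have "\<dots> = x * (\<Sum>j = 1..Suc p. x ^ (Suc p - j) * T j)"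
    unfolding split pair distrib_left sum_distrib_left
    by (intro arg_cong2[of _ _ _ _ "(+)"] refl sum.cong) (simp_all add: others mult.left_commute)
  also have "(\<Sum>j = 1..Suc p. x ^ (Suc p - j) * T j) = symm_sum x (Suc p) (\<lambda>w. F (u @ w @ v))"
    unfolding symm_sum_Suc T_def by (simp del: upt_Suc)
  finally show ?case .
qed simp

lemma symm_sum_word:
  assumes "p \<le> n" "set a \<subseteq> {1..<p}"
  shows "symm_sum x p (\<lambda>w. F (u @ a @ w @ v)) = x ^ length a * symm_sum x p (\<lambda>w. F (u @ w @ v))"
  using assms(2)
proof (induction a arbitrary: u)
  case (Cons i a)
  have "symm_sum x p (\<lambda>w. F (u @ (i # a) @ w @ v)) = x ^ length a * symm_sum x p (\<lambda>w. F ((u @ [i]) @ w @ v))"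
    using Cons.IH[of "u @ [i]"] Cons.prems by simp
  thus ?case using symm_sum_generator[of p i u v] assms(1) Cons.prems by simp
qed simp

lemma mirror: "hecke_functional (\<lambda>w. F (rev w)) n x z"
proof
  show "F (rev u) = F (rev v)" if "u \<approx> v" for u v
    using that by (intro equiv braid_equiv_rev)
  show "F (rev (u @ [i, i] @ v)) = z * F (rev (u @ [i] @ v)) + F (rev (u @ v))"
    if "1 \<le> i" "i < n" for i u v
    using skein[OF that, of "rev v" "rev u"] by simp
qed (rule eigenvalue)

lemma symm_sum_rev_word:
  assumes "p \<le> n" "set a \<subseteq> {1..<p}"
  shows "symm_sum x p (\<lambda>w. F (u @ rev w @ a @ v)) =
    x ^ length a * symm_sum x p (\<lambda>w. F (u @ rev w @ v))"
  using hecke_functional.symm_sum_word[OF mirror assms(1), of "rev a" "rev v" "rev u"] assms(2)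
  by simp

text \<open>
  Let \<open>a\<close> be the symmetriser and \<open>a'\<close> its reversal. Generators act on \<open>a\<close> from the left and on
  \<open>a'\<close> from the right as the scalar \<open>x\<close>, so \<open>a' a\<close> is \<open>P a\<close> as well as \<open>P a'\<close>, where \<open>P\<close> is
  \<open>poincare x p\<close>. Cancelling the unit \<open>P\<close> gives \<open>a = a'\<close>.
\<close>
lemma symm_sum_rev:
  assumes "p \<le> n" "poincare x p dvd 1"
  shows "symm_sum x p (\<lambda>w. F (u @ rev w @ v)) = symm_sum x p (\<lambda>w. F (u @ w @ v))"
proof -
  obtain c where c: "1 = poincare x p * c" using assms(2) by (rule dvdE)
  have words: "set w \<subseteq> {1..<p}" if "w \<in> normal_words p" for w
    using that by (rule normal_words_set)
  have "poincare x p * symm_sum x p (\<lambda>w. F (u @ w @ v)) =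
      symm_sum x p (\<lambda>a. symm_sum x p (\<lambda>w. F (u @ rev a @ w @ v)))"
    unfolding poincare_def symm_sum_scale_right[symmetric]
    using symm_sum_word[OF assms(1), of "rev a" u v for a] words
    by (intro symm_sum_cong) simp
  also have "\<dots> = symm_sum x p (\<lambda>a. symm_sum x p (\<lambda>w. F (u @ rev w @ a @ v)))"
    by (rule symm_sum_swap)
  also have "\<dots> = poincare x p * symm_sum x p (\<lambda>w. F (u @ rev w @ v))"
    unfolding poincare_def symm_sum_scale_right[symmetric]
    using symm_sum_rev_word[OF assms(1), of a u v for a] words
    by (intro symm_sum_cong) simp
  finally have "c * (poincare x p * symm_sum x p (\<lambda>w. F (u @ w @ v))) =
    c * (poincare x p * symm_sum x p (\<lambda>w. F (u @ rev w @ v)))" by simp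
  thus ?thesis using c by (simp add: mult.assoc[symmetric] mult.commute[of c])
qed

lemma symm_sum_word_right:
  assumes "p \<le> n" "set a \<subseteq> {1..<p}" "poincare x p dvd 1"
  shows "symm_sum x p (\<lambda>w. F (u @ w @ a @ v)) = x ^ length a * symm_sum x p (\<lambda>w. F (u @ w @ v))"
  using symm_sum_rev_word[OF assms(1,2)] symm_sum_rev[OF assms(1,3)] by simp

end

section \<open>Closed braids in the skein of the annulus\<close>

definition annulus_class :: "annular \<Rightarrow> annulus_skein" where
  "annulus_class D = abs_annulus_skein (Poly_Mapping.single D 1)"

lemma annulus_class_eq: "same_annular D D' \<Longrightarrow> annulus_class D = annulus_class D'"
  by (simp add: annulus_class_def same_annular_def annulus_skein.abs_eq_iff)

lemma annulus_class_add: "annulus_class (D + D') = annulus_class D * annulus_class D'"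
  by (simp add: annulus_class_def times_annulus_skein.abs_eq mult_single)

lemma annulus_class_0: "annulus_class 0 = 1"
  by (simp add: annulus_class_def one_annulus_skein_def)

definition annulus_scalar :: "lam \<Rightarrow> annulus_skein" where
  "annulus_scalar c = c *\<^sub>C 1"

lemma scale_annulus_eq: "c *\<^sub>C y = annulus_scalar c * y"
  unfolding annulus_scalar_def by transfer (simp add: free_scale_times free.span_zero)

lemma annulus_scalar_hom:
  "annulus_scalar 0 = 0" "annulus_scalar 1 = 1"
  "annulus_scalar (a + b) = annulus_scalar a + annulus_scalar b"
  "annulus_scalar (a - b) = annulus_scalar a - annulus_scalar b"
  "annulus_scalar (a * b) = annulus_scalar a * annulus_scalar b"
proof -
  show "annulus_scalar 0 = 0" "annulus_scalar 1 = 1"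
    "annulus_scalar (a + b) = annulus_scalar a + annulus_scalar b"
    "annulus_scalar (a - b) = annulus_scalar a - annulus_scalar b"
    unfolding annulus_scalar_def
    by (transfer; simp add: free.span_zero free.scale_left_distrib free.scale_left_diff_distrib)+
  have "(a * b) *\<^sub>C 1 = a *\<^sub>C b *\<^sub>C 1" by transfer (simp add: free.span_zero)
  thus "annulus_scalar (a * b) = annulus_scalar a * annulus_scalar b"
    using scale_annulus_eq[of a "b *\<^sub>C 1"] by (simp add: annulus_scalar_def)
qed

lemma annulus_scalar_power: "annulus_scalar (a ^ k) = annulus_scalar a ^ k"
  by (induction k) (simp_all add: annulus_scalar_hom)

lemma annulus_scalar_sum: "annulus_scalar (sum f A) = (\<Sum>a\<in>A. annulus_scalar (f a))"
  by (induction A rule: infinite_finite_induct) (simp_all add: annulus_scalar_hom)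

lemma closure_map_add: "closure_map (a + b) = closure_map a + closure_map b"
  by transfer (simp add: free_map_add free.span_zero)

lemma closure_map_0: "closure_map 0 = 0"
  by transfer (simp add: free.span_zero)

lemma closure_map_scale: "closure_map (c *\<^sub>H a) = annulus_scalar c * closure_map a"
  unfolding scale_annulus_eq[symmetric] by transfer (simp add: free_map_scale free.span_zero)

lemma closure_map_sum: "closure_map (sum f A) = (\<Sum>a\<in>A. closure_map (f a))"
  by (induction A rule: infinite_finite_induct) (simp_all add: closure_map_add closure_map_0)

lemma closure_map_class: "closure_map (box_class D) = annulus_class (close_box D)"
  by (simp add: box_class_def annulus_class_def closure_map.abs_eq)

definition events :: "nat list \<Rightarrow> event list" where
  "events u = map (\<lambda>i. Crossing (i - 1) True) u"

lemma events_append: "events (u @ v) = events u @ events v"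
  by (simp add: events_def)

lemma tangle_crossing:
  assumes "1 \<le> i" "i < n"
  shows "tangle (replicate n Up) [Crossing (i - 1) b] (replicate n Up)"
proof -
  have n: "replicate n Up = replicate (i - 1) Up @ Up # Up # replicate (n - Suc i) Up"
  proof -
    have "n = (i - 1) + Suc (Suc (n - Suc i))" using assms by simp
    thus ?thesis by (metis replicate_add replicate_Suc)
  qed
  show ?thesis
    using after_split(1)[of "replicate (i - 1) Up" Up Up "replicate (n - Suc i) Up" b]
    unfolding n by simp
qed

lemma tangle_events: "set u \<subseteq> {1..<n} \<Longrightarrow> tangle (replicate n Up) (events u) (replicate n Up)"
proof (induction u)
  case (Cons i u)
  hence "tangle (replicate n Up) [Crossing (i - 1) True] (replicate n Up)"
    by (intro tangle_crossing) auto
  from tangle_appendI[OF this Cons.IH] Cons.prems show ?case by (simp add: events_def)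
qed (simp add: events_def)

lemma braid_eq_class: "set u \<subseteq> {1..<n} \<Longrightarrow> braid n u = box_class (box_of n (events u))"
proof (induction u)
  case Nil
  thus ?case by (simp add: braid_def box_one_def events_def)
next
  case (Cons i u)
  have i: "tangle (replicate n Up) [Crossing (i - 1) True] (replicate n Up)"
    using Cons.prems by (intro tangle_crossing) auto
  have u: "tangle (replicate n Up) (events u) (replicate n Up)"
    using Cons.prems by (intro tangle_events) auto
  have "braid n (i # u) = sigma n i * braid n u" by (simp add: braid_def)
  also have "\<dots> = box_class (box_of n [Crossing (i - 1) True]) * box_class (box_of n (events u))"
    using Cons by (simp add: sigma_def)
  also have "\<dots> = box_class (box_of n ([Crossing (i - 1) True] @ events u))"
    by (simp only: box_class_def times_box_skein.abs_eq stack_mult_single strings_box_of[OF i]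
        strings_box_of[OF u] stack_box_of[OF i u] simp_thms if_True mult_1)
  finally show ?case by (simp add: events_def)
qed

text \<open>
  The value \<open>0\<close> on words with a letter outside \<open>{1..<n}\<close> makes the braid relations and the
  rotation of words valid for all words.
\<close>
definition closed_braid :: "nat \<Rightarrow> nat list \<Rightarrow> annulus_skein" where
  "closed_braid n u = (if set u \<subseteq> {1..<n} then closure_map (braid n u) else 0)"

lemma closed_braid_class:
  assumes "set u \<subseteq> {1..<n}"
  shows "closed_braid n u = annulus_class (annular_of (replicate n Up) (events u))"
  using assms by (simp add: closed_braid_def braid_eq_class closure_map_class close_box_of tangle_events)

lemma closed_braid_0: "closed_braid 0 [] = 1"
  by (simp add: closed_braid_class events_def zero_annular_of[symmetric] annulus_class_0)

lemma closed_braid_rotate: "closed_braid n (u @ v) = closed_braid n (v @ u)"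
proof (cases "set (u @ v) \<subseteq> {1..<n}")
  case True
  hence "set u \<subseteq> {1..<n}" "set v \<subseteq> {1..<n}" by auto
  from annulus_class_eq[OF same_annular_rotate[OF this[THEN tangle_events]]] this True
  show ?thesis by (simp add: closed_braid_class events_append)
qed (auto simp: closed_braid_def)

lemma closed_braid_mult:
  assumes u: "set u \<subseteq> {1..<n}" and v: "set v \<subseteq> {1..<m}"
  shows "closed_braid n u * closed_braid m v = closed_braid (n + m) (u @ map ((+) n) v)"
proof -
  have "map (shift n) (events v) = events (map ((+) n) v)"
    using v by (induction v) (auto simp: events_def)
  moreover have "set (u @ map ((+) n) v) \<subseteq> {1..<n + m}" using u v by fastforce
  ultimately show ?thesis
    using u v by (simp add: closed_braid_class annulus_class_add[symmetric] plus_annular_of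
        tangle_events replicate_add events_append del: set_append)
qed

lemma closed_braid_same_tangle:
  assumes "set u \<subseteq> {1..<n}" "set v \<subseteq> {1..<n}"
    and "same_tangle (replicate n Up) a b (replicate n Up)"
  shows "annulus_class (annular_of (replicate n Up) (events u @ a @ events v)) =
    annulus_class (annular_of (replicate n Up) (events u @ b @ events v))"
  using same_tangle_context[OF assms(3), of _ _ "[]" "[]"] tangle_events[OF assms(1)] tangle_events[OF assms(2)]
  by (intro annulus_class_eq) simp

lemma closed_braid_equiv: "u \<approx> v \<Longrightarrow> closed_braid n u = closed_braid n v"
proof (induction rule: braid_equiv.induct)
  case (far_commute i j u v)
  show ?case
  proof (cases "set (u @ [i, j] @ v) \<subseteq> {1..<n}")
    case True
    \<comment> \<open>The interchange move locates the right event by its distance from the legs of the left one.\<close>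
    have "i - 1 + 2 + (j - 1 - (i + 1)) = j - 1" using far_commute True by simp
    hence "diagram_move [Crossing (i - 1) True, Crossing (j - 1) True]
        [Crossing (j - 1) True, Crossing (i - 1) True]"
      using diagram_move.interchange[of "Crossing (i - 1) True" "Crossing (j - 1 - (i + 1)) True"]
      by (simp only: pos.simps legs_above.simps legs_below.simps shift.simps)
    moreover have "tangle (replicate n Up) (events [i, j]) (replicate n Up)"
      "tangle (replicate n Up) (events [j, i]) (replicate n Up)"
      using True by (auto intro!: tangle_events)
    ultimately have "same_tangle (replicate n Up) (events [i, j]) (events [j, i]) (replicate n Up)"
      by (intro same_tangle_move) (simp_all add: events_def)
    from closed_braid_same_tangle[OF _ _ this, of u v] True show ?thesis
      by (simp add: closed_braid_class events_append del: append_Cons append_Nil)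
  next
    case False
    moreover have "set (u @ [j, i] @ v) = set (u @ [i, j] @ v)" by auto
    ultimately show ?thesis by (simp only: closed_braid_def if_False)
  qed
next
  case (braid_relation u i v)
  show ?case
  proof (cases "set (u @ [i, i + 1, i] @ v) \<subseteq> {1..<n}")
    case True
    hence "i - 1 + 1 = i" by simp
    hence "diagram_move (events [i, i + 1, i]) (events [i + 1, i, i + 1])"
      using diagram_move.R3[of True True True "i - 1"] by (simp add: events_def)
    moreover have "tangle (replicate n Up) (events [i, i + 1, i]) (replicate n Up)"
      "tangle (replicate n Up) (events [i + 1, i, i + 1]) (replicate n Up)"
      using True by (auto intro!: tangle_events)
    ultimately have "same_tangle (replicate n Up) (events [i, i + 1, i]) (events [i + 1, i, i + 1])
        (replicate n Up)"
      by (rule same_tangle_move)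
    from closed_braid_same_tangle[OF _ _ this, of u v] True show ?thesis
      by (simp add: closed_braid_class events_append del: append_Cons append_Nil)
  next
    case False
    moreover have "set (u @ [i + 1, i, i + 1] @ v) = set (u @ [i, i + 1, i] @ v)" by auto
    ultimately show ?thesis by (simp only: closed_braid_def if_False)
  qed
qed auto

text \<open>
  Multiplying \<open>\<sigma>\<^sub>i - \<sigma>\<^sub>i\<^sup>-\<^sup>1 = z\<close> by \<open>\<sigma>\<^sub>i\<close>: the skein relation is applied to the lower of the two
  crossings, and the diagram with the negative crossing is simplified by a Reidemeister move II.
\<close>
lemma closed_braid_skein:
  assumes i: "1 \<le> i" "i < n"
  shows "closed_braid n (u @ [i, i] @ v) =
    annulus_scalar var_z * closed_braid n (u @ [i] @ v) + closed_braid n (u @ v)"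
proof (cases "set (u @ v) \<subseteq> {1..<n}")
  case True
  let ?P = "replicate n Up" and ?c = "\<lambda>b. Crossing (i - 1) b"
  define D where "D w = annular_of ?P (events u @ w @ events ([i] @ v))" for w
  have u: "set u \<subseteq> {1..<n}" and v: "set v \<subseteq> {1..<n}" and iv: "set ([i] @ v) \<subseteq> {1..<n}"
    using True i by auto
  have c: "tangle ?P [?c b] ?P" for b using i by (rule tangle_crossing)
  have "Poly_Mapping.single (D [?c True]) 1 - Poly_Mapping.single (D [?c False]) 1
      - Poly_Mapping.single (D []) var_z \<in> annular_relations"
    by (rule annular_relations_local[OF local_relations.skein[OF c refl]
          tangle_events[OF u] tangle_events[OF iv]]) (simp add: D_def)
  hence "abs_annulus_skein (Poly_Mapping.single (D [?c True]) 1 - Poly_Mapping.single (D [?c False]) 1)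
      = abs_annulus_skein (Poly_Mapping.single (D []) var_z)"
    by (simp add: annulus_skein.abs_eq_iff free.span_base)
  moreover have "abs_annulus_skein (Poly_Mapping.single (D []) var_z) =
      annulus_scalar var_z * annulus_class (D [])"
    by (simp add: scale_annulus_eq[symmetric] annulus_class_def scale_annulus.abs_eq)
  ultimately have "annulus_class (D [?c True]) - annulus_class (D [?c False]) =
      annulus_scalar var_z * annulus_class (D [])"
    by (simp add: annulus_class_def minus_annulus_skein.abs_eq)
  moreover have "annulus_class (D [?c True]) = closed_braid n (u @ [i, i] @ v)"
    "annulus_class (D []) = closed_braid n (u @ [i] @ v)"
    using u v i by (simp_all add: D_def closed_braid_class events_def)
  moreover have "annulus_class (D [?c False]) = closed_braid n (u @ v)"
  proof -
    have "same_tangle ?P [?c False, ?c True] [] ?P"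
      using tangle_appendI[OF c c, of False True] by (intro same_tangle_move[OF R2_False]) auto
    from closed_braid_same_tangle[OF u v this] show ?thesis
      using u v by (simp add: D_def closed_braid_class events_def)
  qed
  ultimately show ?thesis by (simp add: algebra_simps)
next
  case False
  thus ?thesis by (auto simp: closed_braid_def)
qed

lemma closed_braid_hecke:
  assumes "x * x = 1 + x * var_z"
  shows "hecke_functional (closed_braid n) n (annulus_scalar x) (annulus_scalar var_z)"
proof
  show "annulus_scalar x * annulus_scalar x = 1 + annulus_scalar x * annulus_scalar var_z"
    using arg_cong[OF assms, of annulus_scalar] by (simp add: annulus_scalar_hom)
qed (fact closed_braid_equiv closed_braid_skein)+

lemma A_elem_eq: "A_elem m = closed_braid m (rev [1..<m])"
  by (simp add: A_elem_def closed_braid_def)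

section \<open>The recursion for closures of symmetrisers\<close>

lemma qint_unit:
  fixes x x' :: "'a::comm_ring_1"
  assumes "x * x' = 1" "(x ^ k - x' ^ k) dvd 1"
  shows "qint x k dvd 1"
proof -
  have "(x * x' ) ^ k = 1" using assms(1) by simp
  hence "(x * x - 1) * qint x k = x ^ k * (x ^ k - x' ^ k)"
    by (simp add: qint_geometric power_mult_distrib right_diff_distrib mult_2 power_add)
  moreover have "x ^ k * (x ^ k - x' ^ k) dvd 1"
  proof -
    have "x ^ k dvd 1" using \<open>(x * x') ^ k = 1\<close> by (metis dvd_triv_left power_mult_distrib)
    from mult_dvd_mono[OF this assms(2)] show ?thesis by simp
  qed
  ultimately show ?thesis by (metis dvd_mult_right)
qed

lemma poincare_unit:
  fixes x x' :: "'a::comm_ring_1"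
  assumes "x * x' = 1" "\<And>k. k \<ge> 1 \<Longrightarrow> (x ^ k - x' ^ k) dvd 1"
  shows "poincare x n dvd 1"
proof (induction n)
  case (Suc n)
  have "qint x (Suc n) dvd 1" using assms(1) by (rule qint_unit) (rule assms(2), simp)
  from mult_dvd_mono[OF this Suc] show ?case by (simp add: poincare_Suc)
qed simp

lemma annulus_scalar_qint: "annulus_scalar (qint x n) = qint (annulus_scalar x) n"
  by (simp add: qint_def annulus_scalar_sum annulus_scalar_power annulus_scalar_hom)

lemma annulus_scalar_poincare: "annulus_scalar (poincare x n) = poincare (annulus_scalar x) n"
  by (induction n) (simp_all add: poincare_Suc annulus_scalar_hom annulus_scalar_qint)

lemma annulus_scalar_unit: "c dvd 1 \<Longrightarrow> annulus_scalar c dvd 1"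
  by (metis annulus_scalar_hom(2,5) dvd_def)

text \<open>
  The symmetriser on the first \<open>p\<close> strings, with \<open>m\<close> further strings tied to its last string: the
  family has the symmetriser closure at \<open>m = 0\<close> and is closed under the recursion below.
  For \<open>p = 0 < m\<close> the word contains the letter \<open>0\<close> and the value is \<open>0\<close>; in the recursion it is
  multiplied by \<open>qint X 0 = 0\<close>.
\<close>
definition partial_closure :: "lam \<Rightarrow> nat \<Rightarrow> nat \<Rightarrow> annulus_skein" where
  "partial_closure x p m =
    symm_sum (annulus_scalar x) p (\<lambda>w. closed_braid (p + m) (rev [p..<p + m] @ w))"

text \<open>
  The symmetriser on \<open>p + 1\<close> strings is expanded by its first cycle \<open>[j..<Suc p]\<close>. For \<open>j = p + 1\<close>
  the cycle is empty and strings \<open>p + 1, \<dots>, p + m + 1\<close> are separate from the first \<open>p\<close>. For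
  \<open>j \<le> p\<close> the final letter \<open>p\<close> of the cycle extends the descending word by one string, while the
  other letters \<open>[j..<p]\<close> commute with that word, are rotated to the end and absorbed. Together with
  the weights \<open>x\<^bsup>p+1-j\<^esup>\<close> of the cycles, the powers of \<open>x\<close> that they leave add up to
  \<open>x (1 + x\<^sup>2 + \<cdots> + x\<^bsup>2(p-1)\<^esup>)\<close>.
\<close>
lemma partial_closure_Suc:
  assumes x: "x * x = 1 + x * var_z" and unit: "poincare x p dvd 1"
  shows "partial_closure x (Suc p) m = partial_closure x p 0 * A_elem (Suc m) +
    annulus_scalar x * qint (annulus_scalar x) p * partial_closure x p (Suc m)"
proof -
  let ?X = "annulus_scalar x" and ?F = "closed_braid (p + Suc m)"
  let ?R = "rev [Suc p..<Suc p + m]"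
  let ?T = "\<lambda>j. symm_sum ?X p (\<lambda>w. ?F (?R @ [j..<Suc p] @ w))"
  interpret hecke_functional ?F "p + Suc m" ?X "annulus_scalar var_z"
    by (rule closed_braid_hecke[OF x])
  have unit': "poincare ?X p dvd 1"
    using annulus_scalar_unit[OF unit] by (simp add: annulus_scalar_poincare)
  have last: "?T (Suc p) = partial_closure x p 0 * A_elem (Suc m)"
  proof -
    have R: "map ((+) p) (rev [1..<Suc m]) = ?R"
      by (induction m) auto
    have "?F (?R @ w) = closed_braid p w * A_elem (Suc m)" if "w \<in> normal_words p" for w
      using closed_braid_mult[OF normal_words_set[OF that], of "rev [1..<Suc m]" "Suc m"]
        closed_braid_rotate[of "p + Suc m" ?R w]
      unfolding R A_elem_eq by (simp del: upt_Suc)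
    thus ?thesis
      unfolding partial_closure_def symm_sum_scale_right[symmetric] by (intro symm_sum_cong) simp
  qed
  have others: "?T j = ?X ^ (p - j) * partial_closure x p (Suc m)" if j: "j \<in> {1..p}" for j
  proof -
    have Rp: "?R @ [p] = rev [p..<p + Suc m]"
      by (simp add: upt_conv_Cons[of p] del: upt_Suc)
    have "?F (?R @ [j..<Suc p] @ w) = ?F (rev [p..<p + Suc m] @ w @ [j..<p])" for w
    proof -
      have "?F (?R @ [j..<Suc p] @ w) = ?F ((?R @ [j..<p]) @ [p] @ w)" using j by simp
      also have "\<dots> = ?F (([j..<p] @ ?R) @ [p] @ w)"
        by (intro equiv braid_equiv_right far_append) auto
      also have "\<dots> = ?F (((?R @ [p]) @ w) @ [j..<p])"
        using closed_braid_rotate[of "p + Suc m" "[j..<p]" "(?R @ [p]) @ w"] by simp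
      finally show ?thesis unfolding Rp by simp
    qed
    moreover have "symm_sum ?X p (\<lambda>w. ?F (rev [p..<p + Suc m] @ w @ [j..<p])) =
        ?X ^ (p - j) * symm_sum ?X p (\<lambda>w. ?F (rev [p..<p + Suc m] @ w))"
      using symm_sum_word_right[of p "[j..<p]" "rev [p..<p + Suc m]" "[]"] j unit' by simp
    ultimately show ?thesis by (simp only: partial_closure_def)
  qed
  have qint: "(\<Sum>j = 1..p. (?X * ?X) ^ (p - j)) = qint ?X p"
    unfolding qint_def
    by (rule sum.reindex_bij_witness[of _ "\<lambda>k. p - k" "\<lambda>j. p - j"]) auto
  have "partial_closure x (Suc p) m = (\<Sum>j = 1..Suc p. ?X ^ (Suc p - j) * ?T j)"
    unfolding partial_closure_def symm_sum_Suc by (simp del: upt_Suc)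
  also have "\<dots> = ?T (Suc p) + (\<Sum>j = 1..p. ?X ^ (Suc p - j) * ?T j)"
    by (simp add: add.commute del: upt_Suc)
  also have "(\<Sum>j = 1..p. ?X ^ (Suc p - j) * ?T j) =
      (\<Sum>j = 1..p. ?X * partial_closure x p (Suc m) * (?X * ?X) ^ (p - j))"
  proof (rule sum.cong[OF HOL.refl])
    fix j assume j: "j \<in> {1..p}"
    hence "?X ^ (Suc p - j) = ?X * ?X ^ (p - j)" by (simp add: Suc_diff_le)
    thus "?X ^ (Suc p - j) * ?T j = ?X * partial_closure x p (Suc m) * (?X * ?X) ^ (p - j)"
      by (simp only: others[OF j]) (simp add: power_mult_distrib mult_ac)
  qed
  also have "\<dots> = ?X * qint ?X p * partial_closure x p (Suc m)"
    unfolding sum_distrib_left[symmetric] qint by (simp add: mult_ac)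
  finally show ?thesis unfolding last .
qed

text \<open>
  For \<open>x = s\<close> this is \<open>h\<^sub>n\<close>, and for \<open>x = -s\<^sup>-\<^sup>1\<close> it is \<open>e\<^sub>n\<close>.
\<close>
definition symmetriser_closure :: "lam \<Rightarrow> nat \<Rightarrow> annulus_skein" where
  "symmetriser_closure x n = closure_map
    (inverse (\<Sum>\<pi> | \<pi> permutes {1..n}. x ^ (2 * perm_length n \<pi>)) *\<^sub>H
      (\<Sum>\<pi> | \<pi> permutes {1..n}. x ^ perm_length n \<pi> *\<^sub>H perm_braid n \<pi>))"

lemma sum_permutations:
  "(\<Sum>\<pi> | \<pi> permutes {1..n}. x ^ perm_length n \<pi> * f \<pi>) = symm_sum x n (\<lambda>w. f (word_perm w))"
  unfolding symm_sum_def
  by (subst sum.reindex_bij_betw[OF word_perm_bij_normal, symmetric])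
    (simp add: perm_length_normal)

lemma closure_perm_braid:
  assumes "w \<in> normal_words n"
  shows "closure_map (perm_braid n (word_perm w)) = closed_braid n w"
proof -
  define u where "u = (SOME u. reduced_word n (word_perm w) u)"
  have "reduced_word n (word_perm w) u"
    unfolding u_def using reduced_word_exists[OF assms] by (rule someI)
  from reduced_word_normal[OF assms this] show ?thesis
    using closed_braid_equiv[of u w n] by (simp add: perm_braid_def u_def[symmetric] closed_braid_def)
qed

lemma symmetriser_closure_eq:
  "symmetriser_closure x n =
    annulus_scalar (inverse (poincare x n)) * symm_sum (annulus_scalar x) n (closed_braid n)"
proof -
  have "(\<Sum>\<pi> | \<pi> permutes {1..n}. x ^ (2 * perm_length n \<pi>)) = poincare x n"
    using sum_permutations[where f = "\<lambda>\<pi>. x ^ perm_length n \<pi>" and n = n and x = x]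
      symm_sum_cong[of n "\<lambda>w. x ^ perm_length n (word_perm w)" "\<lambda>w. x ^ length w" x]
    by (simp add: poincare_def perm_length_normal mult_2 power_add)
  moreover have "closure_map (\<Sum>\<pi> | \<pi> permutes {1..n}. x ^ perm_length n \<pi> *\<^sub>H perm_braid n \<pi>) =
      symm_sum (annulus_scalar x) n (closed_braid n)"
    unfolding closure_map_sum closure_map_scale annulus_scalar_power sum_permutations
    by (intro symm_sum_cong closure_perm_braid)
  ultimately show ?thesis unfolding symmetriser_closure_def closure_map_scale by simp
qed

lemma symmetriser_closure_0: "symmetriser_closure x 0 = 1"
proof -
  have "inverse (1 :: lam) = 1" by (rule lam_inverse_unit) simp
  thus ?thesis by (simp add: symmetriser_closure_eq closed_braid_0 annulus_scalar_hom)
qed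

text \<open>
  The common properties of \<open>s\<close> and \<open>-s\<^sup>-\<^sup>1\<close>. Units are needed to divide by the numbers
  \<open>1 + x\<^sup>2 + \<cdots> + x\<^bsup>2(k-1)\<^esup>\<close>, whose product is the normalising factor of the symmetriser.
\<close>
locale hecke_eigenvalue =
  fixes x x' :: lam
  assumes inverse: "x * x' = 1" and difference: "x - x' = var_z"
    and unit: "k \<ge> 1 \<Longrightarrow> (x ^ k - x' ^ k) dvd 1"
begin

lemma quadratic: "x * x = 1 + x * var_z"
  using inverse by (simp add: difference[symmetric] algebra_simps)

text \<open>
  After division by \<open>poincare x p\<close> the recursion for \<open>partial_closure\<close> relates \<open>qint X p * y p m\<close>
  to \<open>qint X (p - 1) * y (p - 1) (m + 1)\<close> and can be solved by iteration.
\<close>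
lemma symmetriser_closure_sum:
  defines "X \<equiv> annulus_scalar x"
  shows "qint X n * symmetriser_closure x n =
    (\<Sum>i<n. X ^ i * (symmetriser_closure x (n - Suc i) * A_elem (Suc i)))"
proof -
  define y where "y p m = annulus_scalar (inverse (poincare x p)) * partial_closure x p m" for p m
  have P: "poincare x p dvd 1" for p by (rule poincare_unit[OF inverse unit])
  have y0: "y p 0 = symmetriser_closure x p" for p
    by (simp add: y_def symmetriser_closure_eq partial_closure_def)
  have step: "qint X (Suc p) * y (Suc p) m = y p 0 * A_elem (Suc m) + X * qint X p * y p (Suc m)" for p m
  proof -
    have "poincare x (Suc p) * inverse (poincare x (Suc p)) = 1"
      using P[of "Suc p"] lam_inverse_unit by (metis dvdE)
    hence "inverse (poincare x p) = qint x (Suc p) * inverse (poincare x (Suc p))"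
      by (intro lam_inverse_unit) (simp add: poincare_Suc mult_ac)
    hence "qint X (Suc p) * y (Suc p) m =
        annulus_scalar (inverse (poincare x p)) * partial_closure x (Suc p) m"
      by (simp add: y_def X_def annulus_scalar_hom annulus_scalar_qint mult_ac)
    thus ?thesis
      unfolding y_def X_def partial_closure_Suc[OF quadratic P] by (simp add: algebra_simps)
  qed
  have "qint X p * y p m = (\<Sum>i<p. X ^ i * (y (p - Suc i) 0 * A_elem (Suc (m + i))))" for p m
  proof (induction p arbitrary: m)
    case (Suc p)
    have "X * qint X p * y p (Suc m) =
        (\<Sum>i<p. X ^ Suc i * (y (Suc p - Suc (Suc i)) 0 * A_elem (Suc (m + Suc i))))"
      unfolding mult.assoc Suc.IH by (simp add: sum_distrib_left mult.assoc)
    thus ?case unfolding step sum.lessThan_Suc_shift by simp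
  qed simp
  from this[of n 0] show ?thesis by (simp add: y0)
qed

text \<open>
  The coefficient of \<open>t\<^sup>n\<close> is the preceding identity multiplied by \<open>z x\<^bsup>1-n\<^esup>\<close>, because
  \<open>z x (1 + x\<^sup>2 + \<cdots> + x\<^bsup>2n-2\<^esup>) = x\<^bsup>2n\<^esup> - 1\<close>.
\<close>
lemma A_series_quotient:
  "A_series * fps_at (Abs_fps (symmetriser_closure x)) x' = fps_at (Abs_fps (symmetriser_closure x)) x"
proof (rule fps_ext)
  fix n
  let ?X = "annulus_scalar x" and ?X' = "annulus_scalar x'" and ?z = "annulus_scalar var_z"
  let ?h = "symmetriser_closure x"
  have XX': "?X * ?X' = 1" by (simp add: annulus_scalar_hom(5)[symmetric] inverse annulus_scalar_hom)
  have z: "?z * ?X = ?X * ?X - 1"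
    using arg_cong[OF quadratic, of annulus_scalar] by (simp add: annulus_scalar_hom mult.commute)
  have pow: "?X ^ i * ?X' ^ n = ?X' ^ (n - i)" if "i \<le> n" for i
  proof -
    have "?X ^ i * ?X' ^ n = (?X * ?X') ^ i * ?X' ^ (n - i)"
      using that by (simp add: power_mult_distrib mult.assoc power_add[symmetric])
    thus ?thesis by (simp add: XX')
  qed
  have "(\<Sum>i<n. ?z * A_elem (Suc i) * (?X' ^ (n - Suc i) * ?h (n - Suc i))) =
      (\<Sum>i<n. ?z * ?X * ?X' ^ n * (?X ^ i * (?h (n - Suc i) * A_elem (Suc i))))"
  proof (rule sum.cong[OF HOL.refl])
    fix i assume "i \<in> {..<n}"
    hence "?X' ^ (n - Suc i) = ?X * ?X ^ i * ?X' ^ n" using pow[of "Suc i"] by simp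
    thus "?z * A_elem (Suc i) * (?X' ^ (n - Suc i) * ?h (n - Suc i)) =
        ?z * ?X * ?X' ^ n * (?X ^ i * (?h (n - Suc i) * A_elem (Suc i)))" by (simp add: mult_ac)
  qed
  also have "\<dots> = ?X' ^ n * ((?X * ?X - 1) * qint ?X n) * ?h n"
    unfolding sum_distrib_left[symmetric] symmetriser_closure_sum[symmetric] z by (simp add: mult_ac)
  also have "\<dots> = (?X ^ n - ?X' ^ n) * ?h n"
  proof -
    have "?X' ^ n * (?X ^ (2 * n) - 1) = (?X ^ n * ?X' ^ n) * ?X ^ n - ?X' ^ n"
      unfolding mult_2 power_add by (simp add: right_diff_distrib mult_ac)
    thus ?thesis unfolding qint_geometric using pow[of n] by simp
  qed
  finally have main: "(\<Sum>i<n. ?z * A_elem (Suc i) * (?X' ^ (n - Suc i) * ?h (n - Suc i))) =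
      (?X ^ n - ?X' ^ n) * ?h n" .
  have "(A_series * fps_at (Abs_fps ?h) x') $ n =
      (\<Sum>i\<le>n. A_series $ i * (?X' ^ (n - i) * ?h (n - i)))"
    by (simp add: fps_mult_nth fps_at_def scale_annulus_eq annulus_scalar_power atLeast0AtMost)
  also have "\<dots> = ?X' ^ n * ?h n + (\<Sum>i<n. ?z * A_elem (Suc i) * (?X' ^ (n - Suc i) * ?h (n - Suc i)))"
    unfolding lessThan_Suc_atMost[symmetric] sum.lessThan_Suc_shift
    by (simp add: A_series_def scale_annulus_eq)
  also have "\<dots> = ?X ^ n * ?h n" unfolding main by (simp add: algebra_simps)
  finally show "(A_series * fps_at (Abs_fps ?h) x') $ n = fps_at (Abs_fps ?h) x $ n"
    by (simp add: fps_at_def scale_annulus_eq annulus_scalar_power)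
qed

end

section \<open>The series of the two symmetrisers\<close>

lemma fps_at_nth: "fps_at F c $ n = annulus_scalar c ^ n * F $ n"
  by (simp add: fps_at_def scale_annulus_eq annulus_scalar_power)

lemma fps_at_mult: "fps_at (F * G) c = fps_at F c * fps_at G c"
proof (rule fps_ext)
  fix n
  have "annulus_scalar c ^ i * F $ i * (annulus_scalar c ^ (n - i) * G $ (n - i)) =
      annulus_scalar c ^ n * (F $ i * G $ (n - i))" if "i \<in> {0..n}" for i
    using that power_add[of "annulus_scalar c" i "n - i"] by (simp add: mult_ac)
  thus "fps_at (F * G) c $ n = (fps_at F c * fps_at G c) $ n"
    by (simp add: fps_mult_nth fps_at_nth sum_distrib_left)
qed

lemma fps_at_fps_at: "fps_at (fps_at F a) b = fps_at F (a * b)"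
  by (rule fps_ext) (simp add: fps_at_nth annulus_scalar_hom power_mult_distrib mult_ac)

lemma fps_at_1: "fps_at 1 c = 1"
  by (rule fps_ext) (simp add: fps_at_nth)

lemma var_s_unit: "k \<ge> 1 \<Longrightarrow> (var_s ^ k - inverse var_s ^ k) dvd 1"
  using lam_loc_inverse by (metis dvd_triv_left)

interpretation H: hecke_eigenvalue var_s "inverse var_s"
  by standard (simp_all add: var_z_def var_s_unit)

interpretation E: hecke_eigenvalue "- inverse var_s" "- var_s"
proof
  fix k :: nat assume "k \<ge> 1"
  have sign: "(- inverse var_s) ^ k - (- var_s) ^ k =
      (- 1) ^ Suc k * (var_s ^ k - inverse var_s ^ k)"
    using power_minus[of var_s k] power_minus[of "inverse var_s" k] by (simp add: algebra_simps)
  have "(- 1 :: lam) ^ Suc k dvd 1" using dvd_power_same[of "- 1 :: lam" 1 "Suc k"] by simp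
  from mult_dvd_mono[OF this var_s_unit[OF \<open>k \<ge> 1\<close>]]
  show "((- inverse var_s) ^ k - (- var_s) ^ k) dvd 1" unfolding sign by simp
qed (simp_all add: var_z_def)

lemma H_series_eq: "H_series = Abs_fps (symmetriser_closure var_s)"
proof (rule fps_ext)
  fix n
  show "H_series $ n = Abs_fps (symmetriser_closure var_s) $ n"
    using symmetriser_closure_0[of var_s]
    by (cases "n = 0") (simp_all add: H_series_def h_elem_def symm_a_def symmetriser_closure_def)
qed

lemma E_series_eq: "E_series = Abs_fps (symmetriser_closure (- inverse var_s))"
proof (rule fps_ext)
  fix n
  have "inverse (- var_s) = - inverse var_s" by (rule lam_inverse_unit) simp
  thus "E_series $ n = Abs_fps (symmetriser_closure (- inverse var_s)) $ n"
    using symmetriser_closure_0[of "- inverse var_s"]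
    by (cases "n = 0") (simp_all add: E_series_def e_elem_def symm_b_def symmetriser_closure_def)
qed

text \<open>
  Both \<open>H(s t) E(-s t)\<close> and \<open>H(s\<^sup>-\<^sup>1 t) E(-s\<^sup>-\<^sup>1 t)\<close> are equal to
  \<open>A(t) H(s\<^sup>-\<^sup>1 t) E(-s t)\<close>, by the functional equations of \<open>H\<close> and \<open>E\<close>.
\<close>
lemma H_E_inverse: "H_series * fps_at E_series (- 1) = 1"
proof (rule fps_ext)
  fix n
  define G where "G = H_series * fps_at E_series (- 1)"
  have at: "fps_at G c = fps_at H_series c * fps_at E_series (- c)" for c
    by (simp add: G_def fps_at_mult fps_at_fps_at)
  have "fps_at G var_s = fps_at G (inverse var_s)"
    using H.A_series_quotient E.A_series_quotient
    unfolding at H_series_eq[symmetric] E_series_eq[symmetric]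
    by (metis mult.assoc mult.commute)
  hence eq: "annulus_scalar (var_s ^ n - inverse var_s ^ n) * G $ n = 0"
    using fps_at_nth[of G var_s n] fps_at_nth[of G "inverse var_s" n]
    by (simp add: annulus_scalar_hom annulus_scalar_power left_diff_distrib)
  show "G $ n = 1 $ n"
  proof (cases n)
    case 0
    thus ?thesis by (simp add: G_def fps_at_nth H_series_def E_series_def)
  next
    case (Suc k)
    then obtain c where "1 = annulus_scalar (var_s ^ n - inverse var_s ^ n) * c"
      using annulus_scalar_unit[OF var_s_unit[of n]] by (auto elim: dvdE)
    hence "G $ n = c * (annulus_scalar (var_s ^ n - inverse var_s ^ n) * G $ n)"
      by (simp add: mult.assoc[symmetric] mult.commute[of c])
    thus ?thesis using eq Suc by simp
  qed
qed

theorem theorem3p6: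
  shows "A_series = fps_quot (fps_at H_series var_s) (fps_at H_series (inverse var_s)) \<and>
    fps_quot (fps_at H_series var_s) (fps_at H_series (inverse var_s)) =
      fps_at H_series var_s * fps_at E_series (- inverse var_s)"
proof -
  let ?H = "fps_at H_series" and ?E = "fps_at E_series (- inverse var_s)"
  let ?Q = "fps_quot (?H var_s) (?H (inverse var_s))"
  have inv: "?H (inverse var_s) * ?E = 1"
    using arg_cong[OF H_E_inverse, of "\<lambda>F. fps_at F (inverse var_s)"]
    by (simp add: fps_at_mult fps_at_fps_at fps_at_1)
  have unique: "F = ?H var_s * ?E" if "F * ?H (inverse var_s) = ?H var_s" for F
    using that inv by (metis mult.assoc mult.right_neutral)
  have "A_series = ?H var_s * ?E"
    using H.A_series_quotient by (intro unique) (simp add: H_series_eq)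
  moreover have "?Q = ?H var_s * ?E"
    by (intro unique fps_quot_mult) (simp add: fps_at_nth H_series_def)
  ultimately show ?thesis by simp
qed

end
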